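(* Let $k$ be a positive integer and let $G$ be a $k$-crossing-critical graph with minimum degree $\delta$. Suppose $G$ contains a cycle $C$ with $\mu(C)=s$. Then $$ cr(G)\le\begin{cases} \displaystyle 2k+\frac{s-5}{2}, & \text{if } \delta=3;\\[2mm] \displaystyle 2k-sk(G)+\frac{\delta(s-\delta+2)}{2(\delta-2)}, & \text{if } \delta\ge 4. \end{cases} $$
   Context: All graphs are simple, connected, finite and undirected. A drawing of a graph $G$ assigns to each vertex a distinct point of the plane and to each edge $uv$ a continuous arc joining the points of $u$ and $v$ that passes through no other vertex point; $cr(D)$ is the number of crossings in a drawing $D$, and $cr(G)$ is the minimum of $cr(D)$ over all drawings of $G$. A graph $G$ is $k$-crossing-critical if $cr(G)\ge k$ but $cr(G\setminus e)<k$ for every edge $e\in E(G)$. For a cycle $C$ in $G$, $\mu(C)=\min_{v\in V(C)}\sum_{u\in V(C)\setminus\{v\}}(d_G(u)-2)$, where $d_G(u)$ is the degree of $u$ in $G$. The skewness $sk(G)$ is the minimum integer $t$ such that $G\setminus E_0$ is planar for some $E_0\subseteq E(G)$ with $|E_0|=t$. *)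

theory Defs
  imports "HOL-Analysis.Analysis"
begin

text \<open>A graph is given by its vertex set \<open>V\<close> and its set \<open>E\<close> of edges, an edge \<open>uv\<close> being
  the two-element set \<open>{u, v}\<close>. Deleting an edge \<open>e\<close> keeps all vertices: \<open>G - e\<close> is \<open>V\<close>
  together with \<open>E - {e}\<close>.\<close>

definition simple_graph :: "'a set \<Rightarrow> 'a set set \<Rightarrow> bool" where
  "simple_graph V E \<longleftrightarrow> finite V \<and> (\<forall>e\<in>E. e \<subseteq> V \<and> card e = 2)"

definition connected_graph :: "'a set \<Rightarrow> 'a set set \<Rightarrow> bool" where
  "connected_graph V E \<longleftrightarrow>
     V \<noteq> {} \<and> (\<forall>u\<in>V. \<forall>v\<in>V. (u, v) \<in> {(x, y). {x, y} \<in> E}\<^sup>*)"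

definition degree :: "'a set set \<Rightarrow> 'a \<Rightarrow> nat" where
  "degree E v = card {e \<in> E. v \<in> e}"

definition min_degree :: "'a set \<Rightarrow> 'a set set \<Rightarrow> nat" where
  "min_degree V E = Min (degree E ` V)"

text \<open>A cycle is given by the list of its vertices in cyclic order.\<close>

definition cycle_in :: "'a set set \<Rightarrow> 'a list \<Rightarrow> bool" where
  "cycle_in E C \<longleftrightarrow> 3 \<le> length C \<and> distinct C \<and>
     (\<forall>i < length C. {C ! i, C ! (Suc i mod length C)} \<in> E)"

definition cycle_mu :: "'a set set \<Rightarrow> 'a list \<Rightarrow> int" where
  "cycle_mu E C = Min ((\<lambda>v. \<Sum>u \<in> set C - {v}. (int (degree E u) - 2)) ` set C)"

text \<open>The plane is the type \<^typ>\<open>complex\<close>, for which the library states the Jordan curve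
  theorem. A drawing consists of a position for every vertex and a parametrised arc for every
  edge; the direction in which an edge is traversed is immaterial. Since \<^const>\<open>arc\<close> means an
  injective path, no edge crosses itself.\<close>

definition drawing ::
  "'a set \<Rightarrow> 'a set set \<Rightarrow> ('a \<Rightarrow> complex) \<Rightarrow> ('a set \<Rightarrow> real \<Rightarrow> complex) \<Rightarrow> bool" where
  "drawing V E pos \<gamma> \<longleftrightarrow> inj_on pos V \<and>
     (\<forall>e\<in>E. arc (\<gamma> e) \<and>
            {pathstart (\<gamma> e), pathfinish (\<gamma> e)} = pos ` e \<and>
            path_image (\<gamma> e) \<inter> pos ` (V - e) = {})"

text \<open>A crossing is a common point of two distinct edges that is not a common end of them. It is
  recorded together with the unordered pair of edges, so that a point lying on \<open>m\<close> edges is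
  counted once for each of the \<open>m choose 2\<close> pairs, and every common point is counted, adjacent
  edges included.\<close>

definition crossings ::
  "'a set \<Rightarrow> 'a set set \<Rightarrow> ('a \<Rightarrow> complex) \<Rightarrow> ('a set \<Rightarrow> real \<Rightarrow> complex) \<Rightarrow>
     ('a set set \<times> complex) set" where
  "crossings V E pos \<gamma> =
     {({e, f}, p) | e f p. e \<in> E \<and> f \<in> E \<and> e \<noteq> f \<and>
        p \<in> path_image (\<gamma> e) \<inter> path_image (\<gamma> f) - pos ` V}"

text \<open>The finiteness condition excludes drawings with infinitely many crossings, to which
  \<^const>\<open>card\<close> would assign \<open>0\<close>.\<close>

definition crossing_number :: "'a set \<Rightarrow> 'a set set \<Rightarrow> nat" where
  "crossing_number V E =
     (LEAST n. \<exists>pos \<gamma>. drawing V E pos \<gamma> \<and>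
        finite (crossings V E pos \<gamma>) \<and> card (crossings V E pos \<gamma>) = n)"

definition crossing_critical :: "nat \<Rightarrow> 'a set \<Rightarrow> 'a set set \<Rightarrow> bool" where
  "crossing_critical k V E \<longleftrightarrow>
     k \<le> crossing_number V E \<and> (\<forall>e\<in>E. crossing_number V (E - {e}) < k)"

definition planar_graph :: "'a set \<Rightarrow> 'a set set \<Rightarrow> bool" where
  "planar_graph V E \<longleftrightarrow> (\<exists>pos \<gamma>. drawing V E pos \<gamma> \<and> crossings V E pos \<gamma> = {})"

definition skewness :: "'a set \<Rightarrow> 'a set set \<Rightarrow> nat" where
  "skewness V E = (LEAST t. \<exists>E\<^sub>0\<subseteq>E. card E\<^sub>0 = t \<and> planar_graph V (E - E\<^sub>0))"

end

theory Submission
  imports Defs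
begin

text \<open>Let \<open>v\<close> attain the minimum in \<open>\<mu>(C)\<close>, let \<open>e = uv\<close> be an edge of \<open>C\<close> and \<open>P\<close> the rest of
  \<open>C\<close>. An optimal drawing of \<open>G - e\<close> has at most \<open>k - 1\<close> crossings, and \<open>e\<close> is restored next to an
  arc \<open>A\<close> from \<open>u\<close> to \<open>v\<close> contained in the drawing of \<open>P\<close>. On its two sides together \<open>A\<close> meets, at
  each of its inner vertices \<open>w\<close>, at most \<open>d(w) - 2\<close> germs of other edges, and \<open>2m - 2\<close> at a crossing
  of \<open>m\<close> edges; hence on the better side the new edge pays at most half the sum of the \<open>d(w) - 2\<close>, plus
  the number of crossings on \<open>P\<close>. That number is at most \<open>k - 1\<close>; it is also small when the skewness
  is large, since deleting \<open>C\<close> and one edge for every crossing off \<open>P\<close> leaves a planar graph.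

  The arcs being merely continuous, a parallel copy of \<open>A\<close> is not available. Instead, \<open>A\<close> is closed to a
  Jordan curve, and every germ on the chosen side is cut at one point, next to which the drawing is
  first made radial. By Janiszewski's theorem the remaining obstacles do not separate the two ends:
  the cut germs are pendant arcs, and the rest stays away from \<open>A\<close> on that side. So some arc
  joins the ends and meets the drawing only at the cut points.\<close>

section \<open>Straightening a drawing at finitely many points\<close>

text \<open>A continuous arc may spiral around one of its points, meeting every small circle and
  every segment to that point infinitely often. So a vertex cannot simply be approached along a
  segment, nor an edge be crossed once at a prescribed point. Replacing the drawing near the point
  by finitely many full radii cures both: the sectors between them are free, and all edges passing
  there are met in the centre alone.

  The constants arise as follows. For a cycle with n vertices there are at most (k - 1) + n - sk(G)
  crossings on P. Let B be the sum of d(w) - 2 over the vertices of C other than u and v. Each of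
  these n - 2 vertices contributes at least \<delta> - 2 to B, and u contributes at least \<delta> -
  2 to s, so (n - 2)(\<delta> - 2) \<le> B \<le> s - \<delta> + 2. Hence n - 2 + B/2 is at most
  (1/(\<delta> - 2) + 1/2)(s - \<delta> + 2), which is the fraction of the claim. The number 2m - 2
  counts the 2m branches at the crossing without the two taken by A; half of it is m - 1.\<close>

definition radial_at :: "complex set \<Rightarrow> complex \<Rightarrow> real \<Rightarrow> bool" where
  "radial_at X z r \<longleftrightarrow>
     (\<exists>Q. finite Q \<and> Q \<subseteq> sphere z r \<and> X \<inter> cball z r = (\<Union>q\<in>Q. closed_segment z q))"

text \<open>Two segments from \<open>z\<close> that share a second point lie on one ray, and on a
  ray the segment to the farther point contains the nearer one.\<close>

lemma same_ray:
  fixes z q x y :: complex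
  assumes "y \<in> closed_segment z x" "y \<in> closed_segment z q" "y \<noteq> z" "dist z x \<le> dist z q"
  shows "x \<in> closed_segment z q"
proof -
  obtain s where s: "0 \<le> s" "s \<le> 1" "y = z + s *\<^sub>R (x - z)"
    using assms(1) by (auto simp: in_segment algebra_simps)
  obtain t where t: "0 \<le> t" "t \<le> 1" "y = z + t *\<^sub>R (q - z)"
    using assms(2) by (auto simp: in_segment algebra_simps)
  have s0: "s > 0" using s assms(3) by (cases "s = 0") auto
  have st: "s *\<^sub>R (x - z) = t *\<^sub>R (q - z)" using s t by simp
  have xz: "x - z = (t / s) *\<^sub>R (q - z)"
    using arg_cong[OF st, of "\<lambda>w. (1/s) *\<^sub>R w"] s0 by (simp add: field_simps)
  have q0: "q \<noteq> z" using t assms(3) by auto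
  have "norm (x - z) = (t / s) * norm (q - z)" using xz s0 t by simp
  moreover have "norm (x - z) \<le> norm (q - z)"
    using assms(4) by (simp add: dist_norm norm_minus_commute)
  ultimately have "t / s \<le> 1" using q0 mult_le_cancel_right[of "t / s" "norm (q - z)" 1] by simp
  then show ?thesis
    using xz t s0 unfolding in_segment
    by (intro exI[of _ "t/s"]) (auto simp: algebra_simps)
qed

text \<open>A radius met outside the centre would by \<open>same_ray\<close> contain
  \<open>x\<close> itself. This is what radiality is for: the centre is reached in a straight line
  from every point of the disc off \<open>X\<close>.\<close>

lemma radial_at_segment:
  assumes "radial_at X z r" "x \<in> cball z r" "x \<notin> X"
  shows "closed_segment z x \<inter> X \<subseteq> {z}"
proof
  fix y assume y: "y \<in> closed_segment z x \<inter> X"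
  obtain Q where Q: "Q \<subseteq> sphere z r" "X \<inter> cball z r = (\<Union>q\<in>Q. closed_segment z q)"
    using assms(1) unfolding radial_at_def by blast
  have "r \<ge> 0" using assms(2) by (metis dist_self centre_in_cball empty_iff cball_eq_empty not_le)
  then have "closed_segment z x \<subseteq> cball z r"
    using assms(2) by (intro closed_segment_subset) auto
  then obtain q where q: "q \<in> Q" "y \<in> closed_segment z q" using y Q by blast
  show "y \<in> {z}"
  proof (rule ccontr)
    assume "y \<notin> {z}"
    then have "x \<in> closed_segment z q"
      using same_ray[of y z x q] y q Q assms(2) by auto
    then show False using q Q assms by blast
  qed
qed

text \<open>Each of the finitely many radii meets the circle of radius \<open>s\<close> in one
  point, while the circle is infinite.\<close>

lemma radial_at_point:
  assumes "radial_at X z r" "0 < s" "s \<le> r"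
  obtains x where "dist z x = s" "x \<notin> X"
proof -
  obtain Q where Q: "finite Q" "Q \<subseteq> sphere z r" "X \<inter> cball z r = (\<Union>q\<in>Q. closed_segment z q)"
    using assms(1) unfolding radial_at_def by blast
  have inf: "infinite (sphere z s)"
  proof
    assume "finite (sphere z s)"
    moreover have "connected (sphere z s)" by (rule connected_sphere) simp
    moreover have "z + of_real s \<in> sphere z s" "z - of_real s \<in> sphere z s" "z + of_real s \<noteq> z - of_real s"
      using assms by (auto simp: dist_norm)
    ultimately show False
      using connected_finite_iff_sing[of "sphere z s"] by (metis empty_iff singletonD)
  qed
  let ?f = "\<lambda>q. z + (s / r) *\<^sub>R (q - z)"
  have "sphere z s \<inter> X \<subseteq> ?f ` Q"
  proof
    fix x assume x: "x \<in> sphere z s \<inter> X"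
    then have "x \<in> cball z r" using assms by auto
    then obtain q where q: "q \<in> Q" "x \<in> closed_segment z q" using x Q by blast
    then obtain t where t: "0 \<le> t" "t \<le> 1" "x = z + t *\<^sub>R (q - z)"
      by (auto simp: in_segment algebra_simps)
    have "norm (q - z) = r" using q Q by (auto simp: dist_norm norm_minus_commute)
    moreover have "norm (x - z) = s" using x by (auto simp: dist_norm norm_minus_commute)
    ultimately have "t * r = s" using t by auto
    then have "t = s / r" using assms by (auto simp: field_simps)
    then show "x \<in> ?f ` Q" using q t by blast
  qed
  then have "finite (sphere z s \<inter> X)" using Q(1) finite_surj by blast
  then obtain x where "x \<in> sphere z s" "x \<notin> X" using inf
    by (metis IntI finite_subset subsetI)
  then show ?thesis using that by auto
qed

text \<open>The arc may leave and re-enter the disc infinitely often. Up to its last time in the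
  closed disc it is replaced by the radius to the point \<open>q\<close> where it leaves for good.
  The radius \<open>r\<close> stays free below \<open>r0\<close> because all edges through
  \<open>z\<close> will have to use the same one.\<close>

lemma straighten_arc_start:
  fixes g :: "real \<Rightarrow> complex"
  assumes g: "arc g" and z: "pathstart g = z" and N: "open N" "z \<in> N"
  obtains r0 where "r0 > 0" "\<And>r. 0 < r \<Longrightarrow> r < r0 \<Longrightarrow>
     \<exists>g' q S. arc g' \<and> pathstart g' = z \<and> pathfinish g' = pathfinish g \<and>
       q \<in> path_image g \<and> dist z q = r \<and> S \<subseteq> path_image g - cball z r \<and>
       path_image g' = closed_segment z q \<union> S \<and> path_image g' - N = path_image g - N"
proof -
  have cg: "continuous_on {0..1} g" using g by (simp add: arc_def path_def)
  have inj: "inj_on g {0..1}" using g by (simp add: arc_def)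
  have g0: "g 0 = z" using z by (simp add: pathstart_def)
  obtain d where d: "d > 0" "ball z d \<subseteq> N" using N open_contains_ball by blast
  obtain \<eta>0 where \<eta>0: "\<eta>0 > 0" "\<And>t. t \<in> {0..1} \<Longrightarrow> dist t 0 < \<eta>0 \<Longrightarrow> dist (g t) (g 0) < d"
    using cg d(1) unfolding continuous_on_iff by (metis atLeastAtMost_iff order_refl zero_le_one)
  define \<eta> where "\<eta> = min (\<eta>0/2) (1/2)"
  have \<eta>: "0 < \<eta>" "\<eta> < 1" "\<And>t. 0 \<le> t \<Longrightarrow> t \<le> \<eta> \<Longrightarrow> g t \<in> N"
  proof -
    show "0 < \<eta>" "\<eta> < 1" using \<eta>0 by (auto simp: \<eta>_def)
    show "g t \<in> N" if "0 \<le> t" "t \<le> \<eta>" for t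
    proof -
      have "t \<in> {0..1}" "dist t 0 < \<eta>0" using that \<eta>0 by (auto simp: \<eta>_def dist_real_def)
      then have "g t \<in> ball z d" using \<eta>0(2)[of t] g0 by (simp add: dist_commute)
      then show ?thesis using d by blast
    qed
  qed
  \<comment> \<open>After time \<eta> the arc keeps a positive distance \<open>r1\<close> from
    \<open>z\<close>. For \<open>r\<close> below \<open>r1\<close> the last visit to the disc
    therefore falls into the time spent in \<open>N\<close>, and nothing changes outside
    \<open>N\<close>.\<close>
  have comp: "compact (g ` {\<eta>..1})"
    using cg \<eta> by (intro compact_continuous_image continuous_on_subset[OF cg]) auto
  have "z \<notin> g ` {\<eta>..1}"
  proof
    assume "z \<in> g ` {\<eta>..1}"
    then obtain t where "t \<in> {\<eta>..1}" "g t = g 0" using g0 by auto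
    then show False using inj_onD[OF inj, of t 0] \<eta> by auto
  qed
  then obtain r1 where r1: "r1 > 0" "\<And>y. y \<in> g ` {\<eta>..1} \<Longrightarrow> r1 \<le> dist z y"
    using separate_point_closed[of "g ` {\<eta>..1}" z] comp compact_imp_closed by blast
  show ?thesis
  proof (rule that[of "min r1 d"])
    show "min r1 d > 0" using r1 d by simp
    fix r assume r: "0 < r" "r < min r1 d"
    define T where "T = {t\<in>{0..1}. g t \<in> cball z r}"
    have T0: "0 \<in> T" using g0 r by (auto simp: T_def)
    have Tc: "compact T"
    proof -
      have "closed ({0..1} \<inter> g -` cball z r)"
        using cg by (intro continuous_closed_preimage) auto
      then show ?thesis
        by (auto simp: T_def compact_eq_bounded_closed vimage_def Int_def intro: bounded_subset[of "{0..1}"])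
    qed
    obtain u where u: "u \<in> T" "\<And>t. t \<in> T \<Longrightarrow> t \<le> u"
      using compact_attains_sup[OF Tc] T0 by blast
    have u\<eta>: "u < \<eta>"
    proof (rule ccontr)
      assume "\<not> u < \<eta>"
      then have "g u \<in> g ` {\<eta>..1}" using u by (auto simp: T_def)
      then show False using r1(2)[of "g u"] u r by (auto simp: T_def)
    qed
    have u01: "0 \<le> u" "u < 1" using u T0 u\<eta> \<eta> by (auto simp: T_def)
    have after: "dist z (g t) > r" if "u < t" "t \<le> 1" for t
    proof -
      have "t \<notin> T" using u(2)[of t] that by auto
      then show ?thesis using that u01 by (simp add: T_def)
    qed
    \<comment> \<open>The last visit is on the circle: all later points are outside the disc, so
      their limit is not in the open disc.\<close>
    have du: "dist z (g u) = r"
    proof (rule antisym)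
      show "dist z (g u) \<le> r" using u by (auto simp: T_def)
      show "r \<le> dist z (g u)"
      proof -
        have "closure {u<..1} = {u..1}" using u01 by simp
        moreover have "g ` closure {u<..1} \<subseteq> - ball z r"
        proof (rule image_closure_subset)
          show "continuous_on (closure {u<..1}) g"
            using u01 by (auto intro: continuous_on_subset[OF cg])
          show "g ` {u<..1} \<subseteq> - ball z r" using after by force
        qed auto
        ultimately have "g ` {u..1} \<subseteq> - ball z r" by simp
        moreover have "g u \<in> g ` {u..1}" using u01 by simp
        ultimately have "g u \<in> - ball z r" by blast
        then show ?thesis by auto
      qed
    qed
    have uz: "g u \<noteq> z" using du r by auto
    let ?h = "subpath u 1 g"
    let ?g = "linepath z (g u) +++ ?h"
    have h: "arc ?h" using g u01 by (intro arc_subpath_arc) auto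
    have imh: "path_image ?h = g ` {u..1}" using u01 by (simp add: path_image_subpath)
    have seg: "closed_segment z (g u) \<subseteq> cball z r"
      using du r by (intro closed_segment_subset) auto
    have "arc ?g"
    proof (rule arc_join)
      show "arc (linepath z (g u))" using uz by (simp add: arc_linepath)
      show "pathfinish (linepath z (g u)) = pathstart ?h" by simp
      show "path_image (linepath z (g u)) \<inter> path_image ?h \<subseteq> {pathstart ?h}"
      proof
        fix y assume y: "y \<in> path_image (linepath z (g u)) \<inter> path_image ?h"
        then obtain t where t: "t \<in> {u..1}" "y = g t" using imh by auto
        have "dist z y \<le> r" using y seg by auto
        then show "y \<in> {pathstart ?h}" using t after[of t] by (cases "t = u") auto
      qed
    qed (rule h)
    moreover have "path_image ?g = closed_segment z (g u) \<union> g ` {u..1}"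
      by (simp add: path_image_join imh)
    moreover have "g ` {u<..1} \<subseteq> path_image g - cball z r"
      using after u01 by (fastforce simp: path_image_def)
    moreover have "{u..1} = insert u {u<..1}" using u01 by auto
    moreover have "path_image ?g - N = path_image g - N"
    proof -
      have "cball z r \<subseteq> N" using d(2) r by auto
      moreover have "path_image g = g ` {0..u} \<union> g ` {u..1}"
        unfolding path_image_def using u01 by (metis image_Un ivl_disj_un_two_touch(4) less_eq_real_def)
      moreover have "g ` {0..u} \<subseteq> N" using \<eta>(3) u\<eta> by auto
      ultimately show ?thesis using seg by (auto simp: path_image_join imh)
    qed
    moreover have "g u \<in> path_image g" using u01 by (auto simp: path_image_def)
    ultimately show "\<exists>g' q S. arc g' \<and> pathstart g' = z \<and> pathfinish g' = pathfinish g \<and>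
       q \<in> path_image g \<and> dist z q = r \<and> S \<subseteq> path_image g - cball z r \<and>
       path_image g' = closed_segment z q \<union> S \<and> path_image g' - N = path_image g - N"
      using du by (intro exI[of _ ?g] exI[of _ "g u"] exI[of _ "g ` {u<..1}"])
        (auto simp: pathfinish_def[of g])
  qed
qed

lemma closed_segment_far_point:
  fixes z q y :: complex
  assumes "y \<in> closed_segment z q" "dist z q \<le> dist z y"
  shows "y = q"
proof -
  obtain t where t: "0 \<le> t" "t \<le> 1" "y = z + t *\<^sub>R (q - z)"
    using assms(1) by (auto simp: in_segment algebra_simps)
  have "norm (q - z) \<le> t * norm (q - z)"
    using assms(2) t by (simp add: dist_norm norm_minus_commute)
  then have "t = 1 \<or> q = z"
    using t by (metis antisym eq_iff_diff_eq_0 less_eq_real_def mult.left_neutral mult_right_le_imp_le zero_less_norm_iff)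
  then show ?thesis using t by auto
qed

lemma arc_common_start_join:
  fixes g1 g2 :: "real \<Rightarrow> 'a::t2_space"
  assumes "arc g1" "arc g2" "pathstart g1 = z" "pathstart g2 = z"
    "path_image g2 \<inter> path_image g1 \<subseteq> {z}"
  shows "arc (reversepath g2 +++ g1)"
  using assms by (intro arc_join) (auto simp: arc_reversepath)

lemma arc_split:
  fixes g :: "real \<Rightarrow> 'a::real_normed_vector"
  assumes "arc g" "0 < t" "t < 1"
  shows "arc (subpath t 1 g)" "arc (subpath t 0 g)"
    "path_image (subpath t 1 g) = g ` {t..1}" "path_image (subpath t 0 g) = g ` {0..t}"
    "path_image g = path_image (subpath t 0 g) \<union> path_image (subpath t 1 g)"
    "path_image (subpath t 0 g) \<inter> path_image (subpath t 1 g) = {g t}"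
proof -
  show "arc (subpath t 1 g)" "arc (subpath t 0 g)"
    using assms by (auto intro!: arc_subpath_arc)
  show 1: "path_image (subpath t 1 g) = g ` {t..1}"
    and 2: "path_image (subpath t 0 g) = g ` {0..t}"
    using assms by (auto simp: path_image_subpath)
  have "{0..1} = {0..t} \<union> {t..1::real}" using assms by auto
  then show "path_image g = path_image (subpath t 0 g) \<union> path_image (subpath t 1 g)"
    unfolding 1 2 unfolding path_image_def by (simp only: image_Un)
  have "inj_on g {0..1}" using assms by (simp add: arc_def)
  then have "g ` {0..t} \<inter> g ` {t..1} = g ` ({0..t} \<inter> {t..1})"
    using assms by (subst inj_on_image_Int[of g "{0..1}"]) auto
  then show "path_image (subpath t 0 g) \<inter> path_image (subpath t 1 g) = {g t}"
    unfolding 1 2 using assms by auto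
qed

text \<open>An inner point splits the arc into two halves, straightened separately with the same
  radius. The two new radii do not overlap, since their outer ends are distinct points of the
  original arc. A conclusion for \<open>at_right 0\<close> lets the smallness conditions of several
  arcs be combined.\<close>

lemma straighten_arc:
  fixes g :: "real \<Rightarrow> complex"
  assumes g: "arc g" and z: "z \<in> path_image g" and N: "open N" "z \<in> N"
  shows "\<forall>\<^sub>F r in at_right 0. \<exists>g' Q S. arc g' \<and> pathstart g' = pathstart g \<and> pathfinish g' = pathfinish g \<and>
       finite Q \<and> Q \<subseteq> path_image g \<inter> sphere z r \<and> S \<subseteq> path_image g - cball z r \<and>
       path_image g' = (\<Union>q\<in>Q. closed_segment z q) \<union> S \<and> path_image g' - N = path_image g - N"
proof -
  have start: "\<forall>\<^sub>F r in at_right 0. \<exists>g' q S. arc g' \<and> pathstart g' = z \<and> pathfinish g' = pathfinish g \<and>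
       q \<in> path_image g \<and> dist z q = r \<and> S \<subseteq> path_image g - cball z r \<and>
       path_image g' = closed_segment z q \<union> S \<and> path_image g' - N = path_image g - N"
    if "arc g" "pathstart g = z" for g :: "real \<Rightarrow> complex"
    using straighten_arc_start[OF that N] unfolding eventually_at_right_field by metis
  obtain t where t: "t \<in> {0..1}" "g t = z" using z by (auto simp: path_image_def)
  consider "t = 0" | "t = 1" | "0 < t" "t < 1" using t by force
  then show ?thesis
  proof cases
    case 1
    then have "pathstart g = z" using t by (simp add: pathstart_def)
    from start[OF g this] show ?thesis
    proof (rule eventually_mono, elim exE conjE)
      fix r g' q S
      assume "arc g'" "pathstart g' = z" "pathfinish g' = pathfinish g"
       "q \<in> path_image g" "dist z q = r" "S \<subseteq> path_image g - cball z r"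
       "path_image g' = closed_segment z q \<union> S" "path_image g' - N = path_image g - N"
      then show "\<exists>g' Q S. arc g' \<and> pathstart g' = pathstart g \<and> pathfinish g' = pathfinish g \<and>
       finite Q \<and> Q \<subseteq> path_image g \<inter> sphere z r \<and> S \<subseteq> path_image g - cball z r \<and>
       path_image g' = (\<Union>q\<in>Q. closed_segment z q) \<union> S \<and> path_image g' - N = path_image g - N"
        using \<open>pathstart g = z\<close>
        by (intro exI[of _ g'] exI[of _ "{q}"] exI[of _ S]) auto
    qed
  next
    case 2
    then have "pathstart (reversepath g) = z" using t by (simp add: pathfinish_def)
    have "arc (reversepath g)" using g by (simp add: arc_reversepath)
    from start[OF this \<open>pathstart (reversepath g) = z\<close>] show ?thesis
    proof (rule eventually_mono, elim exE conjE)
      fix r g' q S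
      assume "arc g'" "pathstart g' = z" "pathfinish g' = pathfinish (reversepath g)"
       "q \<in> path_image (reversepath g)" "dist z q = r" "S \<subseteq> path_image (reversepath g) - cball z r"
       "path_image g' = closed_segment z q \<union> S" "path_image g' - N = path_image (reversepath g) - N"
      then show "\<exists>g' Q S. arc g' \<and> pathstart g' = pathstart g \<and> pathfinish g' = pathfinish g \<and>
       finite Q \<and> Q \<subseteq> path_image g \<inter> sphere z r \<and> S \<subseteq> path_image g - cball z r \<and>
       path_image g' = (\<Union>q\<in>Q. closed_segment z q) \<union> S \<and> path_image g' - N = path_image g - N"
        using \<open>pathstart (reversepath g) = z\<close>
        by (intro exI[of _ "reversepath g'"] exI[of _ "{q}"] exI[of _ S]) (auto simp: arc_reversepath)
    qed
  next
    case 3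
    note sp = arc_split[OF g 3]
    let ?g1 = "subpath t 1 g" and ?g2 = "subpath t 0 g"
    have p: "pathstart ?g1 = z" "pathstart ?g2 = z" using t by auto
    from eventually_conj[OF start[OF sp(1) p(1)] eventually_conj[OF start[OF sp(2) p(2)] eventually_at_right_less]]
    show ?thesis
    proof (rule eventually_mono, elim exE conjE)
      fix r g1 q1 S1 g2 q2 S2
      assume 1: "arc g1" "pathstart g1 = z" "pathfinish g1 = pathfinish ?g1"
        "q1 \<in> path_image ?g1" "dist z q1 = r" "S1 \<subseteq> path_image ?g1 - cball z r"
        "path_image g1 = closed_segment z q1 \<union> S1" "path_image g1 - N = path_image ?g1 - N"
      assume 2: "arc g2" "pathstart g2 = z" "pathfinish g2 = pathfinish ?g2"
        "q2 \<in> path_image ?g2" "dist z q2 = r" "S2 \<subseteq> path_image ?g2 - cball z r"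
        "path_image g2 = closed_segment z q2 \<union> S2" "path_image g2 - N = path_image ?g2 - N"
      assume r: "0 < r"
      have meet: "path_image ?g2 \<inter> path_image ?g1 = {z}" using sp(6) t by simp
      have qz: "q1 \<noteq> z" "q2 \<noteq> z" using 1(5) 2(5) r by auto
      have "path_image g2 \<inter> path_image g1 \<subseteq> {z}"
      proof
        fix y assume y: "y \<in> path_image g2 \<inter> path_image g1"
        show "y \<in> {z}"
        proof (rule ccontr)
          assume yz: "y \<notin> {z}"
          consider "y \<in> closed_segment z q2" "y \<in> closed_segment z q1"
            | "y \<in> closed_segment z q2" "y \<in> S1" | "y \<in> S2" "y \<in> closed_segment z q1" | "y \<in> S2" "y \<in> S1"
            using y 1(7) 2(7) by blast
          then show False
          proof cases
            case 1
            then have "q2 \<in> closed_segment z q1" using same_ray[of y z q2 q1] yz \<open>dist z q1 = r\<close> 2(5) by auto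
            then have "q2 = q1" using closed_segment_far_point \<open>dist z q1 = r\<close> 2(5) by simp
            then show False using meet qz \<open>q1 \<in> _\<close> 2(4) by blast
          next
            case a: 2
            then have "y = q2" using 2(5) 1(6) closed_segment_far_point[of y z q2] by force
            then show False using a(2) 1(6) 2(4) meet yz by blast
          next
            case a: 3
            then have "y = q1" using 2(6) 1(5) closed_segment_far_point[of y z q1] by force
            then show False using a(1) 2(6) 1(4) meet yz by blast
          next
            case 4
            then show False using 1(6) 2(6) meet yz by blast
          qed
        qed
      qed
      then have "arc (reversepath g2 +++ g1)"
        using 1 2 by (intro arc_common_start_join) auto
      moreover have "path_image (reversepath g2 +++ g1) = path_image g2 \<union> path_image g1"
        using 1 2 by (simp add: path_image_join)
      ultimately show "\<exists>g' Q S. arc g' \<and> pathstart g' = pathstart g \<and> pathfinish g' = pathfinish g \<and>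
       finite Q \<and> Q \<subseteq> path_image g \<inter> sphere z r \<and> S \<subseteq> path_image g - cball z r \<and>
       path_image g' = (\<Union>q\<in>Q. closed_segment z q) \<union> S \<and> path_image g' - N = path_image g - N"
        using 1 2 sp(5)
        by (intro exI[of _ "reversepath g2 +++ g1"] exI[of _ "{q1,q2}"] exI[of _ "S1 \<union> S2"])
           (auto simp: pathstart_def[of g] pathfinish_def[of g])
    qed
  qed
qed

section \<open>Straightening a whole drawing\<close>

definition edges_image :: "'b set \<Rightarrow> ('b \<Rightarrow> real \<Rightarrow> complex) \<Rightarrow> complex set" where
  "edges_image E \<gamma> = (\<Union>e\<in>E. path_image (\<gamma> e))"

lemma drawing_common_point:
  assumes "drawing V E pos \<gamma>" "e \<in> E" "f \<in> E" "e \<noteq> f"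
    "p \<in> path_image (\<gamma> e)" "p \<in> path_image (\<gamma> f)"
  shows "p \<in> pos ` V \<union> snd ` crossings V E pos \<gamma>"
proof (rule ccontr)
  assume "p \<notin> pos ` V \<union> snd ` crossings V E pos \<gamma>"
  moreover from this have "({e,f}, p) \<in> crossings V E pos \<gamma>"
    using assms unfolding crossings_def by blast
  ultimately show False by force
qed

lemma eventually_cball_subset:
  fixes z :: "'a::metric_space"
  assumes "open N" "z \<in> N"
  shows "\<forall>\<^sub>F r in at_right 0. cball z r \<subseteq> N"
proof -
  obtain d where "d > 0" "cball z d \<subseteq> N" using assms open_contains_cball by blast
  then show ?thesis unfolding eventually_at_right_field
    by (intro exI[of _ d]) (auto simp: subset_eq)
qed

text \<open>No crossing is created: two edges sharing a point of the open disc other than the centre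
  share a whole radius, whose outer end was already common to the original edges. This end would be
  a vertex or a crossing, but \<open>r\<close> is so small that the closed disc contains none except
  possibly \<open>z\<close>.\<close>

lemma straighten_drawing:
  fixes E :: "'a set set"
  assumes D: "drawing V E pos \<gamma>" and fin: "finite V" "finite E" "finite (crossings V E pos \<gamma>)"
    and N: "open N" "z \<in> N"
  obtains \<gamma>' r where "r > 0" "cball z r \<subseteq> N" "drawing V E pos \<gamma>'"
    "crossings V E pos \<gamma>' \<subseteq> crossings V E pos \<gamma>"
    "edges_image E \<gamma>' - ball z r \<subseteq> edges_image E \<gamma>"
    "edges_image E \<gamma>' - N = edges_image E \<gamma> - N"
    "radial_at (edges_image E \<gamma>') z r"
proof -
  define K where "K = pos ` V \<union> snd ` crossings V E pos \<gamma>"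
  have K: "finite K" using fin by (simp add: K_def)
  have arcs: "arc (\<gamma> e)" if "e \<in> E" for e using D that by (auto simp: drawing_def)
  \<comment> \<open>The last conjunct keeps an edge that avoids \<open>z\<close> from acquiring it;
    otherwise a vertex incidence or a crossing could arise at the centre.\<close>
  define P where "P r e g' Q S \<longleftrightarrow> arc g' \<and> pathstart g' = pathstart (\<gamma> e) \<and> pathfinish g' = pathfinish (\<gamma> e) \<and>
       finite Q \<and> Q \<subseteq> path_image (\<gamma> e) \<inter> sphere z r \<and> S \<subseteq> path_image (\<gamma> e) - cball z r \<and>
       path_image g' = (\<Union>q\<in>Q. closed_segment z q) \<union> S \<and> path_image g' - N = path_image (\<gamma> e) - N \<and>
       (z \<in> path_image g' \<longrightarrow> z \<in> path_image (\<gamma> e))" for r e g' Q S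
  have ev: "\<forall>\<^sub>F r in at_right 0. \<exists>g' Q S. P r e g' Q S" if e: "e \<in> E" for e
  proof (cases "z \<in> path_image (\<gamma> e)")
    case True
    show ?thesis unfolding P_def
      by (rule eventually_mono[OF straighten_arc[OF arcs[OF e] True N]]) (use True in auto)
  next
    case False
    have "closed (path_image (\<gamma> e))" using arcs[OF e] by (simp add: closed_arc_image)
    then have "\<forall>\<^sub>F r in at_right 0. cball z r \<subseteq> - path_image (\<gamma> e)"
      using False by (intro eventually_cball_subset) auto
    then show ?thesis
    proof (rule eventually_mono)
      fix r assume r: "cball z r \<subseteq> - path_image (\<gamma> e)"
      have "ball z r \<subseteq> cball z r" by auto
      then have "P r e (\<gamma> e) {} (path_image (\<gamma> e))"
        unfolding P_def using r arcs[OF e] by auto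
      then show "\<exists>g' Q S. P r e g' Q S" by blast
    qed
  qed
  have "\<forall>\<^sub>F r in at_right 0. (\<forall>e\<in>E. \<exists>g' Q S. P r e g' Q S) \<and> cball z r \<subseteq> N \<inter> - (K - {z}) \<and> 0 < r"
    using fin ev N K
    by (intro eventually_conj eventually_ball_finite ballI eventually_cball_subset open_Int
          finite_imp_closed[THEN open_Compl] eventually_at_right_less) auto
  from eventually_happens'[OF trivial_limit_at_right_real this]
  obtain r where r: "\<forall>e\<in>E. \<exists>g' Q S. P r e g' Q S" "cball z r \<subseteq> N \<inter> - (K - {z})" "0 < r"
    by blast
  from r(1) obtain \<gamma>' Q S where P: "\<And>e. e \<in> E \<Longrightarrow> P r e (\<gamma>' e) (Q e) (S e)" by metis
  have seg: "closed_segment z q \<subseteq> cball z r" if "q \<in> Q e" "e \<in> E" for q e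
    using P[OF that(2)] that r(3) by (intro closed_segment_subset) (auto simp: P_def)
  have im: "path_image (\<gamma>' e) = (\<Union>q\<in>Q e. closed_segment z q) \<union> S e" if "e \<in> E" for e
    using P[OF that] by (simp add: P_def)
  have QS: "Q e \<subseteq> path_image (\<gamma> e)" "S e \<subseteq> path_image (\<gamma> e)" "S e \<inter> cball z r = {}" "Q e \<subseteq> sphere z r"
      "finite (Q e)" if "e \<in> E" for e
    using P[OF that] by (auto simp: P_def)
  have far: "p \<in> path_image (\<gamma> e)" if ep: "e \<in> E" "p \<in> path_image (\<gamma>' e)" "p \<notin> ball z r" for e p
  proof -
    consider q where "q \<in> Q e" "p \<in> closed_segment z q" | "p \<in> S e" using im[OF ep(1)] ep(2) by blast
    then show ?thesis
    proof cases
      case 1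
      then have "dist z q = r" using QS(4)[OF ep(1)] by auto
      then have "p = q" using closed_segment_far_point[OF 1(2)] ep(3) by auto
      then show ?thesis using 1 QS(1)[OF ep(1)] by auto
    qed (use QS ep in auto)
  qed
  have zin: "z \<in> path_image (\<gamma> e)" if "e \<in> E" "z \<in> path_image (\<gamma>' e)" for e
    using P[OF that(1)] that by (simp add: P_def)
  have drawing: "drawing V E pos \<gamma>'"
    unfolding drawing_def
  proof (intro conjI ballI)
    show "inj_on pos V" using D by (simp add: drawing_def)
    fix e assume e: "e \<in> E"
    show "arc (\<gamma>' e)" using P[OF e] by (simp add: P_def)
    show "{pathstart (\<gamma>' e), pathfinish (\<gamma>' e)} = pos ` e" using P[OF e] D e by (simp add: P_def drawing_def)
    show "path_image (\<gamma>' e) \<inter> pos ` (V - e) = {}"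
    proof (rule ccontr)
      assume "path_image (\<gamma>' e) \<inter> pos ` (V - e) \<noteq> {}"
      then obtain p where p: "p \<in> path_image (\<gamma>' e)" "p \<in> pos ` (V - e)" by blast
      have "p \<in> K" using p by (auto simp: K_def)
      have "p \<in> path_image (\<gamma> e)"
      proof (cases "p \<in> ball z r")
        case True
        then have "p \<in> cball z r" by simp
        then have "p = z" using \<open>p \<in> K\<close> r(2) by blast
        then show ?thesis using zin e p by simp
      qed (use far e p in blast)
      then show False using D e p by (auto simp: drawing_def)
    qed
  qed
  have crossings: "crossings V E pos \<gamma>' \<subseteq> crossings V E pos \<gamma>"
  proof
    fix c assume "c \<in> crossings V E pos \<gamma>'"
    then obtain e f p where c: "c = ({e,f},p)" "e \<in> E" "f \<in> E" "e \<noteq> f"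
      "p \<in> path_image (\<gamma>' e)" "p \<in> path_image (\<gamma>' f)" "p \<notin> pos ` V" unfolding crossings_def by blast
    have "p \<in> path_image (\<gamma> e) \<and> p \<in> path_image (\<gamma> f)"
    proof (cases "p \<in> ball z r - {z}")
      case True
      have "p \<in> cball z r" using True by simp
      then have "p \<notin> S e" "p \<notin> S f" using QS(3)[OF c(2)] QS(3)[OF c(3)] by blast+
      then obtain q q' where q: "q \<in> Q e" "p \<in> closed_segment z q" "q' \<in> Q f" "p \<in> closed_segment z q'"
        using c(5,6) im[OF c(2)] im[OF c(3)] by blast
      have d: "dist z q = r" "dist z q' = r" using q(1,3) QS(4)[OF c(2)] QS(4)[OF c(3)] by auto
      then have "q \<in> closed_segment z q'" using same_ray[OF q(2) q(4)] True by simp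
      then have "q = q'" using d by (intro closed_segment_far_point) auto
      then have "q \<in> path_image (\<gamma> e)" "q \<in> path_image (\<gamma> f)"
        using q(1,3) QS(1)[OF c(2)] QS(1)[OF c(3)] by auto
      then have "q \<in> K" using drawing_common_point[OF D c(2,3,4)] unfolding K_def by blast
      moreover have "q \<in> cball z r" using d by simp
      ultimately have "q = z" using r(2) by blast
      then show ?thesis using d r(3) by simp
    next
      case False
      then show ?thesis using zin far c by (cases "p = z") auto
    qed
    then show "c \<in> crossings V E pos \<gamma>" using c unfolding crossings_def by blast
  qed
  have "edges_image E \<gamma>' - ball z r \<subseteq> edges_image E \<gamma>" using far by (auto simp: edges_image_def)
  moreover have "edges_image E \<gamma>' - N = edges_image E \<gamma> - N"
  proof -
    have "path_image (\<gamma>' e) - N = path_image (\<gamma> e) - N" if "e \<in> E" for e using P[OF that] unfolding P_def by blast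
    then show ?thesis unfolding edges_image_def by blast
  qed
  moreover have "radial_at (edges_image E \<gamma>') z r"
    unfolding radial_at_def
  proof (intro exI conjI)
    show "finite (\<Union>e\<in>E. Q e)" using fin QS by auto
    show "(\<Union>e\<in>E. Q e) \<subseteq> sphere z r" using QS by blast
    show "edges_image E \<gamma>' \<inter> cball z r = (\<Union>q\<in>\<Union>e\<in>E. Q e. closed_segment z q)"
    proof
      show "(\<Union>q\<in>\<Union>e\<in>E. Q e. closed_segment z q) \<subseteq> edges_image E \<gamma>' \<inter> cball z r"
      proof
        fix p assume "p \<in> (\<Union>q\<in>\<Union>e\<in>E. Q e. closed_segment z q)"
        then obtain e q where "e \<in> E" "q \<in> Q e" "p \<in> closed_segment z q" by blast
        then show "p \<in> edges_image E \<gamma>' \<inter> cball z r"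
          using seg[of q e] im[of e] unfolding edges_image_def by blast
      qed
      show "edges_image E \<gamma>' \<inter> cball z r \<subseteq> (\<Union>q\<in>\<Union>e\<in>E. Q e. closed_segment z q)"
      proof
        fix p assume p: "p \<in> edges_image E \<gamma>' \<inter> cball z r"
        then obtain e where e: "e \<in> E" "p \<in> path_image (\<gamma>' e)" by (auto simp: edges_image_def)
        then show "p \<in> (\<Union>q\<in>\<Union>e\<in>E. Q e. closed_segment z q)"
          using im[OF e(1)] QS(3)[OF e(1)] p by blast
      qed
    qed
  qed
  ultimately show ?thesis using that r drawing crossings by blast
qed

text \<open>Each straightening acts inside its own neighbourhood only. As the neighbourhoods are
  disjoint, the radial shape reached at earlier points survives.\<close>

lemma straighten_drawing_many:
  fixes E :: "'a set set"
  assumes D: "drawing V E pos \<gamma>" and fin: "finite V" "finite E" "finite (crossings V E pos \<gamma>)"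
    and Z: "finite Z" "\<forall>z\<in>Z. open (N z) \<and> z \<in> N z" "disjoint_family_on N Z"
  shows "\<exists>\<gamma>' r. (\<forall>z\<in>Z. r z > 0 \<and> cball z (r z) \<subseteq> N z \<and> radial_at (edges_image E \<gamma>') z (r z)) \<and>
    drawing V E pos \<gamma>' \<and> crossings V E pos \<gamma>' \<subseteq> crossings V E pos \<gamma> \<and>
    edges_image E \<gamma>' - (\<Union>z\<in>Z. ball z (r z)) \<subseteq> edges_image E \<gamma> \<and>
    edges_image E \<gamma>' - (\<Union>z\<in>Z. N z) = edges_image E \<gamma> - (\<Union>z\<in>Z. N z)"
  using Z
proof (induction Z rule: finite_induct)
  case empty
  then show ?case using D by (intro exI[of _ \<gamma>]) auto
next
  case (insert z Z)
  have disj: "N z \<inter> N z' = {}" if "z' \<in> Z" for z'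
    using insert.prems(2) insert.hyps(2) that unfolding disjoint_family_on_def by (metis insertCI)
  have nbhd: "\<forall>z\<in>Z. open (N z) \<and> z \<in> N z" using insert.prems(1) by blast
  have "disjoint_family_on N Z" using insert.prems(2) unfolding disjoint_family_on_def by blast
  from insert.IH[OF nbhd this] obtain \<gamma>1 r where 1: "\<forall>z\<in>Z. r z > 0 \<and> cball z (r z) \<subseteq> N z \<and> radial_at (edges_image E \<gamma>1) z (r z)"
    "drawing V E pos \<gamma>1" "crossings V E pos \<gamma>1 \<subseteq> crossings V E pos \<gamma>"
    "edges_image E \<gamma>1 - (\<Union>z\<in>Z. ball z (r z)) \<subseteq> edges_image E \<gamma>"
    "edges_image E \<gamma>1 - (\<Union>z\<in>Z. N z) = edges_image E \<gamma> - (\<Union>z\<in>Z. N z)"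
    by (elim exE conjE) blast
  have "finite (crossings V E pos \<gamma>1)" using 1(3) fin(3) finite_subset by blast
  moreover have "open (N z)" "z \<in> N z" using insert.prems(1) by auto
  ultimately obtain \<gamma>2 s where 2: "s > 0" "cball z s \<subseteq> N z" "drawing V E pos \<gamma>2"
    "crossings V E pos \<gamma>2 \<subseteq> crossings V E pos \<gamma>1"
    "edges_image E \<gamma>2 - ball z s \<subseteq> edges_image E \<gamma>1"
    "edges_image E \<gamma>2 - N z = edges_image E \<gamma>1 - N z"
    "radial_at (edges_image E \<gamma>2) z s"
    using straighten_drawing[OF 1(2) fin(1,2)] by metis
  let ?r = "r(z := s)"
  have rad: "radial_at (edges_image E \<gamma>2) z' (r z')" if "z' \<in> Z" for z'
  proof -
    have "cball z' (r z') \<inter> N z = {}" using 1(1) disj that by blast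
    then have "edges_image E \<gamma>2 \<inter> cball z' (r z') = edges_image E \<gamma>1 \<inter> cball z' (r z')" using 2(6) by blast
    then show ?thesis using 1(1) that by (simp add: radial_at_def)
  qed
  have balls: "(\<Union>z'\<in>insert z Z. ball z' (?r z')) = ball z s \<union> (\<Union>z\<in>Z. ball z (r z))"
    using insert.hyps by (auto split: if_splits)
  show ?case
  proof (intro exI[of _ \<gamma>2] exI[of _ ?r] conjI)
    show "\<forall>z'\<in>insert z Z. ?r z' > 0 \<and> cball z' (?r z') \<subseteq> N z' \<and> radial_at (edges_image E \<gamma>2) z' (?r z')"
      using 1(1) 2 rad insert.hyps by auto
    show "edges_image E \<gamma>2 - (\<Union>z'\<in>insert z Z. ball z' (?r z')) \<subseteq> edges_image E \<gamma>"
      unfolding balls using 1(4) 2(5) by blast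
    show "edges_image E \<gamma>2 - \<Union> (N ` insert z Z) = edges_image E \<gamma> - \<Union> (N ` insert z Z)"
      using 1(5) 2(6) by blast
  qed (use 2 1 in auto)
qed

section \<open>Pendant arcs and radial points\<close>

lemma connected_subset_singleton: "A \<subseteq> {x} \<Longrightarrow> connected A"
  by (metis connected_empty connected_sing subset_singletonD)

text \<open>The arcs are added one at a time: an arc alone does not separate the plane, and its
  intersection with what is already there has at most one point, hence is connected. Bounding the
  intersection with all other arcs at once makes the hypothesis pass to subfamilies.\<close>

lemma pendant_arcs_do_not_separate:
  fixes p q :: complex and M :: "complex set"
  assumes "finite G" "closed M" "connected_component (- M) p q"
    and "\<And>g. g \<in> G \<Longrightarrow> arc g \<and> p \<notin> path_image g \<and> q \<notin> path_image g"
    and "\<And>g. g \<in> G \<Longrightarrow> \<exists>x. path_image g \<inter> (M \<union> (\<Union>h\<in>G - {g}. path_image h)) \<subseteq> {x}"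
  shows "connected_component (- (M \<union> (\<Union>g\<in>G. path_image g))) p q"
  using assms(1,4,5)
proof (induction G rule: finite_induct)
  case empty
  then show ?case using assms by simp
next
  case (insert g G)
  have IH: "connected_component (- (M \<union> (\<Union>g\<in>G. path_image g))) p q"
  proof (rule insert.IH)
    fix h assume h: "h \<in> G"
    then obtain x where "path_image h \<inter> (M \<union> (\<Union>k\<in>insert g G - {h}. path_image k)) \<subseteq> {x}"
      using insert.prems(2)[of h] by auto
    then show "\<exists>x. path_image h \<inter> (M \<union> (\<Union>k\<in>G - {h}. path_image k)) \<subseteq> {x}" by blast
  qed (use insert.prems in auto)
  have g: "arc g" "p \<notin> path_image g" "q \<notin> path_image g" using insert.prems by auto
  have "connected_component (- (path_image g \<union> (M \<union> (\<Union>g\<in>G. path_image g)))) p q"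
  proof (rule Janiszewski[OF _ _ _ _ IH])
    show "compact (path_image g)" using g by (simp add: compact_arc_image)
    show "closed (M \<union> (\<Union>g\<in>G. path_image g))"
      using insert assms(2) by (intro closed_Un closed_UN) (auto simp: closed_arc_image)
    have "insert g G - {g} = G" using insert.hyps by auto
    then obtain x where "path_image g \<inter> (M \<union> (\<Union>h\<in>G. path_image h)) \<subseteq> {x}" using insert.prems(2)[of g] by auto
    then show "connected (path_image g \<inter> (M \<union> (\<Union>g\<in>G. path_image g)))" by (rule connected_subset_singleton)
    have "connected (- path_image g)" using g(1) by (intro connected_arc_complement) auto
    then show "connected_component (- path_image g) p q"
      using g by (auto simp: connected_iff_connected_component)
  qed
  then show ?case by (simp add: Un_left_commute)
qed

lemma path_component_segment:
  "closed_segment a b \<subseteq> S \<Longrightarrow> path_component S a (b :: 'a::real_normed_vector)"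
  unfolding path_component_def by (intro exI[of _ "linepath a b"]) auto

text \<open>The path is followed to its first point on the circle. This point is off
  \<open>M\<close>, hence off \<open>X\<close>, so the straight way from it to the centre avoids
  \<open>X\<close> except at \<open>y\<close>. Inside the open disc only \<open>X\<close> remains as
  an obstacle, whatever \<open>M\<close> contained there.\<close>

lemma path_component_to_radial_centre:
  fixes p m y :: complex
  assumes pm: "path_component (- M) p m" and m: "m \<in> cball y r" and p: "p \<notin> cball y r"
    and rad: "radial_at X y r" and X: "X \<inter> sphere y r \<subseteq> M"
  shows "path_component (- ((M - ball y r) \<union> (X \<inter> cball y r - {y}))) p y"
proof -
  let ?M = "- ((M - ball y r) \<union> (X \<inter> cball y r - {y}))"
  obtain g where g: "path g" "path_image g \<subseteq> - M" "pathstart g = p" "pathfinish g = m"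
    using pm by (auto simp: path_component_def)
  have "pathstart g \<in> closure (- cball y r)" using p g closure_subset[of "- cball y r"] by blast
  then obtain h where h: "path h" "pathstart h = p" "path_image h \<subseteq> path_image g"
     "path_image h - {pathfinish h} \<subseteq> interior (- cball y r)" "pathfinish h \<in> frontier (- cball y r)"
    using exists_path_subpath_to_frontier[OF g(1), of "- cball y r"] g m by auto
  let ?s = "pathfinish h"
  have s: "dist y ?s = r" using h(5) by (simp add: frontier_complement)
  have "?s \<in> path_image h" by (rule pathfinish_in_path_image)
  then have sM: "?s \<notin> M" using h(3) g(2) by blast
  then have sX: "?s \<notin> X" using X s by auto
  have "path_image h \<subseteq> ?M"
  proof
    fix w assume w: "w \<in> path_image h"
    then have "w \<notin> M" using h(3) g(2) by blast
    moreover have "w = ?s \<or> w \<notin> cball y r" using w h(4) interior_subset by blast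
    ultimately show "w \<in> ?M" using sX by auto
  qed
  then have "path_component ?M p ?s" using h by (auto simp: path_component_def)
  moreover have "path_component ?M ?s y"
  proof (rule path_component_segment)
    have r: "0 \<le> r" using s by auto
    have seg: "closed_segment y ?s \<subseteq> cball y r" using s r by (intro closed_segment_subset) auto
    have "closed_segment y ?s \<inter> X \<subseteq> {y}" using radial_at_segment[OF rad _ sX] s by simp
    moreover have "w \<in> ball y r" if "w \<in> closed_segment y ?s" "w \<noteq> ?s" for w
      using closed_segment_far_point[OF that(1)] that s by force
    ultimately have "closed_segment y ?s \<subseteq> ?M" using sM seg by blast
    then show "closed_segment ?s y \<subseteq> ?M" by (simp add: closed_segment_commute)
  qed
  ultimately show ?thesis using path_component_trans by blast
qed

text \<open>A path that enters the disc links both of its ends to the centre, and the detour through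
  \<open>y\<close> replaces it; a path that misses the disc is not affected.\<close>

lemma path_component_through_radial_point:
  fixes p q y :: complex
  assumes pq: "path_component (- M) p q" and p: "p \<notin> cball y r" "q \<notin> cball y r"
    and rad: "radial_at X y r" and X: "X \<inter> sphere y r \<subseteq> M"
  shows "path_component (- ((M - ball y r) \<union> (X \<inter> cball y r - {y}))) p q"
proof -
  let ?M = "- ((M - ball y r) \<union> (X \<inter> cball y r - {y}))"
  obtain g where g: "path g" "path_image g \<subseteq> - M" "pathstart g = p" "pathfinish g = q"
    using pq by (auto simp: path_component_def)
  show ?thesis
  proof (cases "path_image g \<inter> cball y r = {}")
    case True
    then have "path_image g \<subseteq> ?M" using g(2) by blast
    then show ?thesis using g by (auto simp: path_component_def)
  next
    case False
    then obtain m where m: "m \<in> path_image g" "m \<in> cball y r" by blast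
    have pc: "path_connected (path_image g)" using g(1) by (rule path_connected_path_image)
    have "path_component (- M) p m" "path_component (- M) q m"
      using pc m(1) g pathstart_in_path_image[of g] pathfinish_in_path_image[of g]
      by (auto simp: path_connected_component intro: path_component_of_subset)
    then show ?thesis
      using path_component_to_radial_centre[OF _ m(2) _ rad X] p
      by (meson path_component_sym path_component_trans)
  qed
qed

text \<open>The induction alters the obstacles inside the discs already treated. Disjointness of the
  closed discs keeps the circle of the next point out of them, so that its intersection with
  \<open>X\<close> still consists of obstacles.\<close>

lemma path_component_through_radial_points:
  fixes p q :: complex
  assumes "finite Y" and "path_component (- M) p q"
    and "\<And>y. y \<in> Y \<Longrightarrow> p \<notin> cball y (r y) \<and> q \<notin> cball y (r y) \<and> radial_at X y (r y)"
    and "\<And>y. y \<in> Y \<Longrightarrow> X \<inter> sphere y (r y) \<subseteq> M"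
    and "\<And>y y'. y \<in> Y \<Longrightarrow> y' \<in> Y \<Longrightarrow> y \<noteq> y' \<Longrightarrow> cball y (r y) \<inter> cball y' (r y') = {}"
  shows "path_component (- ((M - (\<Union>y\<in>Y. ball y (r y))) \<union> (X \<inter> (\<Union>y\<in>Y. cball y (r y)) - Y))) p q"
  using assms(1,3,4,5)
proof (induction Y rule: finite_induct)
  case empty
  then show ?case using assms by simp
next
  case (insert y Y)
  let ?M = "(M - (\<Union>y\<in>Y. ball y (r y))) \<union> (X \<inter> (\<Union>y\<in>Y. cball y (r y)) - Y)"
  have disj: "cball y (r y) \<inter> cball y' (r y') = {}" if "y' \<in> Y" for y'
    using insert.prems(3)[of y y'] insert.hyps that by auto
  have IH: "path_component (- ?M) p q"
    by (rule insert.IH) (use insert.prems in auto)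
  have "X \<inter> sphere y (r y) \<subseteq> ?M"
  proof -
    have "X \<inter> sphere y (r y) \<subseteq> M" using insert.prems by auto
    moreover have "sphere y (r y) \<inter> ball y' (r y') = {}" if "y' \<in> Y" for y'
      using disj[OF that] by (meson ball_subset_cball disjoint_iff sphere_cball subsetD)
    ultimately show ?thesis by blast
  qed
  then have *: "path_component (- ((?M - ball y (r y)) \<union> (X \<inter> cball y (r y) - {y}))) p q"
    by (intro path_component_through_radial_point[OF IH]) (use insert.prems in auto)
  show ?case
  proof (rule path_component_of_subset[OF _ *])
    have "ball y (r y) \<subseteq> cball y (r y)" by (rule ball_subset_cball)
    then show "- ((?M - ball y (r y)) \<union> (X \<inter> cball y (r y) - {y}))
      \<subseteq> - (M - (\<Union>y\<in>insert y Y. ball y (r y)) \<union> (X \<inter> (\<Union>y\<in>insert y Y. cball y (r y)) - insert y Y))"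
      by blast
  qed
qed

section \<open>Germs of a drawing at a point\<close>

text \<open>The number of branches of an arc at one of its points: one at an end, two elsewhere.
  Away from the arc the value 2 has no meaning, so \<open>local_degree\<close> sums over the edges
  through \<open>x\<close> only; it is the degree at a vertex and twice the number of edges through
  \<open>x\<close> at any other point.\<close>

definition germ_count :: "(real \<Rightarrow> complex) \<Rightarrow> complex \<Rightarrow> nat" where
  "germ_count g x = of_bool (x \<noteq> pathstart g) + of_bool (x \<noteq> pathfinish g)"

definition local_degree :: "'b set \<Rightarrow> ('b \<Rightarrow> real \<Rightarrow> complex) \<Rightarrow> complex \<Rightarrow> nat" where
  "local_degree E \<gamma> x = (\<Sum>e | e \<in> E \<and> x \<in> path_image (\<gamma> e). germ_count (\<gamma> e) x)"

lemma arc_germs: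
  assumes g: "arc g" and x: "x \<in> path_image g"
  shows "\<exists>H. finite H \<and> card H \<le> germ_count g x \<and> (\<forall>h\<in>H. arc h \<and> pathstart h = x) \<and>
    (\<Union>h\<in>H. path_image h) = path_image g \<and>
    (\<forall>h\<in>H. \<forall>h'\<in>H. h \<noteq> h' \<longrightarrow> path_image h \<inter> path_image h' \<subseteq> {x})"
proof -
  obtain t where t: "t \<in> {0..1}" "g t = x" using x by (auto simp: path_image_def)
  have sf: "pathstart g \<noteq> pathfinish g" using arc_distinct_ends[OF g] by metis
  consider "t = 0" | "t = 1" | "0 < t" "t < 1" using t by force
  then show ?thesis
  proof cases
    case 1
    then have "pathstart g = x" using t by (simp add: pathstart_def)
    then show ?thesis using g sf by (intro exI[of _ "{g}"]) (auto simp: germ_count_def)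
  next
    case 2
    then have "pathfinish g = x" using t by (simp add: pathfinish_def)
    then show ?thesis using g sf by (intro exI[of _ "{reversepath g}"]) (auto simp: germ_count_def arc_reversepath)
  next
    case 3
    note sp = arc_split[OF g 3]
    have inj: "inj_on g {0..1}" using g by (simp add: arc_def)
    have "x \<noteq> pathstart g" "x \<noteq> pathfinish g"
      using inj_onD[OF inj, of t 0] inj_onD[OF inj, of t 1] 3 t by (auto simp: pathstart_def pathfinish_def)
    then have gc: "germ_count g x = 2" by (simp add: germ_count_def)
    let ?H = "{subpath t 1 g, subpath t 0 g}"
    have "finite ?H" "card ?H \<le> germ_count g x" unfolding gc by (simp_all add: card_insert_if)
    moreover have "\<forall>h\<in>?H. arc h \<and> pathstart h = x" using sp(1,2) t by simp
    moreover have "(\<Union>h\<in>?H. path_image h) = path_image g" using sp(5) by (simp add: Un_commute)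
    moreover have "\<forall>h\<in>?H. \<forall>h'\<in>?H. h \<noteq> h' \<longrightarrow> path_image h \<inter> path_image h' \<subseteq> {x}"
      using sp(6) t(2) by (simp add: Int_commute)
    ultimately show ?thesis by blast
  qed
qed

text \<open>The germs are whole edges or edges cut at \<open>x\<close>, so they may meet again far
  away. The radius \<rho> excludes all other vertices and crossings and all edges that avoid
  \<open>x\<close>; within it distinct germs share only \<open>x\<close>.\<close>

lemma drawing_germs:
  fixes E :: "'a set set"
  assumes D: "drawing V E pos \<gamma>" and fin: "finite V" "finite E" "finite (crossings V E pos \<gamma>)"
  obtains H \<rho> where "finite H" "card H \<le> local_degree E \<gamma> x" "\<rho> > 0"
    "\<And>h. h \<in> H \<Longrightarrow> arc h \<and> pathstart h = x \<and> path_image h \<subseteq> edges_image E \<gamma>"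
    "edges_image E \<gamma> \<inter> ball x \<rho> \<subseteq> (\<Union>h\<in>H. path_image h)"
    "\<And>h h'. h \<in> H \<Longrightarrow> h' \<in> H \<Longrightarrow> h \<noteq> h' \<Longrightarrow> path_image h \<inter> path_image h' \<inter> ball x \<rho> \<subseteq> {x}"
proof -
  define K where "K = pos ` V \<union> snd ` crossings V E pos \<gamma>"
  have K: "finite K" using fin by (simp add: K_def)
  have arcs: "arc (\<gamma> e)" if "e \<in> E" for e using D that by (auto simp: drawing_def)
  let ?Ex = "{e \<in> E. x \<in> path_image (\<gamma> e)}"
  have "\<forall>e\<in>?Ex. \<exists>H. finite H \<and> card H \<le> germ_count (\<gamma> e) x \<and> (\<forall>h\<in>H. arc h \<and> pathstart h = x) \<and>
    (\<Union>h\<in>H. path_image h) = path_image (\<gamma> e) \<and>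
    (\<forall>h\<in>H. \<forall>h'\<in>H. h \<noteq> h' \<longrightarrow> path_image h \<inter> path_image h' \<subseteq> {x})"
    using arc_germs arcs by simp
  then obtain Hs where Hs: "\<forall>e\<in>?Ex. finite (Hs e) \<and> card (Hs e) \<le> germ_count (\<gamma> e) x \<and> (\<forall>h\<in>Hs e. arc h \<and> pathstart h = x) \<and>
    (\<Union>h\<in>Hs e. path_image h) = path_image (\<gamma> e) \<and>
    (\<forall>h\<in>Hs e. \<forall>h'\<in>Hs e. h \<noteq> h' \<longrightarrow> path_image h \<inter> path_image h' \<subseteq> {x})"
    by (rule bchoice[THEN exE])
  define H where "H = (\<Union>e\<in>?Ex. Hs e)"
  let ?F = "(K - {x}) \<union> (\<Union>e\<in>E - ?Ex. path_image (\<gamma> e))"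
  have "closed ?F"
    using K fin arcs by (intro closed_Un closed_UN finite_imp_closed) (auto simp: closed_arc_image)
  then have "open (- ?F)" by (rule open_Compl)
  moreover have "x \<in> - ?F" by blast
  ultimately obtain \<rho> where \<rho>: "\<rho> > 0" "ball x \<rho> \<subseteq> - ?F"
    unfolding open_contains_ball by blast
  show ?thesis
  proof (rule that[of H \<rho>])
    show "finite H" using Hs fin by (auto simp: H_def)
    show "card H \<le> local_degree E \<gamma> x"
    proof -
      have "card H \<le> (\<Sum>e\<in>?Ex. card (Hs e))" unfolding H_def using fin by (intro card_UN_le) auto
      also have "\<dots> \<le> (\<Sum>e\<in>?Ex. germ_count (\<gamma> e) x)" using Hs by (intro sum_mono) auto
      finally show ?thesis by (simp add: local_degree_def)
    qed
    show "\<rho> > 0" by fact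
    show "arc h \<and> pathstart h = x \<and> path_image h \<subseteq> edges_image E \<gamma>" if hH: "h \<in> H" for h
    proof -
      obtain e where e: "e \<in> ?Ex" "h \<in> Hs e" using hH unfolding H_def by blast
      have "path_image h \<subseteq> path_image (\<gamma> e)" using bspec[OF Hs e(1)] e(2) by blast
      also have "\<dots> \<subseteq> edges_image E \<gamma>" using e(1) by (auto simp: edges_image_def)
      finally show ?thesis using bspec[OF Hs e(1)] e(2) by simp
    qed
    show "edges_image E \<gamma> \<inter> ball x \<rho> \<subseteq> (\<Union>h\<in>H. path_image h)"
    proof
      fix y assume y: "y \<in> edges_image E \<gamma> \<inter> ball x \<rho>"
      then obtain e where e: "e \<in> E" "y \<in> path_image (\<gamma> e)" by (auto simp: edges_image_def)
      then have eE: "e \<in> ?Ex" using \<rho>(2) y by blast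
      then have "y \<in> (\<Union>h\<in>Hs e. path_image h)" using bspec[OF Hs eE] e(2) by simp
      then show "y \<in> (\<Union>h\<in>H. path_image h)" using eE unfolding H_def by blast
    qed
    show "path_image h \<inter> path_image h' \<inter> ball x \<rho> \<subseteq> {x}" if hh: "h \<in> H" "h' \<in> H" "h \<noteq> h'" for h h'
    proof
      fix y assume y: "y \<in> path_image h \<inter> path_image h' \<inter> ball x \<rho>"
      obtain e e' where e: "e \<in> ?Ex" "e' \<in> ?Ex" "h \<in> Hs e" "h' \<in> Hs e'" using hh(1,2) unfolding H_def by blast
      show "y \<in> {x}"
      proof (cases "e = e'")
        case True
        then have "path_image h \<inter> path_image h' \<subseteq> {x}" using bspec[OF Hs e(1)] e(3,4) hh(3) by blast
        then show ?thesis using y by blast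
      next
        case False
        have "path_image h \<subseteq> path_image (\<gamma> e)" using bspec[OF Hs e(1)] e(3) by blast
        moreover have "path_image h' \<subseteq> path_image (\<gamma> e')" using bspec[OF Hs e(2)] e(4) by blast
        ultimately have "y \<in> path_image (\<gamma> e)" "y \<in> path_image (\<gamma> e')" using y by auto
        moreover have "e \<in> E" "e' \<in> E" using e(1,2) by auto
        ultimately have "y \<in> K" using drawing_common_point[OF D _ _ False] unfolding K_def by blast
        then show ?thesis using \<rho>(2) y by blast
      qed
    qed
  qed
qed

lemma arc_initial_small:
  fixes h :: "real \<Rightarrow> complex"
  assumes "arc h" "open N" "pathstart h \<in> N"
  obtains \<epsilon> where "0 < \<epsilon>" "\<epsilon> < 1" "h ` {0..\<epsilon>} \<subseteq> N"
proof -
  have cg: "continuous_on {0..1} h" using assms by (simp add: arc_def path_def)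
  obtain d where d: "d > 0" "ball (h 0) d \<subseteq> N" using assms open_contains_ball
    by (metis pathstart_def)
  obtain \<eta> where \<eta>: "\<eta> > 0" "\<And>t. t \<in> {0..1} \<Longrightarrow> dist t 0 < \<eta> \<Longrightarrow> dist (h t) (h 0) < d"
    using cg d(1) unfolding continuous_on_iff by (metis atLeastAtMost_iff order_refl zero_le_one)
  show ?thesis
  proof (rule that[of "min (\<eta>/2) (1/2)"])
    show "h ` {0..min (\<eta>/2) (1/2)} \<subseteq> N"
    proof
      fix y assume "y \<in> h ` {0..min (\<eta>/2) (1/2)}"
      then obtain t where "t \<in> {0..min (\<eta>/2) (1/2)}" "y = h t" by auto
      then have "y \<in> ball (h 0) d" using \<eta>(2)[of t] \<eta>(1) by (auto simp: dist_commute)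
      then show "y \<in> N" using d by blast
    qed
  qed (use \<eta> in auto)
qed

text \<open>By injectivity and compactness the arc after time \<epsilon> stays away from its start.
  Nearness in space thus implies nearness in time, and a germ can be replaced by an initial piece
  without losing any of its points near \<open>x\<close>.\<close>

lemma arc_initial_ball:
  fixes h :: "real \<Rightarrow> complex"
  assumes "arc h" "0 < \<epsilon>"
  obtains r where "0 < r" "path_image h \<inter> ball (pathstart h) r \<subseteq> h ` {0..<\<epsilon>}"
proof -
  have cg: "continuous_on {0..1} h" and inj: "inj_on h {0..1}" using assms by (simp_all add: arc_def path_def)
  have comp: "compact (h ` {\<epsilon>..1})"
    using assms by (intro compact_continuous_image continuous_on_subset[OF cg]) auto
  have notin: "pathstart h \<notin> h ` {\<epsilon>..1}"
  proof
    assume "pathstart h \<in> h ` {\<epsilon>..1}"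
    then obtain t where "t \<in> {\<epsilon>..1}" "h 0 = h t" by (auto simp: pathstart_def)
    then show False using inj_onD[OF inj, of 0 t] assms by auto
  qed
  obtain r where r: "r > 0" "\<forall>y\<in>h ` {\<epsilon>..1}. r \<le> dist (pathstart h) y"
    using separate_point_closed[OF compact_imp_closed[OF comp] notin] by blast
  have "path_image h \<inter> ball (pathstart h) r \<subseteq> h ` {0..<\<epsilon>}"
  proof
    fix y assume y: "y \<in> path_image h \<inter> ball (pathstart h) r"
    then obtain t where t: "t \<in> {0..1}" "y = h t" by (auto simp: path_image_def)
    have "t < \<epsilon>"
    proof (rule ccontr)
      assume "\<not> t < \<epsilon>"
      then have "y \<in> h ` {\<epsilon>..1}" using t by simp
      then have "r \<le> dist (pathstart h) y" using r(2) by blast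
      then show False using y by simp
    qed
    then show "y \<in> h ` {0..<\<epsilon>}" using t by auto
  qed
  then show ?thesis using that r by blast
qed

text \<open>An initial piece of \<open>B\<close> without \<open>x\<close> is connected and covered
  by finitely many closed germs that are disjoint there, so it stays in one of them. The converse
  inclusion makes the beginning of this germ a part of \<open>B\<close>.\<close>

lemma arc_follows_germ:
  fixes B :: "real \<Rightarrow> complex"
  assumes H: "finite H" "\<forall>h\<in>H. arc h \<and> pathstart h = x"
    and disj: "\<forall>h\<in>H. \<forall>h'\<in>H. h \<noteq> h' \<longrightarrow> path_image h \<inter> path_image h' \<inter> ball x \<rho> \<subseteq> {x}"
    and \<rho>: "\<rho> > 0"
    and B: "arc B" "pathstart B = x" "path_image B \<inter> ball x \<rho> \<subseteq> (\<Union>h\<in>H. path_image h)"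
  obtains h \<epsilon> \<tau> where "h \<in> H" "0 < \<epsilon>" "B ` {0..\<epsilon>} \<subseteq> path_image h" "0 < \<tau>" "\<tau> \<le> 1" "h ` {0..\<tau>} \<subseteq> path_image B"
proof -
  obtain \<epsilon> where \<epsilon>: "0 < \<epsilon>" "\<epsilon> < 1" "B ` {0..\<epsilon>} \<subseteq> ball x \<rho>"
    using arc_initial_small[OF B(1), of "ball x \<rho>"] B(2) \<rho> by auto
  have cB: "continuous_on {0..1} B" and injB: "inj_on B {0..1}" using B by (simp_all add: arc_def path_def)
  have B0: "B 0 = x" using B by (simp add: pathstart_def)
  have inU: "B ` {0..\<epsilon>} \<subseteq> (\<Union>h\<in>H. path_image h)" 
  proof -
    have "B ` {0..\<epsilon>} \<subseteq> path_image B" using \<epsilon> by (auto simp: path_image_def)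
    then show ?thesis using \<epsilon>(3) B(3) by blast
  qed
  moreover have "B \<epsilon> \<in> B ` {0..\<epsilon>}" using \<epsilon> by simp
  ultimately obtain h where h: "h \<in> H" "B \<epsilon> \<in> path_image h" by blast
  have h0: "h 0 = x" using bspec[OF H(2) h(1)] by (simp add: pathstart_def)
  let ?C = "B ` {0<..\<epsilon>}"
  have conC: "connected ?C"
    using \<epsilon> by (intro connected_continuous_image continuous_on_subset[OF cB]) auto
  have xC: "x \<notin> ?C"
  proof
    assume "x \<in> ?C"
    then obtain t where "t \<in> {0<..\<epsilon>}" "B 0 = B t" using B0 by auto
    then show False using inj_onD[OF injB, of 0 t] \<epsilon> by auto
  qed
  let ?F = "\<Union>h'\<in>H - {h}. path_image h'"
  have clF: "closed ?F" using H by (intro closed_UN) (auto simp: closed_arc_image)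
  have clh: "closed (path_image h)" using H h by (simp add: closed_arc_image)
  have "?C \<subseteq> path_image h"
  proof -
    have 1: "path_image h \<inter> ?F \<inter> ?C = {}"
    proof (rule ccontr)
      assume "path_image h \<inter> ?F \<inter> ?C \<noteq> {}"
      then obtain y h' where y: "y \<in> path_image h" "h' \<in> H" "h \<noteq> h'" "y \<in> path_image h'" "y \<in> ?C" by blast
      have "?C \<subseteq> B ` {0..\<epsilon>}" by auto
      then have "y \<in> ball x \<rho>" using \<epsilon>(3) y(5) by blast
      moreover have "path_image h \<inter> path_image h' \<inter> ball x \<rho> \<subseteq> {x}"
        using bspec[OF bspec[OF disj h(1)] y(2)] y(3) by simp
      ultimately have "y = x" using y by blast
      then show False using xC y(5) by simp
    qed
    have cover: "?C \<subseteq> path_image h \<union> ?F"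
    proof -
      have "?C \<subseteq> B ` {0..\<epsilon>}" by auto
      then show ?thesis using inU by blast
    qed
    have "B \<epsilon> \<in> path_image h \<inter> ?C" using \<epsilon> h by simp
    then have "?F \<inter> ?C = {}" using connected_closedD[OF conC 1 cover clh clF] by blast
    then show ?thesis using cover by blast
  qed
  have x_in: "x \<in> path_image h" using pathstart_in_path_image[of h] bspec[OF H(2) h(1)] by simp
  have ivl: "{0..\<epsilon>} = insert 0 {0<..\<epsilon>}" using \<epsilon> by auto
  have Bh: "B ` {0..\<epsilon>} \<subseteq> path_image h"
    unfolding ivl using \<open>?C \<subseteq> path_image h\<close> B0 x_in by simp
  have "arc h" using bspec[OF H(2) h(1)] by simp
  then obtain k where k: "homeomorphism {0..1} (path_image h) h k" by (rule homeomorphism_arc)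
  have ck: "continuous_on (path_image h) k" using k by (simp add: homeomorphism_def)
  have con: "connected (k ` B ` {0..\<epsilon>})"
    using \<epsilon> Bh by (intro connected_continuous_image continuous_on_subset[OF cB] continuous_on_subset[OF ck]) auto
  have k0: "k x = 0" using homeomorphism_apply1[OF k, of 0] h0 by simp
  have in0: "0 \<in> k ` B ` {0..\<epsilon>}" using B0 \<epsilon> k0 by (metis atLeastAtMost_iff image_eqI less_imp_le order_refl)
  let ?\<tau> = "k (B \<epsilon>)"
  have in1: "?\<tau> \<in> k ` B ` {0..\<epsilon>}" using \<epsilon> by simp
  \<comment> \<open>The parameters that \<open>h\<close> takes on the initial piece of
    \<open>B\<close> form a connected set containing 0 and \<open>?\<tau>\<close>, hence the whole
    interval between them.\<close>
  have sub: "{0..?\<tau>} \<subseteq> k ` B ` {0..\<epsilon>}"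
    using con in0 in1 by (rule connected_contains_Icc)
  have hk: "h (k y) = y" if "y \<in> path_image h" for y using k that by (rule homeomorphism_apply2)
  have k01: "k ` path_image h = {0..1}" using k by (simp add: homeomorphism_def)
  have "?\<tau> \<in> {0..1}" using k01 h(2) by blast
  then have t1: "0 \<le> ?\<tau>" "?\<tau> \<le> 1" by auto
  have "B \<epsilon> \<in> ?C" using \<epsilon> by simp
  then have "B \<epsilon> \<noteq> x" using xC by blast
  then have "?\<tau> \<noteq> 0" using hk[OF h(2)] h0 by metis
  moreover have "h ` {0..?\<tau>} \<subseteq> path_image B"
  proof -
    have "h ` {0..?\<tau>} \<subseteq> h ` k ` B ` {0..\<epsilon>}" using sub by blast
    also have "\<dots> \<subseteq> B ` {0..\<epsilon>}"
    proof
      fix y assume "y \<in> h ` k ` B ` {0..\<epsilon>}"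
      then obtain w where w: "w \<in> B ` {0..\<epsilon>}" "y = h (k w)" by blast
      then have "w \<in> path_image h" using Bh by blast
      then show "y \<in> B ` {0..\<epsilon>}" using hk w by simp
    qed
    also have "\<dots> \<subseteq> path_image B" using \<epsilon> by (auto simp: path_image_def)
    finally show ?thesis .
  qed
  ultimately show ?thesis using t1 by (intro that[OF h(1) \<epsilon>(1) Bh]) auto
qed

text \<open>The two halves of \<open>A\<close> at \<open>x\<close> follow one germ each, and these
  differ because the halves meet only in \<open>x\<close>. Near \<open>x\<close> the arc is thus
  used up by two germs, and every other germ meets it in \<open>x\<close> at most.\<close>

lemma arc_through_germs:
  fixes A :: "real \<Rightarrow> complex"
  assumes H: "finite H" "\<forall>h\<in>H. arc h \<and> pathstart h = x"
    and disj: "\<forall>h\<in>H. \<forall>h'\<in>H. h \<noteq> h' \<longrightarrow> path_image h \<inter> path_image h' \<inter> ball x \<rho> \<subseteq> {x}"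
    and \<rho>: "\<rho> > 0"
    and A: "arc A" "path_image A \<inter> ball x \<rho> \<subseteq> (\<Union>h\<in>H. path_image h)"
    and x: "x \<in> path_image A - {pathstart A, pathfinish A}"
  obtains h1 h2 r where "h1 \<in> H" "h2 \<in> H" "h1 \<noteq> h2" "0 < r"
    "path_image h1 \<inter> ball x r \<subseteq> path_image A" "path_image h2 \<inter> ball x r \<subseteq> path_image A"
    "\<And>h. h \<in> H - {h1, h2} \<Longrightarrow> path_image h \<inter> path_image A \<inter> ball x r \<subseteq> {x}"
proof -
  obtain t where t: "t \<in> {0..1}" "A t = x" using x by (auto simp: path_image_def)
  have "t \<noteq> 0" "t \<noteq> 1" using t(2) x by (auto simp: pathstart_def pathfinish_def)
  then have t01: "0 < t" "t < 1" using t(1) by auto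
  note sp = arc_split[OF A(1) t01]
  let ?A1 = "subpath t 1 A" and ?A2 = "subpath t 0 A"
  have st: "pathstart ?A1 = x" "pathstart ?A2 = x" using t by auto
  have sub: "path_image ?A1 \<inter> ball x \<rho> \<subseteq> (\<Union>h\<in>H. path_image h)" "path_image ?A2 \<inter> ball x \<rho> \<subseteq> (\<Union>h\<in>H. path_image h)"
    using A(2) sp(5) by blast+
  obtain h1 \<epsilon>1 \<tau>1 where 1: "h1 \<in> H" "0 < \<epsilon>1" "?A1 ` {0..\<epsilon>1} \<subseteq> path_image h1" "0 < \<tau>1" "\<tau>1 \<le> 1" "h1 ` {0..\<tau>1} \<subseteq> path_image ?A1"
    using arc_follows_germ[OF H disj \<rho> sp(1) st(1) sub(1)] by blast
  obtain h2 \<epsilon>2 \<tau>2 where 2: "h2 \<in> H" "0 < \<epsilon>2" "?A2 ` {0..\<epsilon>2} \<subseteq> path_image h2" "0 < \<tau>2" "\<tau>2 \<le> 1" "h2 ` {0..\<tau>2} \<subseteq> path_image ?A2"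
    using arc_follows_germ[OF H disj \<rho> sp(2) st(2) sub(2)] by blast
  have meet: "path_image ?A2 \<inter> path_image ?A1 = {x}" using sp(6) t by simp
  have ne: "h1 \<noteq> h2"
  proof
    assume eq: "h1 = h2"
    let ?m = "min \<tau>1 \<tau>2"
    have m: "0 < ?m" "?m \<le> 1" "?m \<in> {0..\<tau>1}" "?m \<in> {0..\<tau>2}" using 1 2 by auto
    have "h1 ?m \<in> path_image ?A2 \<inter> path_image ?A1" using 1(6) 2(6) m eq by blast
    then have "h1 ?m = h1 0" using meet bspec[OF H(2) 1(1)] by (simp add: pathstart_def)
    moreover have "inj_on h1 {0..1}" using bspec[OF H(2) 1(1)] by (simp add: arc_def)
    ultimately show False using inj_onD[of h1 "{0..1}" ?m 0] m by auto
  qed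
  obtain r1 where r1: "0 < r1" "path_image h1 \<inter> ball x r1 \<subseteq> h1 ` {0..<\<tau>1}"
    using arc_initial_ball[of h1 \<tau>1] bspec[OF H(2) 1(1)] 1(4) by auto
  obtain r2 where r2: "0 < r2" "path_image h2 \<inter> ball x r2 \<subseteq> h2 ` {0..<\<tau>2}"
    using arc_initial_ball[of h2 \<tau>2] bspec[OF H(2) 2(1)] 2(4) by auto
  obtain r3 where r3: "0 < r3" "path_image ?A1 \<inter> ball x r3 \<subseteq> ?A1 ` {0..<\<epsilon>1}"
    using arc_initial_ball[of ?A1 \<epsilon>1] sp(1) st 1(2) by auto
  obtain r4 where r4: "0 < r4" "path_image ?A2 \<inter> ball x r4 \<subseteq> ?A2 ` {0..<\<epsilon>2}"
    using arc_initial_ball[of ?A2 \<epsilon>2] sp(2) st 2(2) by auto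
  define r where "r = Min {\<rho>, r1, r2, r3, r4}"
  have r: "0 < r" "r \<le> \<rho>" "r \<le> r1" "r \<le> r2" "r \<le> r3" "r \<le> r4"
    using \<rho> r1 r2 r3 r4 by (auto simp: r_def)
  have b: "ball x r \<subseteq> ball x s" if "r \<le> s" for s using that by auto
  have lt: "f ` {0..<u} \<subseteq> f ` {0..u}" for f :: "real \<Rightarrow> complex" and u by auto
  show ?thesis
  proof (rule that[OF 1(1) 2(1) ne r(1)])
    show "path_image h1 \<inter> ball x r \<subseteq> path_image A"
      using b[OF r(3)] r1(2) lt[of h1 \<tau>1] 1(6) sp(5) by blast
    show "path_image h2 \<inter> ball x r \<subseteq> path_image A"
      using b[OF r(4)] r2(2) lt[of h2 \<tau>2] 2(6) sp(5) by blast
    fix h assume h: "h \<in> H - {h1, h2}"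
    show "path_image h \<inter> path_image A \<inter> ball x r \<subseteq> {x}"
    proof
      fix y assume y: "y \<in> path_image h \<inter> path_image A \<inter> ball x r"
      have "y \<in> path_image h1 \<or> y \<in> path_image h2"
        using y sp(5) b[OF r(5)] b[OF r(6)] r3(2) r4(2) lt[of ?A1 \<epsilon>1] lt[of ?A2 \<epsilon>2] 1(3) 2(3) by blast
      moreover have "y \<in> ball x \<rho>" using y b[OF r(2)] by blast
      ultimately show "y \<in> {x}" using y h disj 1(1) 2(1) by blast
    qed
  qed
qed

text \<open>The two germs that carry \<open>A\<close> are dropped, hence the 2 next to
  \<open>card G\<close>; the others are shortened to fit into \<open>N\<close>. The condition on the
  closure says that a shortened germ is attached to the rest of the drawing only at its two ends, so
  that it becomes pendant once it is cut near \<open>pathfinish g\<close>.\<close>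

lemma germs_off_arc:
  fixes E :: "'a set set" and A :: "real \<Rightarrow> complex"
  assumes D: "drawing V E pos \<gamma>" and fin: "finite V" "finite E" "finite (crossings V E pos \<gamma>)"
    and A: "arc A" "path_image A \<subseteq> edges_image E \<gamma>"
    and x: "x \<in> path_image A - {pathstart A, pathfinish A}"
    and N: "open N" "x \<in> N"
  shows "\<exists>G \<rho>. finite G \<and> card G + 2 \<le> local_degree E \<gamma> x \<and> \<rho> > 0 \<and> ball x \<rho> \<subseteq> N \<and>
    (\<forall>g\<in>G. arc g \<and> pathstart g = x \<and> path_image g \<subseteq> edges_image E \<gamma> \<inter> N \<and>
       path_image g \<inter> path_image A \<subseteq> {x} \<and>
       closure (edges_image E \<gamma> - path_image g) \<inter> path_image g \<subseteq> {x, pathfinish g}) \<and>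
    (\<forall>g\<in>G. \<forall>g'\<in>G. g \<noteq> g' \<longrightarrow> path_image g \<inter> path_image g' \<subseteq> {x}) \<and>
    edges_image E \<gamma> \<inter> ball x \<rho> \<subseteq> path_image A \<union> (\<Union>g\<in>G. path_image g)"
proof -
  let ?X = "edges_image E \<gamma>"
  obtain H \<rho> where H: "finite H" "card H \<le> local_degree E \<gamma> x" "\<rho> > 0"
    "\<And>h. h \<in> H \<Longrightarrow> arc h \<and> pathstart h = x \<and> path_image h \<subseteq> ?X"
    "?X \<inter> ball x \<rho> \<subseteq> (\<Union>h\<in>H. path_image h)"
    "\<And>h h'. h \<in> H \<Longrightarrow> h' \<in> H \<Longrightarrow> h \<noteq> h' \<Longrightarrow> path_image h \<inter> path_image h' \<inter> ball x \<rho> \<subseteq> {x}"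
    using drawing_germs[OF D fin, of x] by metis
  have Hs: "\<forall>h\<in>H. arc h \<and> pathstart h = x" using H(4) by blast
  have disj: "\<forall>h\<in>H. \<forall>h'\<in>H. h \<noteq> h' \<longrightarrow> path_image h \<inter> path_image h' \<inter> ball x \<rho> \<subseteq> {x}" using H(6) by blast
  have "path_image A \<inter> ball x \<rho> \<subseteq> (\<Union>h\<in>H. path_image h)" using A(2) H(5) by blast
  then obtain h1 h2 r where h12: "h1 \<in> H" "h2 \<in> H" "h1 \<noteq> h2" "0 < r"
    "path_image h1 \<inter> ball x r \<subseteq> path_image A" "path_image h2 \<inter> ball x r \<subseteq> path_image A"
    "\<And>h. h \<in> H - {h1, h2} \<Longrightarrow> path_image h \<inter> path_image A \<inter> ball x r \<subseteq> {x}"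
    using arc_through_germs[OF H(1) Hs disj H(3) A(1) _ x] by metis
  obtain r' where r': "r' > 0" "ball x r' \<subseteq> N" using N open_contains_ball by blast
  define s where "s = Min {\<rho>, r, r'}"
  have s: "s > 0" "ball x s \<subseteq> ball x \<rho>" "ball x s \<subseteq> ball x r" "ball x s \<subseteq> N"
  proof -
    show "s > 0" using H(3) h12(4) r'(1) by (simp add: s_def)
    have "s \<le> \<rho>" "s \<le> r" "s \<le> r'" by (simp_all add: s_def)
    then show "ball x s \<subseteq> ball x \<rho>" "ball x s \<subseteq> ball x r" "ball x s \<subseteq> N"
      using subset_ball r'(2) by blast+
  qed
  let ?H = "H - {h1, h2}"
  have "\<forall>h\<in>?H. \<exists>\<epsilon>. 0 < \<epsilon> \<and> \<epsilon> < 1 \<and> h ` {0..\<epsilon>} \<subseteq> ball x s"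
  proof
    fix h assume h: "h \<in> ?H"
    show "\<exists>\<epsilon>. 0 < \<epsilon> \<and> \<epsilon> < 1 \<and> h ` {0..\<epsilon>} \<subseteq> ball x s"
      using arc_initial_small[of h "ball x s"] Hs h s(1) by (metis DiffD1 centre_in_ball open_ball)
  qed
  then obtain \<epsilon> where \<epsilon>: "\<forall>h\<in>?H. 0 < \<epsilon> h \<and> \<epsilon> h < 1 \<and> h ` {0..\<epsilon> h} \<subseteq> ball x s"
    by (rule bchoice[THEN exE])
  have "\<forall>h\<in>?H. \<exists>r. 0 < r \<and> path_image h \<inter> ball x r \<subseteq> h ` {0..<\<epsilon> h}"
  proof
    fix h assume h: "h \<in> ?H"
    have "arc h" "pathstart h = x" "0 < \<epsilon> h" using Hs \<epsilon> h by auto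
    then show "\<exists>r. 0 < r \<and> path_image h \<inter> ball x r \<subseteq> h ` {0..<\<epsilon> h}"
      using arc_initial_ball[of h "\<epsilon> h"] by metis
  qed
  then obtain R where R: "\<forall>h\<in>?H. 0 < R h \<and> path_image h \<inter> ball x (R h) \<subseteq> h ` {0..<\<epsilon> h}"
    by (rule bchoice[THEN exE])
  define germ where "germ h = subpath 0 (\<epsilon> h) h" for h :: "real \<Rightarrow> complex"
  have germ: "arc (germ h)" "pathstart (germ h) = x" "pathfinish (germ h) = h (\<epsilon> h)"
    "path_image (germ h) = h ` {0..\<epsilon> h}" "path_image (germ h) \<subseteq> path_image h" "path_image (germ h) \<subseteq> ball x s"
    if h: "h \<in> ?H" for h
  proof -
    have e: "0 < \<epsilon> h" "\<epsilon> h < 1" "h ` {0..\<epsilon> h} \<subseteq> ball x s" using bspec[OF \<epsilon> h] by auto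
    have a: "arc h" "pathstart h = x" using Hs h by auto
    show "arc (germ h)" unfolding germ_def using e a by (intro arc_subpath_arc) auto
    show "pathstart (germ h) = x" "pathfinish (germ h) = h (\<epsilon> h)"
      using a by (simp_all add: germ_def pathstart_def[of h])
    show im: "path_image (germ h) = h ` {0..\<epsilon> h}" using e by (simp add: germ_def path_image_subpath)
    show "path_image (germ h) \<subseteq> path_image h" unfolding im using e by (auto simp: path_image_def)
    show "path_image (germ h) \<subseteq> ball x s" using e(3) im by simp
  qed
  define G where "G = germ ` ?H"
  \<comment> \<open>Within distance \<open>R h\<close> of \<open>x\<close> only the shortened part
    of \<open>h\<close> is visible, so inside radius \<sigma> the shortened germs together with
    \<open>A\<close> still cover the drawing.\<close>
  define \<sigma> where "\<sigma> = Min (insert s (R ` ?H))"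
  have \<sigma>: "\<sigma> > 0" "\<sigma> \<le> s" "\<And>h. h \<in> ?H \<Longrightarrow> \<sigma> \<le> R h"
    using H(1) R s(1) by (auto simp: \<sigma>_def)
  show ?thesis
  proof (intro exI[of _ G] exI[of _ \<sigma>] conjI ballI impI)
    show "finite G" using H(1) by (simp add: G_def)
    have "card G \<le> card ?H" unfolding G_def using H(1) by (intro card_image_le) auto
    moreover have "card ?H + 2 = card H"
    proof -
      have "{h1, h2} \<subseteq> H" "card {h1, h2} = 2" using h12 by auto
      then show ?thesis using card_Diff_subset[of "{h1,h2}" H] card_mono[OF H(1), of "{h1, h2}"] by simp
    qed
    ultimately show "card G + 2 \<le> local_degree E \<gamma> x" using H(2) by linarith
    show "\<sigma> > 0" by fact
    have bs: "ball x \<sigma> \<subseteq> ball x s" using \<sigma>(2) by (rule subset_ball)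
    then show "ball x \<sigma> \<subseteq> N" using s(4) by blast
    show "?X \<inter> ball x \<sigma> \<subseteq> path_image A \<union> (\<Union>g\<in>G. path_image g)"
    proof
      fix y assume y: "y \<in> ?X \<inter> ball x \<sigma>"
      then obtain h where h: "h \<in> H" "y \<in> path_image h" using H(5) bs s(2) by blast
      show "y \<in> path_image A \<union> (\<Union>g\<in>G. path_image g)"
      proof (cases "h \<in> ?H")
        case True
        have "y \<in> ball x (R h)" using y subset_ball[OF \<sigma>(3)[OF True]] by blast
        then have "y \<in> h ` {0..<\<epsilon> h}" using bspec[OF R True] h(2) by blast
        then have "y \<in> path_image (germ h)" using germ(4)[OF True] by auto
        then show ?thesis using True by (auto simp: G_def)
      next
        case False
        then show ?thesis using h y h12(5,6) bs s(3) by blast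
      qed
    qed
    {
      fix g assume "g \<in> G"
      then obtain h where h: "h \<in> ?H" "g = germ h" by (auto simp: G_def)
      note gh = germ[OF h(1), folded h(2)]
      show "arc g" "pathstart g = x" by (fact gh)+
      show "path_image g \<subseteq> ?X \<inter> N" using gh(5,6) H(4) h(1) s(4) by blast
      show "path_image g \<inter> path_image A \<subseteq> {x}" using gh(5,6) h12(7)[OF h(1)] s(3) by blast
      show "closure (?X - path_image g) \<inter> path_image g \<subseteq> {x, pathfinish g}"
      proof -
        \<comment> \<open>A closed set around everything but \<open>g\<close>: the outside of the
          disc, the other germs, and the remainder of \<open>h\<close> after the cut.\<close>
        let ?F = "- ball x s \<union> (\<Union>h'\<in>H - {h}. path_image h') \<union> h ` {\<epsilon> h..1}"
        have e: "0 < \<epsilon> h" "\<epsilon> h < 1" using bspec[OF \<epsilon> h(1)] by auto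
        have ch: "continuous_on {0..1} h" and inj: "inj_on h {0..1}" using Hs h(1) by (auto simp: arc_def path_def)
        have "compact (h ` {\<epsilon> h..1})"
          using e by (intro compact_continuous_image continuous_on_subset[OF ch]) auto
        then have "closed ?F"
          using H(1) Hs by (intro closed_Un closed_UN) (auto simp: closed_arc_image compact_imp_closed)
        moreover have "?X - path_image g \<subseteq> ?F"
        proof
          fix y assume y: "y \<in> ?X - path_image g"
          show "y \<in> ?F"
          proof (cases "y \<in> ball x s")
            case True
            then obtain k where k: "k \<in> H" "y \<in> path_image k" using H(5) s(2) y by blast
            show ?thesis
            proof (cases "k = h")
              case True
              then obtain t where t: "t \<in> {0..1}" "y = h t" using k by (auto simp: path_image_def)
              have "\<not> t \<le> \<epsilon> h" using t y gh(4) by auto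
              then show ?thesis using t by auto
            qed (use k in blast)
          qed blast
        qed
        ultimately have "closure (?X - path_image g) \<subseteq> ?F" by (rule closure_minimal[rotated])
        moreover have "?F \<inter> path_image g \<subseteq> {x, pathfinish g}"
        proof
          fix y assume y: "y \<in> ?F \<inter> path_image g"
          then consider "y \<notin> ball x s" | h' where "h' \<in> H" "h' \<noteq> h" "y \<in> path_image h'" | "y \<in> h ` {\<epsilon> h..1}" by blast
          then show "y \<in> {x, pathfinish g}"
          proof cases
            case 1
            then show ?thesis using y gh(6) by blast
          next
            case 2
            have "y \<in> ball x \<rho>" "y \<in> path_image h" using y gh(5,6) s(2) by blast+
            then show ?thesis using 2 H(6)[of h' h] h(1) by blast
          next
            case 3
            then obtain t where t: "t \<in> {\<epsilon> h..1}" "y = h t" by blast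
            obtain t' where t': "t' \<in> {0..\<epsilon> h}" "y = h t'" using y gh(4) by blast
            have "t = t'" using inj_onD[OF inj, of t t'] t t' e by auto
            then have "y = h (\<epsilon> h)" using t t' by auto
            then show ?thesis using gh(3) by simp
          qed
        qed
        ultimately show ?thesis by blast
      qed
      fix g' assume "g' \<in> G" and ne: "g \<noteq> g'"
      then obtain h' where h': "h' \<in> ?H" "g' = germ h'" by (auto simp: G_def)
      have "h \<noteq> h'" using ne h h' by blast
      then show "path_image g \<inter> path_image g' \<subseteq> {x}"
        using H(6)[of h h'] h h' gh(5,6) germ(5)[OF h'(1)] s(2) by blast
    }
  qed
qed

section \<open>Routes along one side of an arc\<close>

lemma arc_ends_in_closure:
  fixes A :: "real \<Rightarrow> complex"
  assumes "arc A"
  shows "path_image A \<subseteq> closure (path_image A - {pathstart A, pathfinish A})"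
proof -
  have cA: "continuous_on {0..1} A" and inj: "inj_on A {0..1}" using assms by (simp_all add: arc_def path_def)
  have "A ` {0<..<1} \<subseteq> path_image A - {pathstart A, pathfinish A}"
  proof
    fix y assume "y \<in> A ` {0<..<1}"
    then obtain t where "0 < t" "t < 1" "y = A t" by auto
    then show "y \<in> path_image A - {pathstart A, pathfinish A}"
      using inj_onD[OF inj, of t 0] inj_onD[OF inj, of t 1]
      by (auto simp: path_image_def pathstart_def pathfinish_def)
  qed
  then have "closure (A ` {0<..<1}) \<subseteq> closure (path_image A - {pathstart A, pathfinish A})"
    by (rule closure_mono)
  moreover have "A ` closure {0<..<1} \<subseteq> closure (A ` {0<..<1})"
    by (rule image_closure_subset) (auto simp: cA closure_subset)
  then have "path_image A \<subseteq> closure (A ` {0<..<1})" by (simp add: path_image_def)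
  ultimately show ?thesis by blast
qed

lemma connected_arc_interior:
  fixes A :: "real \<Rightarrow> complex"
  assumes "arc A"
  shows "connected (path_image A - {pathstart A, pathfinish A})"
  using assms arc_imp_simple_path connected_simple_path_endless by blast

text \<open>Janiszewski's theorem is applied to the obstacles inside \<open>I\<close> together with \<open>\<beta>\<close>, and
  to the Jordan curve formed by \<open>A\<close> and \<open>\<beta>\<close>; the two sets meet in the connected set \<open>\<beta>\<close>.\<close>

lemma connected_along_arc_side:
  fixes A \<beta> :: "real \<Rightarrow> complex"
  assumes A: "arc A" and \<beta>: "arc \<beta>"
    and ends: "pathstart A \<in> path_image \<beta>" "pathfinish A \<in> path_image \<beta>"
    and I: "connected I" "I \<inter> (path_image A \<union> path_image \<beta>) = {}"
    and Imax: "\<And>K. connected K \<Longrightarrow> K \<inter> (path_image A \<union> path_image \<beta>) = {} \<Longrightarrow> K \<inter> I \<noteq> {} \<Longrightarrow> K \<subseteq> I"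
    and X0: "compact X0"
    and \<rho>: "\<And>x. x \<in> path_image A - {pathstart A, pathfinish A} \<Longrightarrow>
       0 < \<rho> x \<and> ball x (\<rho> x) \<inter> path_image \<beta> = {} \<and> ball x (\<rho> x) \<inter> I \<inter> X0 = {}"
    and p: "x \<in> path_image A - {pathstart A, pathfinish A}" "p \<in> ball x (\<rho> x) \<inter> I"
    and q: "y \<in> path_image A - {pathstart A, pathfinish A}" "q \<in> ball y (\<rho> y) \<inter> I"
  shows "connected_component (- X0) p q"
proof -
  let ?A = "path_image A - {pathstart A, pathfinish A}"
  let ?J = "path_image A \<union> path_image \<beta>"
  let ?S = "closure (X0 \<inter> I) \<union> path_image \<beta>"
  have ball_cl: "ball x (\<rho> x) \<inter> closure (X0 \<inter> I) = {}" if "x \<in> ?A" for x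
    using \<rho>[OF that] open_Int_closure_eq_empty[of "ball x (\<rho> x)" "X0 \<inter> I"] by blast
  have "connected_component (- (?S \<union> ?J)) p q"
  proof (rule Janiszewski)
    have "bounded X0" using X0 by (rule compact_imp_bounded)
    then have "compact (closure (X0 \<inter> I))"
      by (meson bounded_subset compact_closure inf_le1)
    then show "compact ?S" using \<beta> by (intro compact_Un) (auto simp: compact_arc_image)
    show "closed ?J" using A \<beta> by (intro closed_Un) (auto simp: closed_arc_image)
    have "?S \<inter> ?J = path_image \<beta>"
    proof -
      have "x \<notin> closure (X0 \<inter> I)" if "x \<in> ?A" for x
        using ball_cl[OF that] \<rho>[OF that] centre_in_ball by blast
      then show ?thesis using ends by blast
    qed
    then show "connected (?S \<inter> ?J)" using \<beta> by (simp add: connected_arc_image)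
    have "I \<subseteq> - ?J" using I(2) by blast
    then show "connected_component (- ?J) p q"
      unfolding connected_component_def using I(1) p q by blast
    \<comment> \<open>A tube about the open arc: all its discs meet the connected set
      \<open>?A\<close>, and none meets \<open>?S\<close>. It links \<open>p\<close> and
      \<open>q\<close> off \<open>?S\<close>.\<close>
    let ?U = "\<Union>x\<in>?A. ?A \<union> ball x (\<rho> x)"
    have "connected (?A \<union> ball x (\<rho> x))" if x: "x \<in> ?A" for x
    proof (rule connected_Un)
      show "connected ?A" using A by (rule connected_arc_interior)
      show "?A \<inter> ball x (\<rho> x) \<noteq> {}" using \<rho>[OF x] x centre_in_ball by blast
    qed simp
    then have "connected ?U"
      using p(1) by (intro connected_Union) blast+
    moreover have "?U \<subseteq> - ?S"
    proof -
      have "ball x (\<rho> x) \<subseteq> - ?S" if "x \<in> ?A" for x using ball_cl[OF that] \<rho>[OF that] by blast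
      moreover have "x \<in> ball x (\<rho> x)" if "x \<in> ?A" for x using \<rho>[OF that] by simp
      ultimately show ?thesis by blast
    qed
    moreover have "p \<in> ?U" "q \<in> ?U" using p q by blast+
    ultimately show "connected_component (- ?S) p q" unfolding connected_component_def by blast
  qed
  then obtain K where K: "connected K" "K \<subseteq> - (?S \<union> ?J)" "p \<in> K" "q \<in> K"
    unfolding connected_component_def by blast
  \<comment> \<open>A connected set avoiding the Jordan curve stays on the side \<open>I\<close>,
    where \<open>?S\<close> contains all of \<open>X0\<close>.\<close>
  have "K \<subseteq> I" using Imax[OF K(1)] K(2,3) p(2) by blast
  moreover have "X0 \<inter> I \<subseteq> closure (X0 \<inter> I)" by (rule closure_subset)
  ultimately have "K \<subseteq> - X0" using K(2) by blast
  then show ?thesis unfolding connected_component_def using K by blast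
qed

lemma Jordan_side_maximal:
  fixes J :: "complex set"
  assumes "open I" "open O'" "I \<inter> O' = {}" "I \<union> O' = - J"
    "connected K" "K \<inter> J = {}" "K \<inter> I \<noteq> {}"
  shows "K \<subseteq> I"
proof -
  have "I \<inter> O' \<inter> K = {}" "K \<subseteq> I \<union> O'" using assms(3,4,6) by blast+
  then have "O' \<inter> K = {}" using connectedD[OF assms(5,1,2)] assms(7) by blast
  then show ?thesis using assms(4,6) by blast
qed

text \<open>Opens a germ at its far end: the piece removed lies in the disc about that end through
  which the route will pass.\<close>

lemma arc_truncate:
  fixes g :: "real \<Rightarrow> complex"
  assumes g: "arc g" and r: "r > 0"
  obtains c where "arc c" "path_image c \<subseteq> path_image g" "pathfinish g \<notin> path_image c"
    "path_image g - ball (pathfinish g) r \<subseteq> path_image c"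
proof -
  obtain \<epsilon> where \<epsilon>: "0 < \<epsilon>" "\<epsilon> < 1" "reversepath g ` {0..\<epsilon>} \<subseteq> ball (pathfinish g) r"
    using arc_initial_small[of "reversepath g" "ball (pathfinish g) r"] g r by (auto simp: arc_reversepath)
  let ?c = "subpath 0 (1 - \<epsilon>) g"
  have inj: "inj_on g {0..1}" using g by (simp add: arc_def)
  have im: "path_image ?c = g ` {0..1 - \<epsilon>}" using \<epsilon> by (simp add: path_image_subpath)
  show ?thesis
  proof (rule that[of ?c])
    show "arc ?c" using g \<epsilon> by (intro arc_subpath_arc) auto
    show "path_image ?c \<subseteq> path_image g" using \<epsilon> unfolding im by (auto simp: path_image_def)
    show "pathfinish g \<notin> path_image ?c"
    proof
      assume "pathfinish g \<in> path_image ?c"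
      then obtain t where "t \<in> {0..1 - \<epsilon>}" "g 1 = g t" unfolding im by (auto simp: pathfinish_def)
      then show False using inj_onD[OF inj, of 1 t] \<epsilon> by auto
    qed
    show "path_image g - ball (pathfinish g) r \<subseteq> path_image ?c"
    proof
      fix y assume y: "y \<in> path_image g - ball (pathfinish g) r"
      then obtain t where t: "t \<in> {0..1}" "y = g t" by (auto simp: path_image_def)
      have "\<not> 1 - \<epsilon> < t"
      proof
        assume "1 - \<epsilon> < t"
        then have "1 - t \<in> {0..\<epsilon>}" "reversepath g (1 - t) = y" using t by (auto simp: reversepath_def)
        then have "y \<in> ball (pathfinish g) r" using \<epsilon>(3) by blast
        then show False using y by blast
      qed
      then show "y \<in> path_image ?c" using t unfolding im by auto
    qed
  qed
qed

lemma finite_separated_nbhds: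
  fixes Y :: "complex set"
  assumes "finite Y" "closed B" "Y \<inter> B = {}"
  obtains \<kappa> where "\<kappa> > 0" "\<And>y. y \<in> Y \<Longrightarrow> cball y \<kappa> \<inter> B = {}"
    "disjoint_family_on (\<lambda>y. ball y \<kappa>) Y"
proof -
  have 1: "\<forall>\<^sub>F \<kappa> in at_right 0. \<forall>y\<in>Y. cball y \<kappa> \<subseteq> - B"
    using assms by (intro eventually_ball_finite ballI eventually_cball_subset) auto
  have pair: "\<forall>\<^sub>F \<kappa> in at_right 0. y \<noteq> y' \<longrightarrow> ball y \<kappa> \<inter> ball y' \<kappa> = {}" for y y' :: complex
  proof (cases "y = y'")
    case False
    have "ball y \<kappa> \<inter> ball y' \<kappa> = {}" if "\<kappa> < dist y y' / 2" for \<kappa>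
    proof (rule ccontr)
      assume "ball y \<kappa> \<inter> ball y' \<kappa> \<noteq> {}"
      then obtain w where "dist y w < \<kappa>" "dist y' w < \<kappa>" by auto
      then show False using dist_triangle2[of y y' w] that by (simp add: dist_commute)
    qed
    then show ?thesis using False unfolding eventually_at_right_field
      by (intro exI[of _ "dist y y' / 2"]) auto
  qed simp
  have 2: "\<forall>\<^sub>F \<kappa> in at_right 0. \<forall>y\<in>Y. \<forall>y'\<in>Y. y \<noteq> y' \<longrightarrow> ball y \<kappa> \<inter> ball y' \<kappa> = {}"
    using assms(1) pair by (intro eventually_ball_finite ballI) auto
  from eventually_happens'[OF trivial_limit_at_right_real eventually_conj[OF 1 eventually_conj[OF 2 eventually_at_right_less]]]
  obtain \<kappa> where "\<forall>y\<in>Y. cball y \<kappa> \<subseteq> - B" "\<forall>y\<in>Y. \<forall>y'\<in>Y. y \<noteq> y' \<longrightarrow> ball y \<kappa> \<inter> ball y' \<kappa> = {}" "0 < \<kappa>"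
    by blast
  then show ?thesis using that[of \<kappa>] unfolding disjoint_family_on_def by blast
qed

lemma compact_edges_image:
  assumes "drawing V E pos \<gamma>" "finite E"
  shows "compact (edges_image E \<gamma>)"
  using assms unfolding edges_image_def drawing_def by (auto intro!: compact_UN simp: compact_arc_image)

text \<open>Only the germs in \<G> that enter the side \<open>I\<close> are crossed. Separation is
  discussed for the original drawing, while the route has to suit the straightened one. The two fit
  together because outside the discs about the cut points the new edges lie in \<open>X\<close>, and
  inside the discs the route is led through the centres.\<close>

lemma route_on_side:
  fixes E :: "'a set set" and \<gamma> :: "'a set \<Rightarrow> real \<Rightarrow> complex" and A \<beta> :: "real \<Rightarrow> complex"
    and \<G> :: "(real \<Rightarrow> complex) set"
  defines "X \<equiv> edges_image E \<gamma>"
  assumes D: "drawing V E pos \<gamma>" and fin: "finite V" "finite E" "finite (crossings V E pos \<gamma>)"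
    and A: "arc A" "pathstart A = a" "pathfinish A = b" "path_image A \<subseteq> X"
    and rad: "\<forall>c\<in>{a, b}. \<exists>r>0. radial_at X c r"
    and \<beta>: "arc \<beta>" "a \<in> path_image \<beta>" "b \<in> path_image \<beta>"
    and I: "open I" "connected I" "I \<inter> (path_image A \<union> path_image \<beta>) = {}" "path_image A \<subseteq> closure I"
    and Imax: "\<And>K. connected K \<Longrightarrow> K \<inter> (path_image A \<union> path_image \<beta>) = {} \<Longrightarrow> K \<inter> I \<noteq> {} \<Longrightarrow> K \<subseteq> I"
    and fG: "finite \<G>"
    and G: "\<And>g. g \<in> \<G> \<Longrightarrow> arc g \<and> path_image g \<inter> (path_image A \<union> path_image \<beta>) = {pathstart g} \<and>
        pathstart g \<in> path_image A - {a, b} \<and>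
        closure (X - path_image g) \<inter> path_image g \<subseteq> {pathstart g, pathfinish g} \<and>
        pathfinish g \<notin> pos ` V \<union> snd ` crossings V E pos \<gamma>"
    and GG: "\<And>g h. g \<in> \<G> \<Longrightarrow> h \<in> \<G> \<Longrightarrow> g \<noteq> h \<Longrightarrow> path_image g \<inter> path_image h \<subseteq> {pathstart g}"
    and \<rho>: "\<And>x. x \<in> path_image A - {a, b} \<Longrightarrow>
       0 < \<rho> x \<and> ball x (\<rho> x) \<inter> path_image \<beta> = {} \<and>
       X \<inter> ball x (\<rho> x) \<subseteq> path_image A \<union> (\<Union>g\<in>\<G>. path_image g)"
  shows "\<exists>\<gamma>' \<eta> Y. drawing V E pos \<gamma>' \<and> crossings V E pos \<gamma>' \<subseteq> crossings V E pos \<gamma> \<and>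
    arc \<eta> \<and> pathstart \<eta> = a \<and> pathfinish \<eta> = b \<and>
    path_image \<eta> \<inter> edges_image E \<gamma>' \<subseteq> Y \<union> {a, b} \<and>
    finite Y \<and> card Y \<le> card {g \<in> \<G>. path_image g \<inter> I \<noteq> {}} \<and>
    Y \<inter> (pos ` V \<union> snd ` crossings V E pos \<gamma>) = {}"
proof -
  let ?A = "path_image A - {a, b}"
  define C where "C = {g \<in> \<G>. path_image g \<inter> I \<noteq> {}}"
  have CG: "g \<in> \<G>" if "g \<in> C" for g using that by (simp add: C_def)
  have fC: "finite C" using fG by (simp add: C_def)
  define U where "U = (\<Union>g\<in>C. path_image g)"
  have cU: "compact U" unfolding U_def using fC G CG by (intro compact_UN) (auto simp: compact_arc_image)
  have cX: "compact X" unfolding X_def using compact_edges_image[OF D fin(2)] .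
  \<comment> \<open>Janiszewski's theorem asks for closed sets. By the closure condition on germs,
    passing to the closure brings back at most the two ends of each removed germ.\<close>
  define X0 where "X0 = closure (X - U) \<union> path_image A"
  have cX0: "compact X0"
    unfolding X0_def using cX A(1)
    by (intro compact_Un) (auto simp: compact_arc_image compact_closure intro: bounded_subset compact_imp_bounded)
  have XX0: "X \<subseteq> X0 \<union> U" using closure_subset[of "X - U"] by (auto simp: X0_def)
  have aA: "a \<in> path_image A" "b \<in> path_image A" using A by auto
  have abne: "a \<noteq> b" using arc_distinct_ends[OF A(1)] A by simp

  have \<rho>0: "ball x (\<rho> x) \<inter> I \<inter> X0 = {}" if x: "x \<in> ?A" for x
  proof -
    have "ball x (\<rho> x) \<inter> I \<inter> (X - U) = {}"
    proof (rule ccontr)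
      assume "ball x (\<rho> x) \<inter> I \<inter> (X - U) \<noteq> {}"
      then obtain y where y: "y \<in> ball x (\<rho> x)" "y \<in> I" "y \<in> X" "y \<notin> U" by blast
      then obtain g where "g \<in> \<G>" "y \<in> path_image g" using \<rho>[OF x] I(3) by blast
      then show False using y unfolding U_def C_def by blast
    qed
    then have "ball x (\<rho> x) \<inter> I \<inter> closure (X - U) = {}"
      using open_Int_closure_eq_empty[of "ball x (\<rho> x) \<inter> I" "X - U"] I(1) by (simp add: open_Int)
    then show ?thesis unfolding X0_def using I(3) by blast
  qed

  \<comment> \<open>The cut points are the far ends of the germs to be crossed. Being neither
    vertices nor crossings, they lie on at most one edge each, so a passage there costs at most one
    crossing.\<close>
  define Y where "Y = pathfinish ` C"
  have fY: "finite Y" using fC by (simp add: Y_def)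
  have YA: "Y \<inter> path_image A = {}"
  proof (rule ccontr)
    assume "Y \<inter> path_image A \<noteq> {}"
    then obtain g where g: "g \<in> C" "pathfinish g \<in> path_image A" by (auto simp: Y_def)
    then have "pathfinish g = pathstart g" using G[OF CG[OF g(1)]] pathfinish_in_path_image[of g] by blast
    then show False using arc_distinct_ends[of g] G[OF CG[OF g(1)]] by simp
  qed
  have "closed (path_image A)" using A by (simp add: closed_arc_image)
  then obtain \<kappa> where \<kappa>: "\<kappa> > 0" "\<And>y. y \<in> Y \<Longrightarrow> cball y \<kappa> \<inter> path_image A = {}"
    "disjoint_family_on (\<lambda>y. ball y \<kappa>) Y"
    using finite_separated_nbhds[OF fY _ YA] by metis
  have "\<forall>y\<in>Y. open (ball y \<kappa>) \<and> y \<in> ball y \<kappa>" using \<kappa>(1) by simp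
  from straighten_drawing_many[OF D fin fY this \<kappa>(3)] obtain \<gamma>' r where
    r: "\<forall>y\<in>Y. r y > 0 \<and> cball y (r y) \<subseteq> ball y \<kappa> \<and> radial_at (edges_image E \<gamma>') y (r y)"
    and D': "drawing V E pos \<gamma>'" "crossings V E pos \<gamma>' \<subseteq> crossings V E pos \<gamma>"
    and X'1: "edges_image E \<gamma>' - (\<Union>y\<in>Y. ball y (r y)) \<subseteq> X"
    and X'2: "edges_image E \<gamma>' - (\<Union>y\<in>Y. ball y \<kappa>) = X - (\<Union>y\<in>Y. ball y \<kappa>)"
    unfolding X_def by (elim exE conjE) blast
  define X' where "X' = edges_image E \<gamma>'"
  note X' = X'1[folded X'_def] X'2[folded X'_def]
  have cballs: "cball y (r y) \<inter> cball y' (r y') = {}" if yy: "y \<in> Y" "y' \<in> Y" "y \<noteq> y'" for y y'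
  proof -
    have "ball y \<kappa> \<inter> ball y' \<kappa> = {}" using \<kappa>(3) yy unfolding disjoint_family_on_def by blast
    then show ?thesis using bspec[OF r yy(1)] bspec[OF r yy(2)] by blast
  qed

  let ?B = "\<Union>y\<in>Y. cball y \<kappa>"
  \<comment> \<open>The point \<open>p\<close> next to an end \<open>c\<close> of \<open>A\<close>
    meets two demands: it is on the side \<open>I\<close> in the disc of some inner point of
    \<open>A\<close>, and it is so close to \<open>c\<close> that, by radiality at \<open>c\<close>,
    the segment between them is free of edges.\<close>
  have near: "\<exists>x p. x \<in> ?A \<and> p \<in> ball x (\<rho> x) \<inter> I \<and> p \<notin> U \<and> p \<notin> ?B \<and> p \<notin> X' \<and> closed_segment c p \<inter> X' \<subseteq> {c}"
    if c: "c \<in> {a, b}" for c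
  proof -
    have cA: "c \<in> path_image A" using c aA by blast
    have cU': "c \<notin> U"
    proof
      assume "c \<in> U"
      then obtain g where g: "g \<in> C" "c \<in> path_image g" by (auto simp: U_def)
      have "path_image g \<inter> (path_image A \<union> path_image \<beta>) = {pathstart g}" and ps: "pathstart g \<notin> {a, b}"
        using G[OF CG[OF g(1)]] by blast+
      then have "c = pathstart g" using g(2) cA by blast
      then show False using ps c by simp
    qed
    have "c \<notin> ?B" using \<kappa>(2) cA by blast
    then have "c \<in> - (?B \<union> U)" using cU' by blast
    moreover have "closed ?B" using fY by (intro closed_UN) auto
    then have "open (- (?B \<union> U))" using compact_imp_closed[OF cU] by (intro open_Compl closed_Un)
    ultimately obtain d where d: "d > 0" "ball c d \<subseteq> - (?B \<union> U)" unfolding open_contains_ball by blast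
    obtain ra where rad: "ra > 0" "radial_at X c ra" using rad c by blast
    define d' where "d' = min d ra"
    have d': "d' > 0" "ball c d' \<subseteq> - (?B \<union> U)" "ball c d' \<subseteq> cball c ra"
      using d rad(1) by (auto simp: d'_def)
    have "c \<in> closure ?A" using arc_ends_in_closure[OF A(1)] A(2,3) cA by blast
    then have "?A \<inter> ball c d' \<noteq> {}" using d'(1) by (metis Int_commute centre_in_ball closure_iff_nhds_not_empty open_ball open_contains_ball_eq order_refl)
    then obtain x where x: "x \<in> ?A" "x \<in> ball c d'" by blast
    have "x \<in> ball c d' \<inter> ball x (\<rho> x)" using x(2) \<rho>[OF x(1)] by simp
    moreover have "x \<in> closure I" using x(1) I(4) by blast
    ultimately have "ball c d' \<inter> ball x (\<rho> x) \<inter> I \<noteq> {}"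
      using open_Int_closure_eq_empty[of "ball c d' \<inter> ball x (\<rho> x)" I] by blast
    then obtain p where p: "p \<in> ball c d'" "p \<in> ball x (\<rho> x)" "p \<in> I" by blast
    have pX: "p \<notin> X" using \<rho>0[OF x(1)] p XX0 d'(2) by blast
    have eq: "X' \<inter> ball c d' = X \<inter> ball c d'"
    proof -
      have "(\<Union>y\<in>Y. ball y \<kappa>) \<subseteq> ?B" by auto
      then have "ball c d' \<inter> (\<Union>y\<in>Y. ball y \<kappa>) = {}" using d'(2) by blast
      then show ?thesis using X'(2) by blast
    qed
    have "closed_segment c p \<subseteq> ball c d'" using p(1) d'(1) by (intro closed_segment_subset) auto
    moreover have "closed_segment c p \<inter> X \<subseteq> {c}"
      using radial_at_segment[OF rad(2) _ pX] p(1) d'(3) by blast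
    ultimately have "closed_segment c p \<inter> X' \<subseteq> {c}" using eq by blast
    moreover have "p \<notin> X'" using eq p(1) pX by blast
    ultimately show ?thesis using x(1) p d'(2) by blast
  qed
  obtain xp p where p: "xp \<in> ?A" "p \<in> ball xp (\<rho> xp) \<inter> I" "p \<notin> U" "p \<notin> ?B" "p \<notin> X'" "closed_segment a p \<inter> X' \<subseteq> {a}"
    using near[of a] by blast
  obtain xq q where q: "xq \<in> ?A" "q \<in> ball xq (\<rho> xq) \<inter> I" "q \<notin> U" "q \<notin> ?B" "q \<notin> X'" "closed_segment b q \<inter> X' \<subseteq> {b}"
    using near[of b] by blast

  have pq0: "connected_component (- X0) p q"
  proof (rule connected_along_arc_side[OF A(1) \<beta>(1) _ _ I(2,3) Imax cX0, of \<rho> xp p xq q])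
    show "0 < \<rho> x \<and> ball x (\<rho> x) \<inter> path_image \<beta> = {} \<and> ball x (\<rho> x) \<inter> I \<inter> X0 = {}"
      if "x \<in> path_image A - {pathstart A, pathfinish A}" for x
      using \<rho>[of x] \<rho>0[of x] that A(2,3) by blast
  qed (use A p q \<beta> in auto)

  have "\<forall>g\<in>C. \<exists>c. arc c \<and> path_image c \<subseteq> path_image g \<and> pathfinish g \<notin> path_image c \<and>
    path_image g - ball (pathfinish g) (r (pathfinish g)) \<subseteq> path_image c"
  proof
    fix g assume g: "g \<in> C"
    have "arc g" "r (pathfinish g) > 0" using G[OF CG[OF g]] r g by (auto simp: Y_def)
    from arc_truncate[OF this] show "\<exists>c. arc c \<and> path_image c \<subseteq> path_image g \<and> pathfinish g \<notin> path_image c \<and>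
      path_image g - ball (pathfinish g) (r (pathfinish g)) \<subseteq> path_image c" by metis
  qed
  then obtain c where c: "\<forall>g\<in>C. arc (c g) \<and> path_image (c g) \<subseteq> path_image g \<and> pathfinish g \<notin> path_image (c g) \<and>
    path_image g - ball (pathfinish g) (r (pathfinish g)) \<subseteq> path_image (c g)"
    by (rule bchoice[THEN exE])
  let ?Bo = "\<Union>y\<in>Y. ball y (r y)"
  \<comment> \<open>Taking out the open discs about the cut points detaches the germs, once
    truncated, from the rest of the drawing at their far ends.\<close>
  define M0 where "M0 = X0 - ?Bo"
  define M where "M = M0 \<union> (\<Union>h\<in>c ` C. path_image h)"
  have clM0: "closed M0" unfolding M0_def using compact_imp_closed[OF cX0] by (intro closed_Diff open_UN) auto
  have clM: "closed M" unfolding M_def using clM0 fC c by (intro closed_Un closed_UN) (auto simp: closed_arc_image)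
  have pqM: "connected_component (- M) p q"
    unfolding M_def
  proof (rule pendant_arcs_do_not_separate)
    show "finite (c ` C)" using fC by simp
    show "closed M0" by fact
    show "connected_component (- M0) p q"
      using pq0 by (rule connected_component_of_subset) (auto simp: M0_def)
    fix h assume "h \<in> c ` C"
    then obtain g where g: "g \<in> C" "h = c g" by blast
    have cg: "arc h" "path_image h \<subseteq> path_image g" "pathfinish g \<notin> path_image h" using bspec[OF c g(1)] g(2) by auto
    have gU: "path_image g \<subseteq> U" using g(1) by (auto simp: U_def)
    then show "arc h \<and> p \<notin> path_image h \<and> q \<notin> path_image h" using cg p(3) q(3) by blast
    have "path_image h \<inter> (M0 \<union> (\<Union>k\<in>c ` C - {h}. path_image k)) \<subseteq> {pathstart g}"
    proof
      fix w assume w: "w \<in> path_image h \<inter> (M0 \<union> (\<Union>k\<in>c ` C - {h}. path_image k))"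
      then have wg: "w \<in> path_image g" "w \<noteq> pathfinish g" using cg by auto
      note Gg = G[OF CG[OF g(1)]]
      consider "w \<in> closure (X - U)" | "w \<in> path_image A" | g' where "g' \<in> C" "g' \<noteq> g" "w \<in> path_image (c g')"
        using w g(2) unfolding M0_def X0_def by blast
      then show "w \<in> {pathstart g}"
      proof cases
        case 1
        have "closure (X - U) \<subseteq> closure (X - path_image g)" using gU by (intro closure_mono) blast
        then show ?thesis using 1 Gg wg by blast
      next
        case 2
        then show ?thesis using Gg wg by blast
      next
        case 3
        then have "w \<in> path_image g'" using c by blast
        then show ?thesis using GG[OF CG[OF g(1)] CG[OF 3(1)]] 3(2) wg(1) by blast
      qed
    qed
    then show "\<exists>x. path_image h \<inter> (M0 \<union> (\<Union>k\<in>c ` C - {h}. path_image k)) \<subseteq> {x}" by blast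
  qed
  have pqM': "path_component (- M) p q"
    using pqM clM open_path_connected_component[of "- M"] by (simp add: open_Compl)

  have X'M: "X' - ?Bo \<subseteq> M"
  proof
    fix w assume w: "w \<in> X' - ?Bo"
    then have "w \<in> X0 \<union> U" using X'(1) XX0 by blast
    then show "w \<in> M"
    proof
      assume "w \<in> X0"
      then show ?thesis using w unfolding M_def M0_def by blast
    next
      assume "w \<in> U"
      then obtain g where g: "g \<in> C" "w \<in> path_image g" by (auto simp: U_def)
      have "w \<notin> ball (pathfinish g) (r (pathfinish g))" using w g(1) unfolding Y_def by blast
      then have "w \<in> path_image (c g)" using bspec[OF c g(1)] g(2) by blast
      then show ?thesis using g(1) unfolding M_def by blast
    qed
  qed
  have notin: "p \<notin> cball y (r y) \<and> q \<notin> cball y (r y) \<and> radial_at X' y (r y)" if y: "y \<in> Y" for y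
  proof -
    have "cball y (r y) \<subseteq> ?B" using bspec[OF r y] ball_subset_cball[of y \<kappa>] y by blast
    then show ?thesis using p(4) q(4) bspec[OF r y] unfolding X'_def by blast
  qed
  have sph: "X' \<inter> sphere y (r y) \<subseteq> M" if y: "y \<in> Y" for y
  proof -
    have "sphere y (r y) \<inter> ?Bo = {}"
    proof (rule ccontr)
      assume "sphere y (r y) \<inter> ?Bo \<noteq> {}"
      then obtain w y' where w: "w \<in> sphere y (r y)" "y' \<in> Y" "w \<in> ball y' (r y')" by blast
      then have "y' \<noteq> y" by auto
      moreover have "w \<in> cball y (r y)" "w \<in> cball y' (r y')" using w by auto
      ultimately show False using cballs[OF y w(2)] by blast
    qed
    then show ?thesis using X'M by blast
  qed
  \<comment> \<open>Inside the discs the obstacles of \<open>M\<close> are exchanged for the radii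
    of the straightened drawing, which may be crossed at the centres.\<close>
  have "path_component (- ((M - ?Bo) \<union> (X' \<inter> (\<Union>y\<in>Y. cball y (r y)) - Y))) p q"
    using path_component_through_radial_points[OF fY pqM' notin sph cballs] by blast
  moreover have "- ((M - ?Bo) \<union> (X' \<inter> (\<Union>y\<in>Y. cball y (r y)) - Y)) \<subseteq> - (X' - Y - {a, b})"
  proof -
    have "?Bo \<subseteq> (\<Union>y\<in>Y. cball y (r y))" using ball_subset_cball by blast
    then show ?thesis using X'M by blast
  qed
  ultimately have pq: "path_component (- (X' - Y - {a, b})) p q" by (rule path_component_of_subset[rotated])
  have ap: "path_component (- (X' - Y - {a, b})) a p" using p(6) by (intro path_component_segment) blast
  have bq: "path_component (- (X' - Y - {a, b})) b q" using q(6) by (intro path_component_segment) blast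
  have "path_component (- (X' - Y - {a, b})) a b"
    using ap pq path_component_sym[OF bq] path_component_trans by blast
  then obtain \<eta>0 where \<eta>0: "path \<eta>0" "path_image \<eta>0 \<subseteq> - (X' - Y - {a, b})" "pathstart \<eta>0 = a" "pathfinish \<eta>0 = b"
    by (auto simp: path_component_def)
  obtain \<eta> where \<eta>: "arc \<eta>" "path_image \<eta> \<subseteq> path_image \<eta>0" "pathstart \<eta> = a" "pathfinish \<eta> = b"
    using path_contains_arc[OF \<eta>0(1,3,4) abne] by metis
  have "path_image \<eta> \<inter> X' \<subseteq> Y \<union> {a, b}" using \<eta>(2) \<eta>0(2) by blast
  moreover have "card Y \<le> card C" unfolding Y_def using fC by (rule card_image_le)
  moreover have "Y \<inter> (pos ` V \<union> snd ` crossings V E pos \<gamma>) = {}" unfolding Y_def using G CG by blast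
  ultimately show ?thesis
    using D' \<eta> fY unfolding C_def X'_def by blast
qed

text \<open>The complement of an arc is path-connected, and radiality makes both ends accessible
  from it by a segment. The new arc may meet other edges freely: it only serves to close
  \<open>A\<close> to a Jordan curve and so to tell the two sides of \<open>A\<close> apart.\<close>

lemma arc_complementary_arc:
  fixes A :: "real \<Rightarrow> complex"
  assumes A: "arc A" "pathstart A = a" "pathfinish A = b" "path_image A \<subseteq> X"
    and rad: "\<forall>c\<in>{a, b}. \<exists>r>0. radial_at X c r"
  obtains \<beta> where "arc \<beta>" "pathstart \<beta> = a" "pathfinish \<beta> = b" "path_image A \<inter> path_image \<beta> = {a, b}"
proof -
  let ?S = "- (path_image A - {a, b})"
  have near: "\<exists>p. p \<notin> path_image A \<and> path_component ?S c p" if c: "c = a \<or> c = b" for c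
  proof -
    obtain ra where ra: "ra > 0" and rc: "radial_at X c ra" using rad c by blast
    obtain p where p: "dist c p = ra" "p \<notin> X" using radial_at_point[OF rc ra] by auto
    have "closed_segment c p \<inter> X \<subseteq> {c}" using radial_at_segment[OF rc _ p(2)] p(1) by simp
    then have "closed_segment c p \<subseteq> ?S" using A(4) c by blast
    then show ?thesis using p(2) A(4) path_component_segment by blast
  qed
  obtain p where p: "p \<notin> path_image A" "path_component ?S a p" using near by blast
  obtain q where q: "q \<notin> path_image A" "path_component ?S b q" using near by blast
  have "path_connected (- path_image A)" using A(1) by (intro path_connected_arc_complement) auto
  then have "path_component (- path_image A) p q" using p(1) q(1) by (simp add: path_connected_component)
  then have "path_component ?S p q" by (rule path_component_of_subset[rotated]) blast
  then have "path_component ?S a b"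
    using p(2) path_component_sym[OF q(2)] path_component_trans by blast
  then obtain g where g: "path g" "path_image g \<subseteq> ?S" "pathstart g = a" "pathfinish g = b"
    by (auto simp: path_component_def)
  have "a \<noteq> b" using arc_distinct_ends[OF A(1)] A by simp
  then obtain \<beta> where \<beta>: "arc \<beta>" "path_image \<beta> \<subseteq> path_image g" "pathstart \<beta> = a" "pathfinish \<beta> = b"
    using path_contains_arc[OF g(1,3,4)] by metis
  have "path_image A \<inter> path_image \<beta> \<subseteq> {a, b}" using \<beta>(2) g(2) by blast
  moreover have "{a, b} \<subseteq> path_image A \<inter> path_image \<beta>"
    using A(2,3) \<beta>(3,4) pathstart_in_path_image[of A] pathfinish_in_path_image[of A]
      pathstart_in_path_image[of \<beta>] pathfinish_in_path_image[of \<beta>] by simp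
  ultimately show ?thesis using that \<beta> by blast
qed

lemma connected_arc_minus_start:
  fixes g :: "real \<Rightarrow> complex"
  assumes "arc g"
  shows "connected (path_image g - {pathstart g})"
proof -
  have c: "continuous_on {0..1} g" and inj: "inj_on g {0..1}" using assms by (simp_all add: arc_def path_def)
  have "path_image g - {pathstart g} = g ` ({0..1} - {0})"
    unfolding path_image_def pathstart_def using inj by (simp add: inj_on_image_set_diff)
  moreover have "{0..1} - {0} = {0<..1::real}" by auto
  ultimately have "path_image g - {pathstart g} = g ` {0<..1}" by simp
  moreover have "connected (g ` {0<..1})"
    by (intro connected_continuous_image continuous_on_subset[OF c]) auto
  ultimately show ?thesis by simp
qed

text \<open>The route is taken on the side of the arc with fewer germs, hence the factor \<open>2\<close>.\<close>

lemma route_along_arc: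
  fixes E :: "'a set set" and A :: "real \<Rightarrow> complex" and \<gamma> :: "'a set \<Rightarrow> real \<Rightarrow> complex"
  assumes D: "drawing V E pos \<gamma>" and fin: "finite V" "finite E" "finite (crossings V E pos \<gamma>)"
    and A: "arc A" "pathstart A = a" "pathfinish A = b" "path_image A \<subseteq> edges_image E \<gamma>"
    and rad: "\<forall>c\<in>{a, b}. \<exists>r>0. radial_at (edges_image E \<gamma>) c r"
    and W: "finite W" "W \<subseteq> path_image A - {a, b}"
      "\<forall>x\<in>path_image A - {a, b} - W. local_degree E \<gamma> x \<le> 2"
  shows "\<exists>\<gamma>' \<eta> Y. drawing V E pos \<gamma>' \<and> crossings V E pos \<gamma>' \<subseteq> crossings V E pos \<gamma> \<and>
    arc \<eta> \<and> pathstart \<eta> = a \<and> pathfinish \<eta> = b \<and>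
    path_image \<eta> \<inter> edges_image E \<gamma>' \<subseteq> Y \<union> {a, b} \<and>
    finite Y \<and> 2 * card Y \<le> (\<Sum>x\<in>W. local_degree E \<gamma> x - 2) \<and>
    Y \<inter> (pos ` V \<union> snd ` crossings V E pos \<gamma>) = {}"
proof -
  let ?X = "edges_image E \<gamma>"
  let ?A = "path_image A - {a, b}"
  define K where "K = pos ` V \<union> snd ` crossings V E pos \<gamma>"
  have K: "finite K" using fin by (simp add: K_def)
  obtain \<beta> where \<beta>: "arc \<beta>" "pathstart \<beta> = a" "pathfinish \<beta> = b" "path_image A \<inter> path_image \<beta> = {a, b}"
    using arc_complementary_arc[OF A rad] by metis
  let ?J = "path_image A \<union> path_image \<beta>"
  have sp: "simple_path (A +++ reversepath \<beta>)"
    using A \<beta> by (intro simple_path_join_loop) (auto simp: arc_reversepath)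
  have imJ: "path_image (A +++ reversepath \<beta>) = ?J" using A \<beta> by (simp add: path_image_join)
  have loop: "pathfinish (A +++ reversepath \<beta>) = pathstart (A +++ reversepath \<beta>)" using A \<beta> by simp
  note Jordan = Jordan_inside_outside[OF sp loop, unfolded imJ]
  have Jin: "?J \<subseteq> closure (inside ?J)" "?J \<subseteq> closure (outside ?J)"
    using Jordan by (auto simp: frontier_def)

  have clB: "closed (path_image \<beta> \<union> (K - W))"
    using closed_arc_image[OF \<beta>(1)] finite_imp_closed[of "K - W"] K by (intro closed_Un) auto
  have WB: "W \<inter> (path_image \<beta> \<union> (K - W)) = {}" using W(2) \<beta>(4) by blast
  obtain \<kappa> where \<kappa>: "\<kappa> > 0" "\<And>x. x \<in> W \<Longrightarrow> cball x \<kappa> \<inter> (path_image \<beta> \<union> (K - W)) = {}"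
    "disjoint_family_on (\<lambda>x. ball x \<kappa>) W"
    using finite_separated_nbhds[OF W(1) clB WB] by metis
  \<comment> \<open>About a point of \<open>W\<close> the neighbourhood is a disc, disjoint from the
    other ones and free of further vertices and crossings. So germs at different points are
    disjoint, and they end at ordinary points of edges. Elsewhere staying off \<beta> is
    enough.\<close>
  define N where "N x = (if x \<in> W then ball x \<kappa> else - path_image \<beta>)" for x
  have N: "open (N x)" "x \<in> N x" "N x \<inter> path_image \<beta> = {}" if x: "x \<in> ?A" for x
  proof -
    show "open (N x)" using \<beta>(1) by (auto simp: N_def closed_arc_image open_Compl)
    show "x \<in> N x" using x \<beta>(4) \<kappa>(1) by (auto simp: N_def)
    show "N x \<inter> path_image \<beta> = {}"
    proof (cases "x \<in> W")
      case True
      have "ball x \<kappa> \<subseteq> cball x \<kappa>" by auto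
      moreover have "N x = ball x \<kappa>" using True by (simp add: N_def)
      ultimately show ?thesis using \<kappa>(2)[OF True] by blast
    qed (auto simp: N_def)
  qed
  define P where "P x G \<rho> \<longleftrightarrow> finite G \<and> card G + 2 \<le> local_degree E \<gamma> x \<and> \<rho> > 0 \<and> ball x \<rho> \<subseteq> N x \<and>
    (\<forall>g\<in>G. arc g \<and> pathstart g = x \<and> path_image g \<subseteq> ?X \<inter> N x \<and>
       path_image g \<inter> path_image A \<subseteq> {x} \<and>
       closure (?X - path_image g) \<inter> path_image g \<subseteq> {x, pathfinish g}) \<and>
    (\<forall>g\<in>G. \<forall>g'\<in>G. g \<noteq> g' \<longrightarrow> path_image g \<inter> path_image g' \<subseteq> {x}) \<and>
    ?X \<inter> ball x \<rho> \<subseteq> path_image A \<union> (\<Union>g\<in>G. path_image g)" for x G \<rho>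
  have "\<exists>G \<rho>. P x G \<rho>" if x: "x \<in> ?A" for x
    unfolding P_def using x A N(1,2)[OF x] by (intro germs_off_arc[OF D fin]) auto
  then obtain G \<rho> where G\<rho>: "\<And>x. x \<in> ?A \<Longrightarrow> P x (G x) (\<rho> x)" by metis
  have G: "arc g" "pathstart g = x" "path_image g \<subseteq> N x" "path_image g \<inter> path_image A \<subseteq> {x}"
    "closure (?X - path_image g) \<inter> path_image g \<subseteq> {x, pathfinish g}" if "x \<in> ?A" "g \<in> G x" for x g
    using G\<rho>[OF that(1)] that(2) unfolding P_def by auto
  define \<G> where "\<G> = (\<Union>x\<in>W. G x)"
  have f\<G>: "finite \<G>" unfolding \<G>_def using W(1) G\<rho> W(2) unfolding P_def by blast
  have WA: "x \<in> ?A" if "x \<in> W" for x using W(2) that by blast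
  have g1: "arc g \<and> path_image g \<inter> ?J = {pathstart g} \<and>
        pathstart g \<in> path_image A - {a, b} \<and>
        closure (?X - path_image g) \<inter> path_image g \<subseteq> {pathstart g, pathfinish g} \<and>
        pathfinish g \<notin> pos ` V \<union> snd ` crossings V E pos \<gamma>" if g: "g \<in> \<G>" for g
  proof -
    obtain x where x: "x \<in> W" "g \<in> G x" using g by (auto simp: \<G>_def)
    note Gx = G[OF WA[OF x(1)] x(2)]
    have "x \<in> path_image g" using Gx(2) pathstart_in_path_image by metis
    then have "path_image g \<inter> ?J = {x}" using Gx(3,4) N(3)[OF WA[OF x(1)]] WA[OF x(1)] by blast
    moreover have "pathfinish g \<notin> K"
    proof
      assume fK: "pathfinish g \<in> K"
      have "pathfinish g \<in> ball x \<kappa>" using Gx(3) x(1) pathfinish_in_path_image[of g] unfolding N_def by auto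
      moreover have "ball x \<kappa> \<subseteq> cball x \<kappa>" by auto
      ultimately have fW: "pathfinish g \<in> W" using \<kappa>(2)[OF x(1)] fK by blast
      have "pathfinish g \<in> ball (pathfinish g) \<kappa>" using \<kappa>(1) by simp
      then have "pathfinish g = x"
        using \<kappa>(3) fW x(1) \<open>pathfinish g \<in> ball x \<kappa>\<close> unfolding disjoint_family_on_def by blast
      then show False using arc_distinct_ends[OF Gx(1)] Gx(2) by simp
    qed
    ultimately show ?thesis using Gx WA[OF x(1)] unfolding K_def by simp
  qed
  have g2: "path_image g \<inter> path_image h \<subseteq> {pathstart g}" if gh: "g \<in> \<G>" "h \<in> \<G>" "g \<noteq> h" for g h
  proof -
    obtain x y where xy: "x \<in> W" "g \<in> G x" "y \<in> W" "h \<in> G y" using gh by (auto simp: \<G>_def)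
    show ?thesis
    proof (cases "x = y")
      case True
      then show ?thesis using G\<rho>[OF WA[OF xy(1)]] xy gh(3) G(2)[OF WA[OF xy(1)] xy(2)] unfolding P_def by blast
    next
      case False
      have "path_image g \<subseteq> ball x \<kappa>" "path_image h \<subseteq> ball y \<kappa>"
        using G(3)[OF WA[OF xy(1)] xy(2)] G(3)[OF WA[OF xy(3)] xy(4)] xy(1,3) unfolding N_def by auto
      moreover have "ball x \<kappa> \<inter> ball y \<kappa> = {}"
        using \<kappa>(3) xy(1,3) False unfolding disjoint_family_on_def by blast
      ultimately show ?thesis by blast
    qed
  qed
  have \<rho>: "0 < \<rho> x \<and> ball x (\<rho> x) \<inter> path_image \<beta> = {} \<and>
       ?X \<inter> ball x (\<rho> x) \<subseteq> path_image A \<union> (\<Union>g\<in>\<G>. path_image g)" if x: "x \<in> ?A" for x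
  proof -
    note Px = G\<rho>[OF x, unfolded P_def]
    \<comment> \<open>Outside \<open>W\<close> the local degree is at most 2, all of it taken by
      \<open>A\<close>, so no germ is left there. Hence the germs in \<G> suffice at every inner
      point of \<open>A\<close>.\<close>
    have sub: "(\<Union>g\<in>G x. path_image g) \<subseteq> (\<Union>g\<in>\<G>. path_image g)"
    proof (cases "x \<in> W")
      case False
      have "card (G x) + 2 \<le> local_degree E \<gamma> x" and fin: "finite (G x)" using Px by blast+
      moreover have "local_degree E \<gamma> x \<le> 2" using W(3) x False by blast
      ultimately have "card (G x) = 0" by linarith
      then have "G x = {}" using fin by simp
      then show ?thesis by simp
    qed (auto simp: \<G>_def)
    have Px': "0 < \<rho> x" "ball x (\<rho> x) \<subseteq> N x"
      "?X \<inter> ball x (\<rho> x) \<subseteq> path_image A \<union> (\<Union>g\<in>G x. path_image g)" using Px by simp_all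
    have "ball x (\<rho> x) \<inter> path_image \<beta> = {}" using Px'(2) N(3)[OF x] by blast
    moreover have "?X \<inter> ball x (\<rho> x) \<subseteq> path_image A \<union> (\<Union>g\<in>\<G>. path_image g)"
      using Px'(3) sub by (meson Un_mono order_refl order_trans)
    ultimately show ?thesis using Px'(1) by simp
  qed

  define C where "C I = {g \<in> \<G>. path_image g \<inter> I \<noteq> {}}" for I
  have side: "\<exists>\<gamma>' \<eta> Y. drawing V E pos \<gamma>' \<and> crossings V E pos \<gamma>' \<subseteq> crossings V E pos \<gamma> \<and>
    arc \<eta> \<and> pathstart \<eta> = a \<and> pathfinish \<eta> = b \<and>
    path_image \<eta> \<inter> edges_image E \<gamma>' \<subseteq> Y \<union> {a, b} \<and> finite Y \<and> card Y \<le> card (C I) \<and>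
    Y \<inter> (pos ` V \<union> snd ` crossings V E pos \<gamma>) = {}"
    if I: "open I" "connected I" "I \<inter> ?J = {}" "?J \<subseteq> closure I"
      "\<And>K. connected K \<Longrightarrow> K \<inter> ?J = {} \<Longrightarrow> K \<inter> I \<noteq> {} \<Longrightarrow> K \<subseteq> I" for I
    unfolding C_def
  proof (rule route_on_side[where A = A and \<beta> = \<beta> and \<G> = \<G> and \<rho> = \<rho> and I = I and E = E and \<gamma> = \<gamma>])
    show "a \<in> path_image \<beta>" "b \<in> path_image \<beta>" using \<beta>(4) by blast+
    show "path_image A \<subseteq> closure I" using I(4) by blast
    show "K \<subseteq> I" if "connected K" "K \<inter> ?J = {}" "K \<inter> I \<noteq> {}" for K using that by (rule I(5))
  qed (fact D fin A rad \<beta>(1) I(1,2,3) f\<G> g1 g2 \<rho>)+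
  have maxin: "K \<subseteq> inside ?J" if "connected K" "K \<inter> ?J = {}" "K \<inter> inside ?J \<noteq> {}" for K
    using Jordan_side_maximal[of "inside ?J" "outside ?J" ?J K] Jordan that by blast
  have maxout: "K \<subseteq> outside ?J" if "connected K" "K \<inter> ?J = {}" "K \<inter> outside ?J \<noteq> {}" for K
    using Jordan_side_maximal[of "outside ?J" "inside ?J" ?J K] Jordan that by blast
  have nJ: "inside ?J \<inter> ?J = {}" "outside ?J \<inter> ?J = {}" by (rule inside_no_overlap, rule outside_no_overlap)
  have s_in: "\<exists>\<gamma>' \<eta> Y. drawing V E pos \<gamma>' \<and> crossings V E pos \<gamma>' \<subseteq> crossings V E pos \<gamma> \<and>
    arc \<eta> \<and> pathstart \<eta> = a \<and> pathfinish \<eta> = b \<and>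
    path_image \<eta> \<inter> edges_image E \<gamma>' \<subseteq> Y \<union> {a, b} \<and> finite Y \<and> card Y \<le> card (C (inside ?J)) \<and>
    Y \<inter> (pos ` V \<union> snd ` crossings V E pos \<gamma>) = {}"
    using Jordan by (intro side nJ(1) Jin(1) maxin) auto
  have s_out: "\<exists>\<gamma>' \<eta> Y. drawing V E pos \<gamma>' \<and> crossings V E pos \<gamma>' \<subseteq> crossings V E pos \<gamma> \<and>
    arc \<eta> \<and> pathstart \<eta> = a \<and> pathfinish \<eta> = b \<and>
    path_image \<eta> \<inter> edges_image E \<gamma>' \<subseteq> Y \<union> {a, b} \<and> finite Y \<and> card Y \<le> card (C (outside ?J)) \<and>
    Y \<inter> (pos ` V \<union> snd ` crossings V E pos \<gamma>) = {}"
    using Jordan by (intro side nJ(2) Jin(2) maxout) auto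
  \<comment> \<open>A germ without its starting point is connected and misses the Jordan curve,
    hence lies on one side only, and no germ is paid for on both.\<close>
  have "C (inside ?J) \<inter> C (outside ?J) = {}"
  proof (rule ccontr)
    assume "C (inside ?J) \<inter> C (outside ?J) \<noteq> {}"
    then obtain g where g: "g \<in> \<G>" "path_image g \<inter> inside ?J \<noteq> {}" "path_image g \<inter> outside ?J \<noteq> {}"
      by (auto simp: C_def)
    let ?K = "path_image g - {pathstart g}"
    have K: "connected ?K" using g1[OF g(1)] connected_arc_minus_start by blast
    have "path_image g \<inter> ?J = {pathstart g}" using g1[OF g(1)] by blast
    then have KJ: "?K \<inter> ?J = {}" "?K \<inter> inside ?J \<noteq> {}" "?K \<inter> outside ?J \<noteq> {}" using g(2,3) nJ by blast+
    have "?K \<subseteq> inside ?J" using maxin[OF K KJ(1,2)] .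
    then show False using KJ(3) Jordan by blast
  qed
  then have "card (C (inside ?J)) + card (C (outside ?J)) = card (C (inside ?J) \<union> C (outside ?J))"
    using f\<G> by (intro card_Un_disjoint[symmetric]) (auto simp: C_def)
  also have "\<dots> \<le> card \<G>" using f\<G> by (intro card_mono) (auto simp: C_def)
  also have "\<dots> \<le> (\<Sum>x\<in>W. card (G x))" unfolding \<G>_def using W(1) by (rule card_UN_le)
  also have "\<dots> \<le> (\<Sum>x\<in>W. local_degree E \<gamma> x - 2)"
  proof (rule sum_mono)
    fix x assume "x \<in> W"
    from G\<rho>[OF WA[OF this]] have "card (G x) + 2 \<le> local_degree E \<gamma> x" by (simp add: P_def)
    then show "card (G x) \<le> local_degree E \<gamma> x - 2" by linarith
  qed
  finally have le: "card (C (inside ?J)) + card (C (outside ?J)) \<le> (\<Sum>x\<in>W. local_degree E \<gamma> x - 2)" .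
  have weaken: "2 * n \<le> (\<Sum>x\<in>W. local_degree E \<gamma> x - 2)"
    if "n \<le> card (C (inside ?J)) \<and> card (C (inside ?J)) \<le> card (C (outside ?J)) \<or>
      n \<le> card (C (outside ?J)) \<and> card (C (outside ?J)) \<le> card (C (inside ?J))" for n
    using that le by linarith
  show ?thesis
  proof (cases "card (C (inside ?J)) \<le> card (C (outside ?J))")
    case True
    then show ?thesis using s_in weaken by blast
  next
    case False
    then have "card (C (outside ?J)) \<le> card (C (inside ?J))" by simp
    then show ?thesis using s_out weaken by blast
  qed
qed

section \<open>Crossing numbers and skewness\<close>

definition parabola :: "nat \<Rightarrow> complex" where
  "parabola n = Complex (real n) (real n ^ 2)"

text \<open>The chord of the curve Im z = (Re z)^2 between abscissae p and q has slope p + q and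
  intercept - p q. It meets the curve only at its ends, since (n - p)(n - q) = 0 there; so no three
  vertices placed on the curve are collinear.\<close>

lemma parabola_segment:
  assumes "z \<in> closed_segment (parabola p) (parabola q)"
  shows "Im z = (real p + real q) * Re z - real p * real q"
    and "z = parabola n \<Longrightarrow> n = p \<or> n = q"
proof -
  obtain t where t: "z = (1 - t) *\<^sub>R parabola p + t *\<^sub>R parabola q"
    using assms by (auto simp: in_segment)
  show line: "Im z = (real p + real q) * Re z - real p * real q"
    unfolding t by (simp add: parabola_def algebra_simps power2_eq_square)
  show "n = p \<or> n = q" if "z = parabola n"
  proof -
    have "(real n - real p) * (real n - real q) = 0"
      using line unfolding that by (simp add: parabola_def algebra_simps power2_eq_square)
    then show ?thesis by simp
  qed
qed

text \<open>Two common points force equal slopes and intercepts, and the sum and product of two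
  numbers determine the pair.\<close>

lemma parabola_segments_meet_once:
  assumes "z \<in> closed_segment (parabola p) (parabola q)" "z \<in> closed_segment (parabola r) (parabola s)"
    "w \<in> closed_segment (parabola p) (parabola q)" "w \<in> closed_segment (parabola r) (parabola s)" "z \<noteq> w"
  shows "{p, q} = {r, s}"
proof -
  note l = parabola_segment(1)[OF assms(1)] parabola_segment(1)[OF assms(2)]
    parabola_segment(1)[OF assms(3)] parabola_segment(1)[OF assms(4)]
  have "Re z \<noteq> Re w" using l(1,3) assms(5) by (auto simp: complex_eq_iff)
  moreover have "((real p + real q) - (real r + real s)) * (Re z - Re w) = 0"
    using l by (simp add: algebra_simps)
  ultimately have 1: "real p + real q = real r + real s" by simp
  then have 2: "real p * real q = real r * real s" using l(1,2) by simp
  have "(real r - real p) * (real r - real q) = real r * real r - (real p + real q) * real r + real p * real q"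
    by (simp add: algebra_simps)
  also have "\<dots> = 0" unfolding 1 2 by (simp add: algebra_simps)
  finally have "r = p \<or> r = q" by simp
  then show ?thesis using 1 by auto
qed

lemma inj_parabola: "inj parabola"
  by (rule injI) (simp add: parabola_def)

lemma simple_graph_finite_edges:
  assumes "simple_graph V E"
  shows "finite E"
proof -
  have "E \<subseteq> Pow V" using assms by (auto simp: simple_graph_def)
  then show ?thesis using assms finite_subset by (auto simp: simple_graph_def)
qed

text \<open>The least number in \<open>crossing_number\<close> is attained only if some drawing has
  finitely many crossings. With the vertices on the parabola, no chord contains a third vertex and
  distinct chords meet at most once.\<close>

lemma straight_line_drawing_exists:
  assumes "simple_graph V E"
  shows "\<exists>pos \<gamma>. drawing V E pos \<gamma> \<and> finite (crossings V E pos \<gamma>)"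
proof -
  have V: "finite V" and E: "finite E" using assms simple_graph_finite_edges by (auto simp: simple_graph_def)
  obtain f :: "'a \<Rightarrow> nat" where f: "inj_on f V" using finite_imp_inj_to_nat_seg[OF V] by blast
  have "\<forall>e\<in>E. \<exists>u v. e = {u, v} \<and> u \<noteq> v \<and> u \<in> V \<and> v \<in> V"
  proof
    fix e assume "e \<in> E"
    then have "e \<subseteq> V" "card e = 2" using assms by (auto simp: simple_graph_def)
    then show "\<exists>u v. e = {u, v} \<and> u \<noteq> v \<and> u \<in> V \<and> v \<in> V" by (auto simp: card_2_iff)
  qed
  then obtain a b where ab: "\<forall>e\<in>E. e = {a e, b e} \<and> a e \<noteq> b e \<and> a e \<in> V \<and> b e \<in> V" by metis
  define pos where "pos v = parabola (f v)" for v
  define \<gamma> where "\<gamma> e = linepath (pos (a e)) (pos (b e))" for e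
  have inj: "inj_on pos V" using f inj_parabola by (auto simp: pos_def inj_on_def)
  have draw: "drawing V E pos \<gamma>"
    unfolding drawing_def
  proof (intro conjI ballI)
    fix e assume e: "e \<in> E"
    note abe = bspec[OF ab e]
    show "arc (\<gamma> e)" unfolding \<gamma>_def using abe inj by (intro arc_linepath) (auto dest: inj_onD)
    have "pos ` e = pos ` {a e, b e}" using abe by simp
    then show "{pathstart (\<gamma> e), pathfinish (\<gamma> e)} = pos ` e" by (simp add: \<gamma>_def)
    show "path_image (\<gamma> e) \<inter> pos ` (V - e) = {}"
    proof (rule ccontr)
      assume "path_image (\<gamma> e) \<inter> pos ` (V - e) \<noteq> {}"
      then obtain w where w: "w \<in> V" "w \<notin> e" "pos w \<in> closed_segment (pos (a e)) (pos (b e))"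
        by (auto simp: \<gamma>_def)
      then have "f w = f (a e) \<or> f w = f (b e)" unfolding pos_def using parabola_segment(2) by blast
      then have "w = a e \<or> w = b e" using f abe w(1) by (auto dest: inj_onD)
      moreover have "a e \<in> e" "b e \<in> e" using abe by auto
      ultimately show False using w(2) by blast
    qed
  qed (rule inj)
  have fin: "finite (path_image (\<gamma> e) \<inter> path_image (\<gamma> g))" if "e \<in> E" "g \<in> E" "e \<noteq> g" for e g
  proof (rule ccontr)
    assume "infinite (path_image (\<gamma> e) \<inter> path_image (\<gamma> g))"
    then obtain z w where "z \<noteq> w" "z \<in> path_image (\<gamma> e) \<inter> path_image (\<gamma> g)" "w \<in> path_image (\<gamma> e) \<inter> path_image (\<gamma> g)"
      by (metis finite.emptyI finite.insertI finite_subset insertI1 subsetI singletonI)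
    then have "{f (a e), f (b e)} = {f (a g), f (b g)}"
      by (intro parabola_segments_meet_once[of z _ _ _ _ w]) (auto simp: \<gamma>_def pos_def)
    then have "f ` e = f ` g" using bspec[OF ab that(1)] bspec[OF ab that(2)] by (metis image_empty image_insert)
    moreover have "e \<subseteq> V" "g \<subseteq> V" using assms that by (auto simp: simple_graph_def)
    ultimately show False using f that(3) by (metis inj_on_image_eq_iff)
  qed
  have "crossings V E pos \<gamma> \<subseteq> (\<Union>(e, g)\<in>{(e, g). e \<in> E \<and> g \<in> E \<and> e \<noteq> g}. {{e, g}} \<times> (path_image (\<gamma> e) \<inter> path_image (\<gamma> g)))"
    unfolding crossings_def by blast
  moreover have "finite (\<Union>(e, g)\<in>{(e, g). e \<in> E \<and> g \<in> E \<and> e \<noteq> g}. {{e, g}} \<times> (path_image (\<gamma> e) \<inter> path_image (\<gamma> g)))"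
  proof (rule finite_UN_I)
    show "finite {(e, g). e \<in> E \<and> g \<in> E \<and> e \<noteq> g}" using E by (rule_tac finite_subset[of _ "E \<times> E"]) auto
  qed (use fin in auto)
  ultimately show ?thesis using draw finite_subset by blast
qed

lemma optimal_drawing:
  assumes "simple_graph V E"
  obtains pos \<gamma> where "drawing V E pos \<gamma>" "finite (crossings V E pos \<gamma>)"
    "card (crossings V E pos \<gamma>) = crossing_number V E"
proof -
  have "\<exists>n. \<exists>pos \<gamma>. drawing V E pos \<gamma> \<and> finite (crossings V E pos \<gamma>) \<and> card (crossings V E pos \<gamma>) = n"
    using straight_line_drawing_exists[OF assms] by blast
  from LeastI_ex[OF this] show ?thesis using that unfolding crossing_number_def by blast
qed

lemma crossing_number_le:
  assumes "drawing V E pos \<gamma>" "finite (crossings V E pos \<gamma>)"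
  shows "crossing_number V E \<le> card (crossings V E pos \<gamma>)"
  unfolding crossing_number_def by (rule Least_le) (use assms in blast)

section \<open>Local degrees at vertices and at crossings\<close>

lemma vertex_on_edge:
  assumes "drawing V E pos \<gamma>" "e \<in> E" "v \<in> V"
  shows "pos v \<in> path_image (\<gamma> e) \<longleftrightarrow> v \<in> e"
proof
  assume "pos v \<in> path_image (\<gamma> e)"
  then show "v \<in> e" using assms unfolding drawing_def by blast
next
  assume "v \<in> e"
  then have "pos v \<in> {pathstart (\<gamma> e), pathfinish (\<gamma> e)}" using assms unfolding drawing_def by blast
  then show "pos v \<in> path_image (\<gamma> e)" using pathstart_in_path_image[of "\<gamma> e"] pathfinish_in_path_image[of "\<gamma> e"] by auto
qed

lemma local_degree_vertex:
  assumes "drawing V E pos \<gamma>" "v \<in> V"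
  shows "local_degree E \<gamma> (pos v) = degree E v"
proof -
  have eq: "{e. e \<in> E \<and> pos v \<in> path_image (\<gamma> e)} = {e \<in> E. v \<in> e}"
    using vertex_on_edge[OF assms(1) _ assms(2)] by blast
  have "germ_count (\<gamma> e) (pos v) = 1" if e: "e \<in> E" "v \<in> e" for e
  proof -
    have "pos v \<in> {pathstart (\<gamma> e), pathfinish (\<gamma> e)}" using assms e unfolding drawing_def by blast
    moreover have "pathstart (\<gamma> e) \<noteq> pathfinish (\<gamma> e)"
      using assms(1) e arc_distinct_ends[of "\<gamma> e"] unfolding drawing_def by metis
    ultimately show ?thesis by (auto simp: germ_count_def)
  qed
  then show ?thesis unfolding local_degree_def eq degree_def by simp
qed

lemma local_degree_nonvertex:
  assumes "simple_graph V E" "drawing V E pos \<gamma>" "x \<notin> pos ` V"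
  shows "local_degree E \<gamma> x = 2 * card {e \<in> E. x \<in> path_image (\<gamma> e)}"
proof -
  have "germ_count (\<gamma> e) x = 2" if e: "e \<in> E" for e
  proof -
    have "{pathstart (\<gamma> e), pathfinish (\<gamma> e)} = pos ` e" "e \<subseteq> V"
      using assms e unfolding drawing_def simple_graph_def by blast+
    then have "{pathstart (\<gamma> e), pathfinish (\<gamma> e)} \<subseteq> pos ` V" by blast
    then show ?thesis using assms(3) by (auto simp: germ_count_def)
  qed
  then show ?thesis unfolding local_degree_def by simp
qed

text \<open>Two edges through \<open>x\<close> would make it a vertex or a crossing; so there is at
  most one, with two germs.\<close>

lemma local_degree_le_2:
  assumes G: "simple_graph V E" and D: "drawing V E pos \<gamma>"
    and x: "x \<notin> pos ` V \<union> snd ` crossings V E pos \<gamma>"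
  shows "local_degree E \<gamma> x \<le> 2"
proof -
  have "e = f" if "e \<in> {e \<in> E. x \<in> path_image (\<gamma> e)}" "f \<in> {e \<in> E. x \<in> path_image (\<gamma> e)}" for e f
    using drawing_common_point[OF D, of e f x] that x by blast
  moreover have "finite {e \<in> E. x \<in> path_image (\<gamma> e)}" using simple_graph_finite_edges[OF G] by simp
  ultimately have "card {e \<in> E. x \<in> path_image (\<gamma> e)} \<le> 1"
    by (metis (no_types, lifting) One_nat_def card_le_Suc0_iff_eq)
  then show ?thesis using local_degree_nonvertex[OF G D] x by simp
qed

text \<open>At a point lying on \<open>m\<close> edges, one of them in \<open>P\<close>, that edge alone already accounts for
  \<open>m - 1\<close> crossings.\<close>

lemma sum_local_degree_crossings:
  assumes G: "simple_graph V E" and D: "drawing V E pos \<gamma>" and fin: "finite (crossings V E pos \<gamma>)"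
    and P: "P \<subseteq> E" and S: "finite S" "S \<inter> pos ` V = {}" "S \<subseteq> (\<Union>e\<in>P. path_image (\<gamma> e))"
  shows "(\<Sum>x\<in>S. local_degree E \<gamma> x - 2) \<le> 2 * card {c \<in> crossings V E pos \<gamma>. \<exists>e\<in>P. e \<in> fst c}"
proof -
  have fE: "finite E" using simple_graph_finite_edges[OF G] .
  have "\<forall>x\<in>S. \<exists>e. e \<in> P \<and> x \<in> path_image (\<gamma> e)" using S(3) by blast
  then obtain h where h: "\<forall>x\<in>S. h x \<in> P \<and> x \<in> path_image (\<gamma> (h x))" by metis
  define F where "F x = {e \<in> E. x \<in> path_image (\<gamma> e)} - {h x}" for x
  \<comment> \<open>The crossings at \<open>x\<close> of the chosen edge \<open>h x\<close> with the
    other edges through \<open>x\<close>. As a crossing records its point, these sets are disjoint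
    for different \<open>x\<close>.\<close>
  define T where "T x = (\<lambda>e. ({h x, e}, x)) ` F x" for x
  have fF: "finite (F x)" for x using fE by (simp add: F_def)
  have T: "local_degree E \<gamma> x - 2 = 2 * card (T x)" if x: "x \<in> S" for x
  proof -
    have "h x \<in> {e \<in> E. x \<in> path_image (\<gamma> e)}" using h P x by blast
    then have "card (F x) = card {e \<in> E. x \<in> path_image (\<gamma> e)} - 1"
      unfolding F_def using fE by (simp add: card_Diff_singleton)
    moreover have "card (T x) = card (F x)"
      unfolding T_def by (rule card_image) (auto simp: inj_on_def doubleton_eq_iff)
    moreover have "x \<notin> pos ` V" using S(2) x by blast
    ultimately show ?thesis using local_degree_nonvertex[OF G D] by simp
  qed
  have "(\<Union>x\<in>S. T x) \<subseteq> {c \<in> crossings V E pos \<gamma>. \<exists>e\<in>P. e \<in> fst c}"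
  proof
    fix c assume "c \<in> (\<Union>x\<in>S. T x)"
    then obtain x e where x: "x \<in> S" "e \<in> F x" "c = ({h x, e}, x)" by (auto simp: T_def)
    have "h x \<in> E" "e \<in> E" "h x \<noteq> e" "x \<in> path_image (\<gamma> (h x)) \<inter> path_image (\<gamma> e) - pos ` V"
      using x(1,2) h P S(2) unfolding F_def by blast+
    then have "c \<in> crossings V E pos \<gamma>" unfolding crossings_def x(3) by blast
    moreover have "h x \<in> P" using h x(1) by blast
    ultimately show "c \<in> {c \<in> crossings V E pos \<gamma>. \<exists>e\<in>P. e \<in> fst c}" using x(3) by auto
  qed
  then have "card (\<Union>x\<in>S. T x) \<le> card {c \<in> crossings V E pos \<gamma>. \<exists>e\<in>P. e \<in> fst c}"
    using fin by (intro card_mono) auto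
  moreover have "card (\<Union>x\<in>S. T x) = (\<Sum>x\<in>S. card (T x))"
    using S(1) fF by (intro card_UN_disjoint) (auto simp: T_def)
  moreover have "(\<Sum>x\<in>S. local_degree E \<gamma> x - 2) = 2 * (\<Sum>x\<in>S. card (T x))"
    using T by (simp add: sum_distrib_left)
  ultimately show ?thesis by simp
qed

text \<open>Consecutive vertices are joined inside the drawn edge between them. The assumption on
  \<open>u\<close> serves the walk of length 0, where \<open>pos u\<close> still has to lie on an
  edge of \<open>P\<close>.\<close>

lemma path_component_along_edges:
  assumes D: "drawing V E pos \<gamma>" and P: "P \<subseteq> E" and uv: "(u, v) \<in> {(x, y). {x, y} \<in> P}\<^sup>*"
    and u: "\<exists>e\<in>P. u \<in> e"
  shows "path_component (\<Union>e\<in>P. path_image (\<gamma> e)) (pos u) (pos v)"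
  using uv
proof (induction rule: rtrancl_induct)
  case base
  obtain e where "e \<in> P" "u \<in> e" using u by blast
  then have "pos u \<in> {pathstart (\<gamma> e), pathfinish (\<gamma> e)}" using D P unfolding drawing_def by blast
  then have "pos u \<in> path_image (\<gamma> e)" using pathstart_in_path_image[of "\<gamma> e"] pathfinish_in_path_image[of "\<gamma> e"] by auto
  then show ?case using \<open>e \<in> P\<close> by (intro path_component_refl) blast
next
  case (step y z)
  then have e: "{y, z} \<in> P" by blast
  then have im: "{pathstart (\<gamma> {y, z}), pathfinish (\<gamma> {y, z})} = pos ` {y, z}" and arc: "arc (\<gamma> {y, z})"
    using D P unfolding drawing_def by blast+
  have "pos y \<in> path_image (\<gamma> {y, z})" "pos z \<in> path_image (\<gamma> {y, z})"
    using im pathstart_in_path_image[of "\<gamma> {y, z}"] pathfinish_in_path_image[of "\<gamma> {y, z}"] by (auto simp: doubleton_eq_iff)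
  then have "path_component (path_image (\<gamma> {y, z})) (pos y) (pos z)"
    using path_connected_path_image[OF arc_imp_path[OF arc]] by (simp add: path_connected_component)
  then have "path_component (\<Union>e\<in>P. path_image (\<gamma> e)) (pos y) (pos z)"
    by (rule path_component_of_subset[rotated]) (use e in blast)
  then show ?case using step.IH path_component_trans by blast
qed

text \<open>Doubling avoids halving a sum that may be odd. By \<open>cov\<close> every vertex lies
  on a remaining edge, so a route that meets the drawing only in cut points and in its own ends
  passes through no third vertex.\<close>

lemma crossing_number_add_edge:
  assumes G: "simple_graph V E" and e: "{u, v} \<in> E" "u \<noteq> v"
    and D: "drawing V (E - {{u, v}}) pos \<gamma>" and fin: "finite (crossings V (E - {{u, v}}) pos \<gamma>)"
    and cov: "\<forall>w\<in>V. \<exists>f\<in>E - {{u, v}}. w \<in> f"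
    and P: "P \<subseteq> E - {{u, v}}" and uv: "(u, v) \<in> {(x, y). {x, y} \<in> P}\<^sup>*"
  shows "2 * crossing_number V E \<le> 2 * card (crossings V (E - {{u, v}}) pos \<gamma>)
    + 2 * card {c \<in> crossings V (E - {{u, v}}) pos \<gamma>. \<exists>f\<in>P. f \<in> fst c}
    + (\<Sum>w\<in>\<Union>P - {u, v}. degree (E - {{u, v}}) w - 2)"
proof -
  define E' where "E' = E - {{u, v}}"
  note D = D[folded E'_def] and fin = fin[folded E'_def] and cov = cov[folded E'_def] and P = P[folded E'_def]
  have G': "simple_graph V E'" using G by (simp add: simple_graph_def E'_def)
  have fV: "finite V" using G by (simp add: simple_graph_def)
  have fE: "finite E'" using simple_graph_finite_edges[OF G'] .
  have uvV: "u \<in> V" "v \<in> V" using G e(1) by (auto simp: simple_graph_def)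
  have inj: "inj_on pos V" using D by (simp add: drawing_def)
  have ne: "pos u \<noteq> pos v" using inj uvV e(2) by (auto dest: inj_onD)
  have uP: "\<exists>f\<in>P. u \<in> f"
    using uv e(2) by (cases rule: converse_rtranclE) auto
  \<comment> \<open>The two ends are made radial before the route is sought; only then are they
    accessible from the complement of the drawing.\<close>
  obtain \<kappa> where \<kappa>: "\<kappa> > 0" "disjoint_family_on (\<lambda>z. ball z \<kappa>) {pos u, pos v}"
    using finite_separated_nbhds[of "{pos u, pos v}" "{}"] by auto
  have "\<forall>z\<in>{pos u, pos v}. open (ball z \<kappa>) \<and> z \<in> ball z \<kappa>" using \<kappa>(1) by simp
  from straighten_drawing_many[OF D fV fE fin _ this \<kappa>(2)]
  obtain \<gamma>1 r where r: "\<forall>z\<in>{pos u, pos v}. r z > 0 \<and> cball z (r z) \<subseteq> ball z \<kappa> \<and> radial_at (edges_image E' \<gamma>1) z (r z)"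
    and D1: "drawing V E' pos \<gamma>1" "crossings V E' pos \<gamma>1 \<subseteq> crossings V E' pos \<gamma>"
    by auto
  have rad: "\<forall>c\<in>{pos u, pos v}. \<exists>r>0. radial_at (edges_image E' \<gamma>1) c r" using r by blast
  have fin1: "finite (crossings V E' pos \<gamma>1)" using D1(2) fin finite_subset by blast
  let ?XP = "\<Union>f\<in>P. path_image (\<gamma>1 f)"
  obtain g where g: "path g" "path_image g \<subseteq> ?XP" "pathstart g = pos u" "pathfinish g = pos v"
    using path_component_along_edges[OF D1(1) P uv uP] by (auto simp: path_component_def)
  \<comment> \<open>The edges of \<open>P\<close> may cross one another, so the drawn path need not
    be injective; an arc contained in it may change edges at a crossing.\<close>
  obtain A where A: "arc A" "path_image A \<subseteq> path_image g" "pathstart A = pos u" "pathfinish A = pos v"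
    using path_contains_arc[OF g(1,3,4) ne] by metis
  have AP: "path_image A \<subseteq> ?XP" using A(2) g(2) by blast
  have AX: "path_image A \<subseteq> edges_image E' \<gamma>1" using AP P unfolding edges_image_def by blast
  define K where "K = pos ` V \<union> snd ` crossings V E' pos \<gamma>1"
  \<comment> \<open>Only vertices and crossings can have a local degree above 2.\<close>
  define W where "W = (path_image A - {pos u, pos v}) \<inter> K"
  have fW: "finite W" using fV fin1 by (simp add: W_def K_def)
  have W2: "\<forall>x\<in>path_image A - {pos u, pos v} - W. local_degree E' \<gamma>1 x \<le> 2"
    using local_degree_le_2[OF G' D1(1)] unfolding W_def K_def by blast
  have "W \<subseteq> path_image A - {pos u, pos v}" by (auto simp: W_def)
  from route_along_arc[OF D1(1) fV fE fin1 A(1,3,4) AX rad fW this W2]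
  obtain \<gamma>2 \<eta> Y where D2: "drawing V E' pos \<gamma>2" "crossings V E' pos \<gamma>2 \<subseteq> crossings V E' pos \<gamma>1"
    and \<eta>: "arc \<eta>" "pathstart \<eta> = pos u" "pathfinish \<eta> = pos v"
      "path_image \<eta> \<inter> edges_image E' \<gamma>2 \<subseteq> Y \<union> {pos u, pos v}"
    and Y: "finite Y" "2 * card Y \<le> (\<Sum>x\<in>W. local_degree E' \<gamma>1 x - 2)"
      "Y \<inter> (pos ` V \<union> snd ` crossings V E' pos \<gamma>1) = {}"
    by (elim exE conjE) blast

  let ?T = "\<Union>P - {u, v}"
  have EV: "f \<subseteq> V" if "f \<in> E'" for f using G' that unfolding simple_graph_def by blast
  have TV: "?T \<subseteq> V" using P EV by blast
  have fT: "finite ?T" using TV fV by (rule finite_subset)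
  have Wv: "W \<inter> pos ` V \<subseteq> pos ` ?T"
  proof
    fix x assume x: "x \<in> W \<inter> pos ` V"
    then obtain w where w: "w \<in> V" "x = pos w" by blast
    obtain f where f: "f \<in> P" "x \<in> path_image (\<gamma>1 f)" using x AP unfolding W_def by blast
    then have "w \<in> f" using vertex_on_edge[OF D1(1) _ w(1)] P w(2) by blast
    moreover have "w \<notin> {u, v}" using x w(2) unfolding W_def by blast
    ultimately show "x \<in> pos ` ?T" using f(1) w(2) by blast
  qed
  have "(\<Sum>x\<in>W \<inter> pos ` V. local_degree E' \<gamma>1 x - 2) \<le> (\<Sum>x\<in>pos ` ?T. local_degree E' \<gamma>1 x - 2)"
    using Wv fT by (intro sum_mono2) auto
  also have "\<dots> = (\<Sum>w\<in>?T. local_degree E' \<gamma>1 (pos w) - 2)"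
    using inj_on_subset[OF inj TV] by (simp add: sum.reindex)
  also have "\<dots> = (\<Sum>w\<in>?T. degree E' w - 2)"
    using TV by (intro sum.cong refl) (simp add: local_degree_vertex[OF D1(1)] subset_iff)
  finally have s1: "(\<Sum>x\<in>W \<inter> pos ` V. local_degree E' \<gamma>1 x - 2) \<le> (\<Sum>w\<in>?T. degree E' w - 2)" .
  let ?CP = "\<lambda>\<gamma>. {c \<in> crossings V E' pos \<gamma>. \<exists>f\<in>P. f \<in> fst c}"
  have "(\<Sum>x\<in>W - pos ` V. local_degree E' \<gamma>1 x - 2) \<le> 2 * card (?CP \<gamma>1)"
    using fW AP unfolding W_def by (intro sum_local_degree_crossings[OF G' D1(1) fin1 P]) auto
  moreover have "card (?CP \<gamma>1) \<le> card (?CP \<gamma>)" using D1(2) fin by (intro card_mono) auto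
  moreover have "(\<Sum>x\<in>W. local_degree E' \<gamma>1 x - 2) =
      (\<Sum>x\<in>W \<inter> pos ` V. local_degree E' \<gamma>1 x - 2) + (\<Sum>x\<in>W - pos ` V. local_degree E' \<gamma>1 x - 2)"
    using fW by (metis sum.Int_Diff)
  ultimately have Y2: "2 * card Y \<le> (\<Sum>w\<in>?T. degree E' w - 2) + 2 * card (?CP \<gamma>)"
    using Y(2) s1 by linarith

  define \<gamma>3 where "\<gamma>3 = \<gamma>2({u, v} := \<eta>)"
  have \<gamma>3: "\<gamma>3 {u, v} = \<eta>" "\<And>f. f \<in> E' \<Longrightarrow> \<gamma>3 f = \<gamma>2 f" by (auto simp: \<gamma>3_def E'_def)
  have split: "f \<in> E \<longleftrightarrow> f = {u, v} \<or> f \<in> E'" for f using e(1) by (auto simp: E'_def)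
  have vertX: "pos w \<in> edges_image E' \<gamma>2" if w: "w \<in> V" for w
  proof -
    obtain f where "f \<in> E'" "w \<in> f" using cov w by blast
    then show ?thesis using vertex_on_edge[OF D2(1) _ w] unfolding edges_image_def by blast
  qed
  have D3: "drawing V E pos \<gamma>3"
    unfolding drawing_def
  proof (intro conjI ballI)
    fix f assume "f \<in> E"
    then consider "f = {u, v}" | "f \<in> E'" using split by blast
    then have "arc (\<gamma>3 f) \<and> {pathstart (\<gamma>3 f), pathfinish (\<gamma>3 f)} = pos ` f \<and> path_image (\<gamma>3 f) \<inter> pos ` (V - f) = {}"
    proof cases
      case 1
      have "path_image \<eta> \<inter> pos ` (V - {u, v}) = {}"
      proof (rule ccontr)
        assume "path_image \<eta> \<inter> pos ` (V - {u, v}) \<noteq> {}"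
        then obtain w where w: "w \<in> V" "w \<noteq> u" "w \<noteq> v" "pos w \<in> path_image \<eta>" by blast
        then have "pos w \<in> Y \<union> {pos u, pos v}" using vertX \<eta>(4) by blast
        moreover have "pos w \<notin> Y" using Y(3) w(1) by blast
        ultimately show False using inj w uvV by (auto dest: inj_onD)
      qed
      then show ?thesis using 1 \<eta> \<gamma>3(1) by simp
    next
      case 2
      then show ?thesis using D2(1) \<gamma>3(2)[OF 2] unfolding drawing_def by simp
    qed
    then show "arc (\<gamma>3 f)" "{pathstart (\<gamma>3 f), pathfinish (\<gamma>3 f)} = pos ` f" "path_image (\<gamma>3 f) \<inter> pos ` (V - f) = {}"
      by blast+
  qed (rule inj)
  \<comment> \<open>The candidates for new crossings. At most one old edge passes through a cut
    point, as it is neither a vertex nor an old crossing; hence \<open>N\<close> injects into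
    \<open>Y\<close>.\<close>
  define N where "N = {({{u, v}, f}, y) | f y. f \<in> E' \<and> y \<in> Y \<and> y \<in> path_image (\<gamma>2 f)}"
  have sub: "crossings V E pos \<gamma>3 \<subseteq> crossings V E' pos \<gamma>2 \<union> N"
  proof
    fix c assume "c \<in> crossings V E pos \<gamma>3"
    then obtain f h p where c: "c = ({f, h}, p)" "f \<in> E" "h \<in> E" "f \<noteq> h"
      "p \<in> path_image (\<gamma>3 f)" "p \<in> path_image (\<gamma>3 h)" "p \<notin> pos ` V" unfolding crossings_def by blast
    have new: "({{u, v}, f'}, p) \<in> N" if "f' \<in> E'" "p \<in> path_image \<eta>" "p \<in> path_image (\<gamma>2 f')" for f'
    proof -
      have "p \<in> Y \<union> {pos u, pos v}" using that \<eta>(4) unfolding edges_image_def by blast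
      then have "p \<in> Y" using c(7) uvV by blast
      then show ?thesis using that unfolding N_def by blast
    qed
    consider "f \<in> E'" "h \<in> E'" | "f = {u, v}" "h \<in> E'" | "f \<in> E'" "h = {u, v}"
      using c(2,3,4) split by blast
    then show "c \<in> crossings V E' pos \<gamma>2 \<union> N"
    proof cases
      case 1
      then show ?thesis using c \<gamma>3(2) unfolding crossings_def by auto
    next
      case 2
      then show ?thesis using new[of h] c \<gamma>3 by auto
    next
      case 3
      then show ?thesis using new[of f] c \<gamma>3 by (auto simp: insert_commute)
    qed
  qed
  have injN: "inj_on snd N"
  proof (rule inj_onI)
    fix c d assume "c \<in> N" "d \<in> N" and cd: "snd c = snd d"
    then obtain f y h y' where c: "c = ({{u, v}, f}, y)" "f \<in> E'" "y \<in> Y" "y \<in> path_image (\<gamma>2 f)"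
      and d0: "d = ({{u, v}, h}, y')" "h \<in> E'" "y' \<in> path_image (\<gamma>2 h)"
      unfolding N_def by blast
    have "y' = y" using cd c(1) d0(1) by simp
    note d = d0[unfolded this]
    have "f = h"
    proof (rule ccontr)
      assume "f \<noteq> h"
      then have "y \<in> pos ` V \<union> snd ` crossings V E' pos \<gamma>2"
        using drawing_common_point[OF D2(1) c(2) d(2) _ c(4) d(3)] by blast
      then show False using Y(3) c(3) D2(2) by blast
    qed
    then show "c = d" using c d by simp
  qed
  have sndN: "snd ` N \<subseteq> Y" by (auto simp: N_def)
  have fN: "finite N" using injN sndN Y(1) by (metis finite_imageD finite_subset)
  have cN: "card N \<le> card Y" using card_image[OF injN] card_mono[OF Y(1) sndN] by simp
  have fin2: "finite (crossings V E' pos \<gamma>2)" using D2(2) fin1 finite_subset by blast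
  have "crossing_number V E \<le> card (crossings V E pos \<gamma>3)"
    using crossing_number_le[OF D3] sub fin2 fN finite_subset by blast
  also have "\<dots> \<le> card (crossings V E' pos \<gamma>2 \<union> N)" using sub fin2 fN by (intro card_mono) auto
  also have "\<dots> \<le> card (crossings V E' pos \<gamma>2) + card N" by (rule card_Un_le)
  also have "\<dots> \<le> card (crossings V E' pos \<gamma>) + card Y"
    using D1(2) D2(2) fin cN by (intro add_mono card_mono) auto
  finally show ?thesis using Y2 unfolding E'_def by linarith
qed

text \<open>Read backwards, this bounds the crossings on \<open>P\<close> from above: those off
  \<open>P\<close> number at least \<open>skewness V E\<close> minus \<open>card P + 1\<close>,
  where the 1 stands for \<open>e\<close> itself.\<close>

lemma skewness_le:
  assumes G: "simple_graph V E" and D: "drawing V (E - {e}) pos \<gamma>" and fin: "finite (crossings V (E - {e}) pos \<gamma>)"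
    and P: "P \<subseteq> E - {e}" and e: "e \<in> E"
  shows "skewness V E \<le> card P + 1 + card {c \<in> crossings V (E - {e}) pos \<gamma>. \<not> (\<exists>f\<in>P. f \<in> fst c)}"
proof -
  let ?N = "{c \<in> crossings V (E - {e}) pos \<gamma>. \<not> (\<exists>f\<in>P. f \<in> fst c)}"
  have "\<forall>c\<in>?N. \<exists>f. f \<in> fst c \<and> f \<in> E" unfolding crossings_def by auto
  then obtain pick where pick: "\<forall>c\<in>?N. pick c \<in> fst c \<and> pick c \<in> E" by (rule bchoice[THEN exE])
  define E0 where "E0 = insert e (P \<union> pick ` ?N)"
  have E0: "E0 \<subseteq> E" using e P pick unfolding E0_def by blast
  have "drawing V (E - E0) pos \<gamma>" using D unfolding drawing_def E0_def by blast
  moreover have "crossings V (E - E0) pos \<gamma> = {}"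
  proof (rule ccontr)
    assume "crossings V (E - E0) pos \<gamma> \<noteq> {}"
    then obtain f g p where c: "f \<in> E - E0" "g \<in> E - E0" "f \<noteq> g"
      "p \<in> path_image (\<gamma> f) \<inter> path_image (\<gamma> g) - pos ` V" unfolding crossings_def by blast
    have "f \<noteq> e" "g \<noteq> e" "f \<notin> P" "g \<notin> P" using c unfolding E0_def by blast+
    then have "({f, g}, p) \<in> crossings V (E - {e}) pos \<gamma>" using c unfolding crossings_def by blast
    then have N: "({f, g}, p) \<in> ?N" using \<open>f \<notin> P\<close> \<open>g \<notin> P\<close> by auto
    then have "pick ({f, g}, p) \<in> {f, g}" using pick by fastforce
    moreover have "pick ({f, g}, p) \<in> E0" using N unfolding E0_def by blast
    ultimately show False using c(1,2) by auto
  qed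
  ultimately have "planar_graph V (E - E0)" unfolding planar_graph_def by blast
  then have "skewness V E \<le> card E0"
    unfolding skewness_def using E0 by (intro Least_le) blast
  also have "\<dots> \<le> card P + 1 + card ?N"
  proof -
    have "card E0 \<le> Suc (card (P \<union> pick ` ?N))" unfolding E0_def by (rule card_insert_le_m1) auto
    also have "card (P \<union> pick ` ?N) \<le> card P + card (pick ` ?N)" by (rule card_Un_le)
    also have "card (pick ` ?N) \<le> card ?N" using fin by (intro card_image_le) auto
    finally show ?thesis by simp
  qed
  finally show ?thesis .
qed

lemma cycle_minus_edge:
  assumes C: "cycle_in E C" and v: "v \<in> set C"
  obtains u P where "u \<in> set C" "u \<noteq> v" "{u, v} \<in> E" "P \<subseteq> E - {{u, v}}" "card P < length C"
    "\<Union>P \<subseteq> set C" "(u, v) \<in> {(x, y). {x, y} \<in> P}\<^sup>*"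
proof -
  let ?n = "length C"
  have n: "3 \<le> ?n" and dist: "distinct C"
    and edge: "\<And>i. i < ?n \<Longrightarrow> {C ! i, C ! (Suc i mod ?n)} \<in> E"
    using C by (auto simp: cycle_in_def)
  obtain i0 where i0: "i0 < ?n" "C ! i0 = v" using v by (auto simp: in_set_conv_nth)
  have nth_eq: "C ! (i mod ?n) = C ! (j mod ?n) \<longleftrightarrow> i mod ?n = j mod ?n" for i j
  proof -
    have "0 < ?n" using n by linarith
    then show ?thesis using dist by (intro nth_eq_iff_index_eq mod_less_divisor)
  qed
  \<comment> \<open>The cycle renumbered from \<open>v\<close>, with indices modulo the length:
    \<open>c\<close> returns to \<open>v\<close> after a full turn, and \<open>P\<close> below is
    the walk from \<open>c 1\<close> back to \<open>v\<close>.\<close>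
  define c where "c j = C ! ((i0 + j) mod ?n)" for j
  have c0: "c 0 = v" "c ?n = v" using i0 by (simp_all add: c_def)
  have c_ne: "c i \<noteq> c j" if ij: "i < j" "j < ?n" for i j
  proof
    assume "c i = c j"
    then have "(i0 + j) mod ?n = (i0 + i) mod ?n" unfolding c_def nth_eq by simp
    then have "?n dvd j - i" using ij mod_eq_dvd_iff_nat[of "i0 + i" "i0 + j" ?n] by simp
    then show False using ij dvd_imp_le[of ?n "j - i"] by simp
  qed
  have c_eq: "c i = c j \<longleftrightarrow> i = j" if "i < ?n" "j < ?n" for i j
    using c_ne[of i j] c_ne[of j i] that by (metis linorder_neqE_nat)
  have cS: "c j \<in> set C" for j
  proof -
    have "0 < ?n" using n by linarith
    then show ?thesis unfolding c_def by (intro nth_mem mod_less_divisor)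
  qed
  have cE: "{c j, c (Suc j)} \<in> E" for j
  proof -
    have "0 < ?n" using n by linarith
    then have "(i0 + j) mod ?n < ?n" by (rule mod_less_divisor)
    from edge[OF this] show ?thesis by (simp add: c_def mod_Suc_eq)
  qed
  define P where "P = (\<lambda>j. {c j, c (Suc j)}) ` {1..<?n}"
  show ?thesis
  proof (rule that[of "c 1" P])
    show "c 1 \<in> set C" by (rule cS)
    show "c 1 \<noteq> v" using c_ne[of 0 1] n c0(1) by force
    show "{c 1, v} \<in> E" using cE[of 0] c0 by (simp add: insert_commute)
    show "\<Union>P \<subseteq> set C" using cS by (auto simp: P_def)
    have "card P \<le> ?n - 1" unfolding P_def by (rule order_trans[OF card_image_le]) auto
    then show "card P < ?n" using n by linarith
    show "P \<subseteq> E - {{c 1, v}}"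
    proof
      fix f assume "f \<in> P"
      then obtain j where j: "1 \<le> j" "j < ?n" "f = {c j, c (Suc j)}" by (auto simp: P_def)
      \<comment> \<open>Equality would force \<open>j = 1\<close> and \<open>c 2 = c 0\<close>,
        which a length of at least 3 excludes.\<close>
      have "f \<noteq> {c 1, v}"
      proof
        assume "f = {c 1, v}"
        then have eq: "{c j, c (Suc j)} = {c 1, c 0}" using j c0 by simp
        have "c j \<noteq> c 0" using c_ne[of 0 j] j by force
        then have "c j = c 1" "c (Suc j) = c 0" using eq by (auto simp: doubleton_eq_iff)
        then have "j = 1" using c_eq[of j 1] j n by auto
        then have "c 2 = c 0" using \<open>c (Suc j) = c 0\<close> by (simp add: numeral_2_eq_2)
        then show False using c_ne[of 0 2] n by force
      qed
      then show "f \<in> E - {{c 1, v}}" using j(3) cE by blast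
    qed
    have reach: "(c 1, c (Suc j)) \<in> {(x, y). {x, y} \<in> P}\<^sup>*" if "j < ?n" for j
      using that
    proof (induction j)
      case (Suc j)
      have "{c (Suc j), c (Suc (Suc j))} \<in> P" unfolding P_def using Suc.prems by (intro image_eqI[of _ _ "Suc j"]) auto
      then show ?case using Suc by (auto intro: rtrancl_into_rtrancl)
    qed simp
    have "Suc (?n - 1) = ?n" "?n - 1 < ?n" using n by linarith+
    from reach[OF this(2), unfolded this(1) c0(2)] show "(c 1, v) \<in> {(x, y). {x, y} \<in> P}\<^sup>*" .
  qed
qed

section \<open>From a cycle to the two bounds\<close>

lemma min_degree_le:
  assumes "finite V" "w \<in> V"
  shows "min_degree V E \<le> degree E w"
  unfolding min_degree_def using assms by (intro Min_le) auto

text \<open>The witness \<open>n\<close> is the length of the cycle, and \<open>B\<close> is the sum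
  of d(w) - 2 over its vertices other than \<open>u\<close> and \<open>v\<close>. Both bounds come
  from 2 cr \<le> 2 x + 2 y + d with d \<le> B, where x \<le> k - 1 counts all crossings and y those
  on \<open>P\<close>: one uses y \<le> x, the other y \<le> n + x - sk.\<close>

lemma crossing_number_cycle_bound:
  assumes G: "simple_graph V E" and k: "crossing_critical k V E"
    and \<delta>: "min_degree V E = \<delta>" "3 \<le> \<delta>" and C: "cycle_in E C"
  obtains n B where "real (crossing_number V E) \<le> 2 * real k - 2 + B / 2"
    "real (crossing_number V E) \<le> 2 * real k - 2 + real n - real (skewness V E) + B / 2"
    "B \<le> real_of_int (cycle_mu E C) - real \<delta> + 2"
    "(real n - 2) * (real \<delta> - 2) \<le> B"
proof -
  have fV: "finite V" using G by (simp add: simple_graph_def)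
  have Cne: "set C \<noteq> {}" and Cdist: "distinct C" using C by (auto simp: cycle_in_def)
  let ?f = "\<lambda>v. \<Sum>w \<in> set C - {v}. (int (degree E w) - 2)"
  have "cycle_mu E C \<in> ?f ` set C" unfolding cycle_mu_def using Cne by (intro Min_in) auto
  then obtain v where v: "v \<in> set C" "cycle_mu E C = ?f v" by blast
  obtain u P where u: "u \<in> set C" "u \<noteq> v" "{u, v} \<in> E" and P: "P \<subseteq> E - {{u, v}}" "card P < length C"
    "\<Union>P \<subseteq> set C" "(u, v) \<in> {(x, y). {x, y} \<in> P}\<^sup>*"
    using cycle_minus_edge[OF C v(1)] by metis
  let ?E = "E - {{u, v}}"
  have G': "simple_graph V ?E" using G by (simp add: simple_graph_def)
  obtain pos \<gamma> where D: "drawing V ?E pos \<gamma>" and fin: "finite (crossings V ?E pos \<gamma>)"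
    and card: "card (crossings V ?E pos \<gamma>) = crossing_number V ?E"
    using optimal_drawing[OF G'] by blast
  have lt: "crossing_number V ?E < k" using k u(3) unfolding crossing_critical_def by blast
  have deg: "\<delta> \<le> degree E w" if "w \<in> V" for w using min_degree_le[OF fV that, of E] \<delta>(1) by simp
  have CV: "set C \<subseteq> V"
  proof
    fix w assume "w \<in> set C"
    then obtain i where "i < length C" "w = C ! i" by (auto simp: in_set_conv_nth)
    then have "{w, C ! (Suc i mod length C)} \<in> E" using C by (auto simp: cycle_in_def)
    then show "w \<in> V" using G by (auto simp: simple_graph_def)
  qed
  \<comment> \<open>Degree at least 2 leaves every vertex an edge after one deletion.\<close>
  have cov: "\<forall>w\<in>V. \<exists>f\<in>?E. w \<in> f"
  proof
    fix w assume "w \<in> V"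
    then have "2 \<le> degree E w" using deg \<delta>(2) by force
    then have "\<not> {e \<in> E. w \<in> e} \<subseteq> {{u, v}}"
      unfolding degree_def by (metis card.empty card.insert card_mono empty_iff finite.emptyI finite.insertI not_less_eq_eq numeral_2_eq_2)
    then show "\<exists>f\<in>?E. w \<in> f" by blast
  qed
  let ?c = "crossings V ?E pos \<gamma>"
  let ?on = "{c \<in> ?c. \<exists>f\<in>P. f \<in> fst c}" and ?off = "{c \<in> ?c. \<not> (\<exists>f\<in>P. f \<in> fst c)}"
  let ?D = "\<Sum>w\<in>\<Union>P - {u, v}. degree ?E w - 2"
  define cr d where "cr = crossing_number V E" and "d = ?D"
  have main: "2 * cr \<le> 2 * card ?c + 2 * card ?on + d"
    unfolding cr_def d_def by (rule crossing_number_add_edge[OF G u(3,2) D fin cov P(1,4)])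
  have "card ?c = card ?on + card ?off"
  proof -
    have "?c = ?on \<union> ?off" by blast
    moreover have "card (?on \<union> ?off) = card ?on + card ?off" using fin by (intro card_Un_disjoint) auto
    ultimately show ?thesis by simp
  qed
  moreover have "skewness V E \<le> card P + 1 + card ?off" by (rule skewness_le[OF G D fin P(1) u(3)])
  ultimately have sk: "skewness V E + card ?on \<le> length C + card ?c" and on: "card ?on \<le> card ?c"
    using P(2) by linarith+
  define B where "B = real_of_int (\<Sum>w \<in> set C - {v} - {u}. (int (degree E w) - 2))"
  have DB: "real ?D \<le> B"
  proof -
    have "?D = (\<Sum>w\<in>\<Union>P - {u, v}. degree E w - 2)"
    proof (rule sum.cong[OF refl])
      fix w assume "w \<in> \<Union>P - {u, v}"
      then have "{e \<in> ?E. w \<in> e} = {e \<in> E. w \<in> e}" by blast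
      then show "degree ?E w - 2 = degree E w - 2" by (simp add: degree_def)
    qed
    also have "\<dots> \<le> (\<Sum>w\<in>set C - {v} - {u}. degree E w - 2)"
      using P(3) by (intro sum_mono2) auto
    finally have "int ?D \<le> (\<Sum>w\<in>set C - {v} - {u}. int (degree E w - 2))" by (simp flip: of_nat_sum)
    also have "\<dots> = (\<Sum>w \<in> set C - {v} - {u}. (int (degree E w) - 2))"
    proof (rule sum.cong[OF refl])
      fix w assume "w \<in> set C - {v} - {u}"
      then have "2 \<le> degree E w" using CV deg[of w] \<delta>(2) by force
      then show "int (degree E w - 2) = int (degree E w) - 2" by simp
    qed
    finally show ?thesis unfolding B_def by (metis of_int_le_iff of_int_of_nat_eq)
  qed
  \<comment> \<open>Leaving out \<open>u\<close> lowers the sum by d(u) - 2, which is at least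
    \<delta> - 2.\<close>
  have "cycle_mu E C = (int (degree E u) - 2) + (\<Sum>w \<in> set C - {v} - {u}. (int (degree E w) - 2))"
    unfolding v(2) using u by (intro sum.remove) auto
  then have "real_of_int (cycle_mu E C) = (real (degree E u) - 2) + B" unfolding B_def by simp
  moreover have "real \<delta> \<le> real (degree E u)" using deg u(1) CV by auto
  ultimately have B1: "B \<le> real_of_int (cycle_mu E C) - real \<delta> + 2" by linarith
  have "(real (length C) - 2) * (real \<delta> - 2) \<le> B"
  proof -
    have "card (set C - {v} - {u}) = length C - 2"
      using u v(1) distinct_card[OF Cdist] by (simp add: card_Diff_singleton)
    moreover have "2 \<le> length C" using C by (simp add: cycle_in_def)
    moreover have "real (card (set C - {v} - {u})) * (real \<delta> - 2) \<le> (\<Sum>w\<in>set C - {v} - {u}. (real (degree E w) - 2))"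
      using CV deg by (intro sum_bounded_below) auto
    ultimately show ?thesis unfolding B_def by simp
  qed
  moreover have "2 * card ?c + 2 \<le> 2 * k" using card lt by linarith
  \<comment> \<open>The total x \<le> k - 1 enters twice, directly and through the bound for the
    crossings on \<open>P\<close>; doubled, this gives 4 k - 4.\<close>
  then have "2 * cr + 4 \<le> 4 * k + d" "2 * cr + 4 + 2 * skewness V E \<le> 4 * k + 2 * length C + d"
    using main on sk by linarith+
  then have "2 * real cr + 4 \<le> 4 * real k + real d"
    "2 * real cr + 4 + 2 * real (skewness V E) \<le> 4 * real k + 2 * real (length C) + real d"
    by linarith+
  then have "real cr \<le> 2 * real k - 2 + B / 2"
    "real cr \<le> 2 * real k - 2 + real (length C) - real (skewness V E) + B / 2"
    using DB unfolding d_def by linarith+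
  ultimately show ?thesis using that B1 unfolding cr_def by blast
qed

theorem theorem4p1:
  fixes V :: "'a set" and E :: "'a set set" and C :: "'a list"
    and k \<delta> :: nat and s :: int
  assumes "simple_graph V E" and "connected_graph V E"
    and "k > 0" and "crossing_critical k V E"
    and "min_degree V E = \<delta>"
    and "cycle_in E C" and "cycle_mu E C = s"
  shows "(\<delta> = 3 \<longrightarrow>
            real (crossing_number V E) \<le> 2 * real k + (real_of_int s - 5) / 2) \<and>
         (\<delta> \<ge> 4 \<longrightarrow>
            real (crossing_number V E) \<le> 2 * real k - real (skewness V E)
              + real \<delta> * (real_of_int s - real \<delta> + 2) / (2 * (real \<delta> - 2)))"
proof (cases "3 \<le> \<delta>")
  case True
  obtain n B where b: "real (crossing_number V E) \<le> 2 * real k - 2 + B / 2"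
    "real (crossing_number V E) \<le> 2 * real k - 2 + real n - real (skewness V E) + B / 2"
    "B \<le> real_of_int s - real \<delta> + 2" "(real n - 2) * (real \<delta> - 2) \<le> B"
    using crossing_number_cycle_bound[OF assms(1,4,5) True assms(6)] assms(7) by metis
  let ?S = "real_of_int s - real \<delta> + 2"
  have d: "real \<delta> - 2 > 0" using True by simp
  \<comment> \<open>The upper bound for n - 2; the summand -2 next to 2 k turns n into n -
    2.\<close>
  define q where "q = ?S / (real \<delta> - 2)"
  have "real n - 2 \<le> q"
    using b(3,4) d by (simp add: q_def pos_le_divide_eq)
  then have "real (crossing_number V E) \<le> 2 * real k - real (skewness V E) + (q + ?S / 2)"
    using b(2,3) by argo
  also have "q + ?S / 2 = real \<delta> * ?S / (2 * (real \<delta> - 2))"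
    unfolding q_def using d by (simp add: divide_simps) (simp add: algebra_simps)
  finally have "real (crossing_number V E) \<le> 2 * real k - real (skewness V E) + real \<delta> * ?S / (2 * (real \<delta> - 2))" .
  moreover have "real (crossing_number V E) \<le> 2 * real k + (real_of_int s - 5) / 2" if "\<delta> = 3"
  proof -
    \<comment> \<open>The constant 5 arises from -2 + (s - 1)/2 = (s - 5)/2.\<close>
    have "B \<le> real_of_int s - 1" using b(3) that by simp
    then show ?thesis using b(1) by argo
  qed
  ultimately show ?thesis by blast
qed simp

end
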